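(* The quenched topological pressure of the Brownian potential, $$P^{\mathrm{quenched}}(B_{t(\cdot)})=\mathbb{E}\left[\sup_{\mu\in\mathscr{P}_\sigma(\Omega)}\left\{h(\mu)+\int_\Omega B_{t(\cdot)}\,d\mu\right\}\right],$$ exists and is finite. Moreover, with $\lambda_B$ the spectral radius (main eigenvalue) of $\mathscr{L}_{B_{t(\cdot)}}$, $$P^{\mathrm{quenched}}(B_{t(\cdot)})=\mathbb{E}[\log\lambda_B]=\mathbb{E}\left[\lim_{n\to\infty}\frac1n\log\mathscr{L}^n_{B_{t(\cdot)}}(1)(\sigma^n(x))\right]\qquad\text{for all }x\in\Omega,$$ and $$0\le P^{\mathrm{quenched}}(B_{t(\cdot)})\le\log\mathbb{E}[\lambda_B]\le\log4+\frac12.$$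
   Context: Let $\Omega=\{0,1\}^{\mathbb{N}}$ with $\mathbb{N}=\{1,2,\ldots\}$, a compact metric space with the metric $d(x,y)=2^{-N}$, $N=\inf\{i\in\mathbb{N}: x_i\neq y_i\}$, and let $\sigma:\Omega\to\Omega$ be the left shift. $\mathscr{P}_\sigma(\Omega)$ is the set of shift-invariant Borel probability measures on $\Omega$ and $h(\mu)$ is the Kolmogorov–Sinai entropy of $\mu$ (with respect to $\sigma$). $C(\Omega)$ is the space of real continuous functions on $\Omega$ with the supremum norm. For $f\in C(\Omega)$ the Ruelle operator $\mathscr{L}_f:C(\Omega)\to C(\Omega)$ is $\mathscr{L}_f(\varphi)(x)=\sum_{a=0,1}\exp(f(ax))\varphi(ax)$, where $ax=(a,x_1,x_2,\ldots)$; $\mathscr{L}^n_f(1)$ is the $n$-th iterate applied to the constant function $1$. Define $t:\Omega\to[0,1]$ by $t(x)=\sum_{n\ge1}2^{-n}x_n$. Let $\{B_s:s\in[0,1]\}$ be a standard one-dimensional Brownian motion (with $B_0=0$ and almost surely continuous paths) on a complete probability space. The Brownian potential is the random function $x\mapsto B_{t(x)}$ on $\Omega$, which is almost surely continuous, so almost surely $\mathscr{L}_{B_{t(\cdot)}}$ is a well-defined bounded operator on $C(\Omega)$. $\mathbb{E}$ denotes expectation with respect to the Wiener measure (the law of $B$). *)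

theory Defs
  imports "HOL-Probability.Probability"
begin

section \<open>The sequence space and the shift\<close>

text \<open>Sequences are indexed from 0, so the coordinate \<open>x\<^sub>n\<close> of the mathematical text is \<open>x (n - 1)\<close>
  here, and the symbols \<open>0\<close>, \<open>1\<close> are \<open>False\<close>, \<open>True\<close>. Topology and Borel sets on the sequence space
  are those of the library's product topology; \<open>open_cantor_iff\<close> below shows that this is the
  topology of the metric \<open>cantor_dist\<close>.\<close>

type_synonym cantor = "nat \<Rightarrow> bool"

definition cantor_dist :: "cantor \<Rightarrow> cantor \<Rightarrow> real" where
  "cantor_dist x y = (if x = y then 0 else (1 / 2) ^ Suc (LEAST i. x i \<noteq> y i))"

definition left_shift :: "cantor \<Rightarrow> cantor" where
  "left_shift x = (\<lambda>n. x (Suc n))"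

definition prepend :: "bool \<Rightarrow> cantor \<Rightarrow> cantor" where
  "prepend a x = (\<lambda>n. case n of 0 \<Rightarrow> a | Suc m \<Rightarrow> x m)"

definition binary_value :: "cantor \<Rightarrow> real" where
  "binary_value x = (\<Sum>n. (1 / 2) ^ Suc n * of_bool (x n))"

lemma cantor_dist_less_iff: "cantor_dist x y < (1 / 2) ^ n \<longleftrightarrow> (\<forall>i<n. x i = y i)"
proof (cases "x = y")
  case True
  then show ?thesis by (simp add: cantor_dist_def)
next
  case False
  define k where "k = (LEAST i. x i \<noteq> y i)"
  obtain j where "x j \<noteq> y j" using False unfolding fun_eq_iff by blast
  then have k: "x k \<noteq> y k" unfolding k_def by (rule LeastI)
  have eq: "x i = y i" if "i < k" for i
    using not_less_Least[OF that[unfolded k_def]] by simp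
  have "cantor_dist x y = (1 / 2) ^ Suc k"
    unfolding cantor_dist_def k_def if_not_P[OF False] ..
  moreover have "(1 / 2 :: real) ^ Suc k < (1 / 2) ^ n \<longleftrightarrow> n < Suc k"
    by (rule power_strict_decreasing_iff) simp_all
  ultimately have "cantor_dist x y < (1 / 2) ^ n \<longleftrightarrow> n < Suc k" by (simp only:)
  also have "\<dots> \<longleftrightarrow> (\<forall>i<n. x i = y i)"
  proof
    assume "n < Suc k"
    then show "\<forall>i<n. x i = y i" using eq by auto
  next
    assume "\<forall>i<n. x i = y i"
    with k have "\<not> k < n" by blast
    then show "n < Suc k" by simp
  qed
  finally show ?thesis .
qed

lemma open_cylinder: "open {y :: cantor. \<forall>i<n. x i = y i}"
proof -
  define X where "X i = (if i < n then {x i} else UNIV)" for i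
  have "finite {i. X i \<noteq> UNIV}"
    by (rule finite_subset[of _ "{..<n}"]) (auto simp: X_def)
  then have "open (PiE UNIV X)"
    by (rule open_PiE[OF discrete_topology_class.open_discrete])
  moreover have "y \<in> PiE UNIV X \<longleftrightarrow> (\<forall>i<n. x i = y i)" for y
  proof -
    have "y i \<in> X i \<longleftrightarrow> (i < n \<longrightarrow> x i = y i)" for i
      unfolding X_def by (cases "i < n") auto
    then show ?thesis by (simp add: PiE_iff)
  qed
  then have "PiE UNIV X = {y. \<forall>i<n. x i = y i}" by blast
  ultimately show ?thesis by simp
qed

lemma open_cantor_iff:
  "open U \<longleftrightarrow> (\<forall>x\<in>U. \<exists>e>0. \<forall>y. cantor_dist x y < e \<longrightarrow> y \<in> U)"
proof
  assume U: "open U"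
  show "\<forall>x\<in>U. \<exists>e>0. \<forall>y. cantor_dist x y < e \<longrightarrow> y \<in> U"
  proof
    fix x assume "x \<in> U"
    obtain X where X: "x \<in> PiE UNIV X" "finite {i. X i \<noteq> UNIV}" "PiE UNIV X \<subseteq> U"
      using product_topology_open_contains_basis[OF U[unfolded open_fun_def] \<open>x \<in> U\<close>]
      unfolding topspace_euclidean by blast
    obtain n where n: "\<And>i. X i \<noteq> UNIV \<Longrightarrow> i < n"
      using X(2) unfolding finite_nat_set_iff_bounded by blast
    have "y \<in> U" if "cantor_dist x y < (1 / 2) ^ n" for y
    proof -
      have "y i \<in> X i" for i
      proof (cases "X i = UNIV")
        case False
        then have "x i = y i" using that n unfolding cantor_dist_less_iff by blast
        moreover have "x i \<in> X i" using X(1) by (simp add: PiE_iff)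
        ultimately show ?thesis by simp
      qed simp
      then have "y \<in> PiE UNIV X" by (simp add: PiE_iff)
      then show ?thesis using X(3) by blast
    qed
    moreover have "(1 / 2 :: real) ^ n > 0" by simp
    ultimately show "\<exists>e>0. \<forall>y. cantor_dist x y < e \<longrightarrow> y \<in> U" by blast
  qed
next
  assume R: "\<forall>x\<in>U. \<exists>e>0. \<forall>y. cantor_dist x y < e \<longrightarrow> y \<in> U"
  have "\<exists>T. open T \<and> x \<in> T \<and> T \<subseteq> U" if "x \<in> U" for x
  proof -
    from R that obtain e where e: "e > 0" "\<And>y. cantor_dist x y < e \<Longrightarrow> y \<in> U" by blast
    have "(1 / 2 :: real) < 1" by simp
    with e(1) obtain n where n: "(1 / 2) ^ n < e" using real_arch_pow_inv by blast
    have "y \<in> U" if "\<forall>i<n. x i = y i" for y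
      using that[folded cantor_dist_less_iff] n by (intro e(2)) (rule less_trans)
    then have "{y. \<forall>i<n. x i = y i} \<subseteq> U" by blast
    then show ?thesis
      by (intro exI[of _ "{y. \<forall>i<n. x i = y i}"] conjI open_cylinder) simp_all
  qed
  then show "open U" by (subst open_subopen) (intro ballI)
qed

lemma compact_cantor: "compact (UNIV :: cantor set)"
proof -
  have "compact_space (product_topology (\<lambda>_. euclidean :: bool topology) (UNIV :: nat set))"
    by (intro compact_space_product_topology[THEN iffD2] disjI2 ballI)
      (simp add: compact_space_def finite_imp_compact)
  then show ?thesis
    by (simp add: euclidean_product_topology compact_space_def)
qed

text \<open>Since the sequence space is compact, the space \<open>C(\<Omega>)\<close> with the supremum norm is the
  library's Banach space \<open>cantor \<Rightarrow>\<^sub>C real\<close> of bounded continuous functions.\<close>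

lemma cantor_in_bcontfun:
  fixes g :: "cantor \<Rightarrow> real"
  assumes "continuous_on UNIV g"
  shows "g \<in> bcontfun"
  unfolding bcontfun_def
  using assms compact_imp_bounded[OF compact_continuous_image[OF assms compact_cantor]] by simp

lemma continuous_on_prepend: "continuous_on UNIV (prepend a)"
proof (rule continuous_on_coordinatewise_then_product)
  fix i show "continuous_on UNIV (\<lambda>x. prepend a x i)"
    by (cases i) (simp_all add: prepend_def continuous_on_product_coordinates)
qed

lemma continuous_on_left_shift: "continuous_on UNIV left_shift"
  unfolding left_shift_def
  by (intro continuous_on_coordinatewise_then_product continuous_on_product_coordinates)

lemma summable_binary_value: "summable (\<lambda>n. (1 / 2 :: real) ^ Suc n * of_bool (x n))"
  by (rule summable_comparison_test'[of "\<lambda>n. (1 / 2 :: real) ^ n" 0]) (auto simp: summable_geometric)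

lemma binary_value_range: "binary_value x \<in> {0..1}"
proof -
  have s: "(\<lambda>n. (1 / 2 :: real) ^ Suc n) sums 1"
    using power_half_series .
  have "binary_value x \<le> (\<Sum>n. (1 / 2 :: real) ^ Suc n)"
    unfolding binary_value_def
    by (intro suminf_le summable_binary_value sums_summable[OF s]) auto
  moreover have "0 \<le> binary_value x"
    unfolding binary_value_def by (intro suminf_nonneg summable_binary_value) auto
  ultimately show ?thesis using sums_unique[OF s] by simp
qed

lemma continuous_on_binary_value: "continuous_on UNIV binary_value"
proof -
  have lim: "uniform_limit UNIV (\<lambda>n (x :: cantor). \<Sum>i<n. (1 / 2 :: real) ^ Suc i * of_bool (x i))
      (\<lambda>x. \<Sum>i. (1 / 2) ^ Suc i * of_bool (x i)) sequentially"
  proof (rule Weierstrass_m_test)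
    show "summable (\<lambda>n. (1 / 2 :: real) ^ n)" by (simp add: summable_geometric)
  qed auto
  have coord: "continuous_on UNIV (\<lambda>x :: cantor. of_bool (x i) :: real)" for i
  proof -
    have "continuous_on UNIV (of_bool :: bool \<Rightarrow> real)"
      by (simp add: continuous_on_open_vimage discrete_topology_class.open_discrete)
    then show ?thesis
      by (rule continuous_on_compose2) (rule continuous_on_product_coordinates, simp)
  qed
  have "continuous_on UNIV (\<lambda>x :: cantor. \<Sum>i<n. (1 / 2 :: real) ^ Suc i * of_bool (x i))" for n
    by (intro continuous_on_sum continuous_on_mult continuous_on_const coord)
  then show ?thesis
    using uniform_limit_theorem[OF always_eventually lim] unfolding binary_value_def by simp
qed

section \<open>The Ruelle operator and its spectral radius\<close>

definition ruelle :: "(cantor \<Rightarrow>\<^sub>C real) \<Rightarrow> (cantor \<Rightarrow>\<^sub>C real) \<Rightarrow> (cantor \<Rightarrow>\<^sub>C real)" where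
  "ruelle f \<phi> = Bcontfun (\<lambda>x. \<Sum>a\<in>UNIV. exp (f (prepend a x)) * \<phi> (prepend a x))"

lemma ruelle_apply:
  "apply_bcontfun (ruelle f \<phi>) x = (\<Sum>a\<in>UNIV. exp (f (prepend a x)) * \<phi> (prepend a x))"
proof -
  have c: "continuous_on UNIV (\<lambda>x. apply_bcontfun g (prepend a x))" for g :: "cantor \<Rightarrow>\<^sub>C real" and a
    by (rule continuous_on_compose2[OF continuous_on_apply_bcontfun continuous_on_prepend subset_UNIV])
  have "(\<lambda>x. \<Sum>a\<in>UNIV. exp (f (prepend a x)) * \<phi> (prepend a x)) \<in> bcontfun"
    by (intro cantor_in_bcontfun continuous_intros c)
  then show ?thesis
    unfolding ruelle_def by (simp only: Bcontfun_inverse)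
qed

text \<open>The spectrum of a bounded operator \<open>T\<close> on a real Banach space is that of its complexification
  \<open>u + i v \<mapsto> T u + i T v\<close>. Writing \<open>u + i v\<close> as the pair \<open>(u, v)\<close>, the operator
  \<open>z - T\<close> on the complexification is \<open>complex_pencil z T\<close>.\<close>

definition complex_pencil ::
    "complex \<Rightarrow> ('a::real_normed_vector \<Rightarrow> 'a) \<Rightarrow> 'a \<times> 'a \<Rightarrow> 'a \<times> 'a" where
  "complex_pencil z T = (\<lambda>(u, v).
     (Re z *\<^sub>R u - Im z *\<^sub>R v - T u, Im z *\<^sub>R u + Re z *\<^sub>R v - T v))"

definition spectrum :: "('a::real_normed_vector \<Rightarrow> 'a) \<Rightarrow> complex set" where
  "spectrum T = {z. \<not> (\<exists>S. bounded_linear S \<and>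
     S \<circ> complex_pencil z T = id \<and> complex_pencil z T \<circ> S = id)}"

definition spectral_radius :: "('a::real_normed_vector \<Rightarrow> 'a) \<Rightarrow> real" where
  "spectral_radius T = (SUP z\<in>spectrum T. cmod z)"

section \<open>Kolmogorov--Sinai entropy and pressure\<close>

definition partition_entropy :: "'a measure \<Rightarrow> 'a set set \<Rightarrow> real" where
  "partition_entropy M P = - (\<Sum>A\<in>P. measure M A * ln (measure M A))"

text \<open>The nonempty atoms of the join of \<open>T\<^sup>-\<^sup>i P\<close> for \<open>i < n\<close>:\<close>

definition iterated_join :: "'a measure \<Rightarrow> ('a \<Rightarrow> 'a) \<Rightarrow> 'a set set \<Rightarrow> nat \<Rightarrow> 'a set set" where
  "iterated_join M T P n =
     {C. C \<noteq> {} \<and> (\<exists>A. (\<forall>i<n. A i \<in> P) \<and> C = {x \<in> space M. \<forall>i<n. (T ^^ i) x \<in> A i})}"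

definition entropy_wrt_partition :: "'a measure \<Rightarrow> ('a \<Rightarrow> 'a) \<Rightarrow> 'a set set \<Rightarrow> real" where
  "entropy_wrt_partition M T P = lim (\<lambda>n. partition_entropy M (iterated_join M T P n) / real n)"

definition ks_entropy :: "'a measure \<Rightarrow> ('a \<Rightarrow> 'a) \<Rightarrow> ereal" where
  "ks_entropy M T =
     (SUP P\<in>{P. finite P \<and> P \<subseteq> sets M \<and> partition_on (space M) P}. ereal (entropy_wrt_partition M T P))"

definition shift_invariant_measures :: "cantor measure set" where
  "shift_invariant_measures =
     {\<mu>. prob_space \<mu> \<and> sets \<mu> = sets borel \<and> distr \<mu> borel left_shift = \<mu>}"

definition topological_pressure :: "(cantor \<Rightarrow>\<^sub>C real) \<Rightarrow> ereal" where
  "topological_pressure f =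
     (SUP \<mu>\<in>shift_invariant_measures. ks_entropy \<mu> left_shift + ereal (\<integral>x. f x \<partial>\<mu>))"

section \<open>Brownian motion and the Brownian potential\<close>

locale standard_brownian_motion = prob_space M for M :: "'w measure" +
  fixes B :: "real \<Rightarrow> 'w \<Rightarrow> real"
  assumes random_variable: "s \<in> {0..1} \<Longrightarrow> B s \<in> borel_measurable M"
    and start: "AE \<omega> in M. B 0 \<omega> = 0"
    and gaussian_increments: "0 \<le> s \<Longrightarrow> s < u \<Longrightarrow> u \<le> 1 \<Longrightarrow>
      distributed M lborel (\<lambda>\<omega>. B u \<omega> - B s \<omega>) (normal_density 0 (sqrt (u - s)))"
    and independent_increments: "(\<And>i. i \<le> n \<Longrightarrow> \<tau> i \<in> {0..1}) \<Longrightarrow>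
      (\<And>i. i < n \<Longrightarrow> \<tau> i \<le> \<tau> (Suc i)) \<Longrightarrow>
      indep_vars (\<lambda>_. borel) (\<lambda>i \<omega>. B (\<tau> (Suc i)) \<omega> - B (\<tau> i) \<omega>) {..<n::nat}"
    and continuous_paths: "AE \<omega> in M. continuous_on {0..1} (\<lambda>s. B s \<omega>)"

text \<open>On the null set of discontinuous paths the value of \<open>Bcontfun\<close> is arbitrary.\<close>

definition brownian_potential :: "(real \<Rightarrow> 'w \<Rightarrow> real) \<Rightarrow> 'w \<Rightarrow> (cantor \<Rightarrow>\<^sub>C real)" where
  "brownian_potential B \<omega> = Bcontfun (\<lambda>x. B (binary_value x) \<omega>)"

lemma (in standard_brownian_motion) brownian_potential_apply:
  "AE \<omega> in M. \<forall>x. apply_bcontfun (brownian_potential B \<omega>) x = B (binary_value x) \<omega>"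
  using continuous_paths
proof eventually_elim
  case (elim \<omega>)
  have "continuous_on UNIV (\<lambda>x. B (binary_value x) \<omega>)"
    by (rule continuous_on_compose2[OF elim continuous_on_binary_value])
      (use binary_value_range in auto)
  then show ?case
    unfolding brownian_potential_def by (simp add: Bcontfun_inverse cantor_in_bcontfun)
qed

definition quenched_pressure :: "'w measure \<Rightarrow> (real \<Rightarrow> 'w \<Rightarrow> real) \<Rightarrow> real" where
  "quenched_pressure M B =
     (\<integral>\<omega>. real_of_ereal (topological_pressure (brownian_potential B \<omega>)) \<partial>M)"

definition brownian_spectral_radius :: "(real \<Rightarrow> 'w \<Rightarrow> real) \<Rightarrow> 'w \<Rightarrow> real" where
  "brownian_spectral_radius B \<omega> = spectral_radius (ruelle (brownian_potential B \<omega>))"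

end

(* Idea.  For a single continuous potential f on the full shift everything reduces to one number p(f),
   the limit of (1/n) log of the sup norm of L_f^n 1, which exists by subadditivity.  Since L_f^n 1 (y)
   is a sum of exp of Birkhoff sums over the 2^n words prepended to y, and Birkhoff sums of a continuous
   f vary only by o(n) on n-cylinders, the limit may be taken at arbitrary points y = y_n.

   exp p(f) is the spectral radius: outside that radius the Neumann series converges, and if
   r = exp p(f) were in the resolvent set, then u = (l - L_f)^(-1) (l 1) would stay bounded as l
   decreases to r, so that L_f u <= (l - e) u with fixed e > 0, which forces a growth rate below r.

   The variational principle follows from Gibbs' inequality: the entropy of a random variable W is at
   most - E log q(U, W) for every subprobability q on the joint range of (U, W).  Choosing q by hand
   gives subadditivity of the entropies; the upper bound, where q combines the Gibbs weights of cylinders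
   with a noisy channel that accounts for approximating a partition by cylinders; and the lower bound
   for the measures obtained by concatenating independent blocks distributed by Gibbs weights.

   For Brownian paths, Levy's maximal inequality and E exp(B_1) = exp(1/2) give
   E exp(max B) <= 2 exp(1/2), and 1 <= lambda_B <= 2 exp(max B) almost surely.  Jensen's inequality
   concludes. *)

theory Submission
  imports Defs
begin

section \<open>Subadditivity, Gibbs inequality and Neumann series\<close>

text \<open>For a merely continuous f the distortion on n-cylinders is not a constant but an error n
  e with e > 0 arbitrary; every estimate therefore carries a spare e and is divided by n at the end.
  In the spectral part the function u serves as an approximate positive eigenfunction.

  The entropy supremum runs over all finite Borel partitions, whose atoms need not be unions of
  cylinders. This is why the channel has to be noisy: a channel that trusted the approximation would
  give weight 0 to mislabelled words, and Gibbs' inequality demands positive weight wherever the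
  true law charges.

  The supremum over invariant measures is not visibly measurable in the path; its identification
  with a limit of finite sums of values of B settles this. The constant log 4 + 1/2 is log 2 for the
  two inverse branches, log 2 for Levy's inequality, and 1/2 for the exponential moment of a
  standard normal variable.\<close>

lemma subadditive_mult_le:
  fixes a :: "nat \<Rightarrow> real"
  assumes sub: "\<And>m n. a (m + n) \<le> a m + a n"
  shows "a (k * m + r) \<le> real k * a m + a r"
proof (induction k)
  case (Suc k)
  have "a (m + (k * m + r)) \<le> a m + a (k * m + r)" by (rule sub)
  with Suc show ?case by (simp add: algebra_simps)
qed simp

text \<open>Fekete's lemma, with limit the infimum of \<open>a n / n\<close>. The lower bound keeps
  the infimum finite and, at n = 0, gives the second conclusion, where no quotient is
  available.\<close>

lemma subadditive_limit:
  fixes a :: "nat \<Rightarrow> real"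
  assumes sub: "\<And>m n. a (m + n) \<le> a m + a n"
    and lower: "\<And>n. - c * real n \<le> a n"
  obtains l where "(\<lambda>n. a n / real n) \<longlonglongrightarrow> l" "\<And>n. real n * l \<le> a n"
proof -
  define l where "l = (INF n\<in>{1..}. a n / real n)"
  have bdd: "bdd_below ((\<lambda>n. a n / real n) ` {1..})"
    by (rule bdd_belowI2[where m = "- c"]) (use lower in \<open>simp add: pos_le_divide_eq\<close>)
  have le: "l \<le> a n / real n" if "n \<ge> 1" for n
    unfolding l_def by (rule cINF_lower[OF bdd]) (use that in simp)
  have "(\<lambda>n. a n / real n) \<longlonglongrightarrow> l"
  proof (rule LIMSEQ_I)
    fix e :: real assume e: "e > 0"
    have "\<exists>m\<in>{1..}. a m / real m < l + e / 2"
      unfolding l_def using e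
      by (subst cINF_less_iff[symmetric]) (use bdd in auto)
    then obtain m where m: "m \<ge> 1" "a m / real m < l + e / 2" by auto
    \<comment> \<open>Bounds the remainder terms \<open>a r\<close> for r < m together with the
      linear term that accompanies them, so that division by m with remainder yields
      \<open>up\<close> for every n.\<close>
    define K where "K = Max ((\<lambda>r. \<bar>a r\<bar>) ` {..<m}) + \<bar>real m * (l + e / 2)\<bar>"
    have fin: "finite ((\<lambda>r. \<bar>a r\<bar>) ` {..<m})" by simp
    have K: "a r - real r * (l + e / 2) \<le> K" if "r < m" for r
    proof -
      have "\<bar>a r\<bar> \<le> Max ((\<lambda>r. \<bar>a r\<bar>) ` {..<m})"
        by (rule Max_ge[OF fin]) (use that in simp)
      moreover have "\<bar>real r * (l + e / 2)\<bar> \<le> \<bar>real m * (l + e / 2)\<bar>"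
        unfolding abs_mult using that by (intro mult_right_mono) auto
      ultimately show ?thesis unfolding K_def by linarith
    qed
    have up: "a n \<le> real n * (l + e / 2) + K" for n
    proof -
      have "a n \<le> real (n div m) * a m + a (n mod m)"
        using subadditive_mult_le[of a "n div m" m "n mod m", OF sub] by simp
      also have "real (n div m) * a m \<le> real (n div m) * (real m * (l + e / 2))"
        using m by (intro mult_left_mono) (simp_all add: divide_less_eq mult.commute)
      also have "a (n mod m) \<le> real (n mod m) * (l + e / 2) + K"
        using K[of "n mod m"] m(1) by simp
      finally have "a n \<le> (real (n div m) * real m + real (n mod m)) * (l + e / 2) + K"
        by (simp add: algebra_simps)
      also have "real (n div m) * real m + real (n mod m) = real n"
        by (metis div_mult_mod_eq of_nat_add of_nat_mult)
      finally show ?thesis .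
    qed
    obtain n0 where n0: "real n0 > 2 * K / e" using reals_Archimedean2 by blast
    show "\<exists>no. \<forall>n\<ge>no. norm (a n / real n - l) < e"
    proof (intro exI allI impI)
      fix n assume n: "n \<ge> max 1 n0"
      have "2 * K / e < real n" using n n0 by simp
      then have "K < real n * (e / 2)" using e by (simp add: field_simps)
      with up[of n] have "a n < real n * (l + e)" by (simp add: algebra_simps)
      then have "a n / real n < l + e" using n by (simp add: divide_less_eq mult.commute)
      with le[of n] n show "norm (a n / real n - l) < e" by simp
    qed
  qed
  moreover have "real n * l \<le> a n" for n
  proof (cases "n = 0")
    case True
    then show ?thesis using lower[of 0] by simp
  next
    case False
    then show ?thesis using le[of n] by (simp add: pos_le_divide_eq mult.commute)
  qed
  ultimately show ?thesis using that by blast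
qed

text \<open>Termwise \<open>ln t \<le> t - 1\<close>, with t the quotient of \<open>q u w\<close> by
  the marginal of p at w. As this marginal dominates \<open>p u w\<close>, the terms add up to at
  most the difference of the totals, which \<open>le\<close> makes nonpositive. Positivity of q
  where p charges matters because \<open>ln 0 = 0\<close> would make forbidden pairs cost
  nothing.\<close>

lemma gibbs_marginal:
  fixes p q :: "'a \<Rightarrow> 'b \<Rightarrow> real"
  assumes "finite A" "finite K"
    and p: "\<And>u w. u \<in> A \<Longrightarrow> w \<in> K \<Longrightarrow> 0 \<le> p u w"
    and q: "\<And>u w. u \<in> A \<Longrightarrow> w \<in> K \<Longrightarrow> 0 \<le> q u w"
    and pq: "\<And>u w. u \<in> A \<Longrightarrow> w \<in> K \<Longrightarrow> 0 < p u w \<Longrightarrow> 0 < q u w"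
    and le: "(\<Sum>w\<in>K. \<Sum>u\<in>A. q u w) \<le> (\<Sum>w\<in>K. \<Sum>u\<in>A. p u w)"
  shows "- (\<Sum>w\<in>K. (\<Sum>u\<in>A. p u w) * ln (\<Sum>u\<in>A. p u w)) \<le> - (\<Sum>w\<in>K. \<Sum>u\<in>A. p u w * ln (q u w))"
proof -
  have *: "p u w * ln (q u w) - p u w * ln (\<Sum>u\<in>A. p u w) \<le> q u w - p u w" if "u \<in> A" "w \<in> K" for u w
  proof (cases "p u w = 0")
    case True
    then show ?thesis using q that by simp
  next
    case False
    then have pos: "p u w > 0" "q u w > 0" using p[OF that] pq[OF that] by auto
    have ps: "p u w \<le> (\<Sum>u\<in>A. p u w)"
      by (rule member_le_sum[OF that(1)]) (use p that assms in auto)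
    then have P: "(\<Sum>u\<in>A. p u w) > 0" using pos by simp
    have "ln (q u w) - ln (\<Sum>u\<in>A. p u w) = ln (q u w / (\<Sum>u\<in>A. p u w))"
      using pos P by (simp add: ln_div)
    also have "\<dots> \<le> q u w / (\<Sum>u\<in>A. p u w) - 1"
      using pos P by (intro ln_le_minus_one) simp
    also have "\<dots> \<le> q u w / p u w - 1"
      using pos P ps by (simp add: divide_left_mono)
    finally have "p u w * (ln (q u w) - ln (\<Sum>u\<in>A. p u w)) \<le> p u w * (q u w / p u w - 1)"
      using pos by (intro mult_left_mono) auto
    then show ?thesis using pos by (simp add: algebra_simps)
  qed
  have "(\<Sum>w\<in>K. \<Sum>u\<in>A. p u w * ln (q u w) - p u w * ln (\<Sum>u\<in>A. p u w)) \<le> (\<Sum>w\<in>K. \<Sum>u\<in>A. q u w - p u w)"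
    by (intro sum_mono *) auto
  then show ?thesis using le by (simp add: sum_subtractf sum_distrib_right)
qed

text \<open>The bound is put on the powers because the norm of Q itself may exceed 1 although its
  powers decay. Completeness is a hypothesis so that the statement serves real functions and pairs
  of them alike.\<close>

lemma neumann_series:
  fixes Q :: "'a::real_normed_vector \<Rightarrow> 'a"
  assumes complete: "\<And>X :: nat \<Rightarrow> 'a. Cauchy X \<Longrightarrow> convergent X"
    and Q: "bounded_linear Q" and th: "0 \<le> \<theta>" "\<theta> < 1"
    and bd: "\<And>n x. norm ((Q ^^ n) x) \<le> C * \<theta> ^ n * norm x"
  obtains S where "bounded_linear S" "\<And>x. S x - Q (S x) = x" "\<And>x. S (x - Q x) = x"
    "\<And>x. (\<lambda>n. (Q ^^ n) x) sums S x"
proof -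
  define S where "S x = (\<Sum>n. (Q ^^ n) x)" for x
  have lin: "linear (Q ^^ n)" for n
  proof (induction n)
    case 0
    show ?case by (simp add: linear_iff)
  next
    case (Suc n)
    then show ?case using linear_compose[OF Suc bounded_linear.linear[OF Q]] by (simp add: o_def)
  qed
  have geo: "summable (\<lambda>n. C * \<theta> ^ n * norm x)" for x :: 'a
    using th by (intro summable_mult summable_mult2 summable_geometric) simp
  have sm: "summable (\<lambda>n. (Q ^^ n) x)" for x
  proof -
    let ?s = "\<lambda>n. \<Sum>i<n. (Q ^^ i) x"
    have "Cauchy ?s"
    proof (rule CauchyI')
      fix e :: real assume "e > 0"
      obtain N where N: "\<And>m n. m \<ge> N \<Longrightarrow> norm (\<Sum>i=m..<n. C * \<theta> ^ i * norm x) < e"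
        using geo[of x] \<open>e > 0\<close> unfolding summable_Cauchy by blast
      have "dist (?s m) (?s n) < e" if "N \<le> m" "m < n" for m n
      proof -
        have "?s n = ?s m + (\<Sum>i=m..<n. (Q ^^ i) x)"
          using that(2) sum.atLeastLessThan_concat[of 0 m n "\<lambda>i. (Q ^^ i) x"]
          by (simp add: atLeast0LessThan)
        then have "dist (?s m) (?s n) \<le> (\<Sum>i=m..<n. norm ((Q ^^ i) x))"
          by (simp add: dist_norm norm_sum)
        also have "\<dots> \<le> (\<Sum>i=m..<n. C * \<theta> ^ i * norm x)" by (intro sum_mono bd)
        also have "\<dots> < e" using N[OF that(1), of n] by simp
        finally show ?thesis .
      qed
      then show "\<exists>M. \<forall>m\<ge>M. \<forall>n>m. dist (?s m) (?s n) < e" by blast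
    qed
    then obtain l where "?s \<longlonglongrightarrow> l" using complete unfolding convergent_def by blast
    then show ?thesis unfolding summable_def sums_def by blast
  qed
  then have sums: "(\<lambda>n. (Q ^^ n) x) sums S x" for x unfolding S_def by (rule summable_sums)
  have norm_S: "norm (S x) \<le> (\<Sum>n. C * \<theta> ^ n * norm x)" for x
  proof (rule LIMSEQ_le[OF tendsto_norm[OF sums[of x, unfolded sums_def]] summable_LIMSEQ[OF geo[of x]]])
    show "\<exists>N. \<forall>n\<ge>N. norm (\<Sum>i<n. (Q ^^ i) x) \<le> (\<Sum>i<n. C * \<theta> ^ i * norm x)"
      by (intro exI allI impI order_trans[OF norm_sum] sum_mono bd)
  qed
  have bl: "bounded_linear S"
  proof (rule bounded_linear_intro[where K = "C * (1 / (1 - \<theta>))"])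
    fix x y show "S (x + y) = S x + S y"
      using sums_unique2[OF sums[of "x + y"]] sums_add[OF sums[of x] sums[of y]]
      by (simp add: linear_add[OF lin])
  next
    fix r x show "S (r *\<^sub>R x) = r *\<^sub>R S x"
      using sums_unique2[OF sums[of "r *\<^sub>R x"]] sums_scaleR_right[OF sums[of x]]
      by (simp add: linear_scale[OF lin])
  next
    fix x
    have "norm (S x) \<le> (\<Sum>n. C * \<theta> ^ n * norm x)" by (rule norm_S)
    also have "\<dots> = C * (1 / (1 - \<theta>)) * norm x"
      using th by (simp add: suminf_mult2[symmetric] suminf_mult suminf_geometric summable_geometric summable_mult)
    finally show "norm (S x) \<le> norm x * (C * (1 / (1 - \<theta>)))" by (simp add: mult.commute)
  qed
  have tail: "(\<lambda>n. (Q ^^ Suc n) x) sums (S x - x)" for x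
    using sums_Suc_iff[of "\<lambda>n. (Q ^^ n) x" "S x - x"] sums[of x] by simp
  have "S (Q x) = S x - x" for x
    using sums_unique2[OF sums[of "Q x"]] tail[of x] by (simp add: funpow_swap1)
  then have "S (x - Q x) = x" for x
    by (simp add: linear_diff[OF bounded_linear.linear[OF bl]])
  moreover have "S x - Q (S x) = x" for x
    using sums_unique2[OF bounded_linear.sums[OF Q sums[of x]]] tail[of x] by simp
  ultimately show ?thesis using that bl sums by blast
qed

section \<open>Words over an alphabet and sums over them\<close>

definition words :: "'l set \<Rightarrow> nat \<Rightarrow> 'l list set" where
  "words K n = {w. set w \<subseteq> K \<and> length w = n}"

lemma finite_words: "finite K \<Longrightarrow> finite (words K n)"
  unfolding words_def by (rule finite_lists_length_eq)

lemma words_0: "words K 0 = {[]}"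
  by (auto simp: words_def)

lemma sum_words_append:
  fixes g :: "'l list \<Rightarrow> 'b::comm_monoid_add"
  shows "(\<Sum>w\<in>words K (n + m). g w) = (\<Sum>u\<in>words K n. \<Sum>v\<in>words K m. g (u @ v))"
proof -
  have "(\<Sum>u\<in>words K n. \<Sum>v\<in>words K m. g (u @ v)) = (\<Sum>(u, v)\<in>words K n \<times> words K m. g (u @ v))"
    by (rule sum.cartesian_product)
  also have "\<dots> = (\<Sum>w\<in>words K (n + m). g w)"
  proof (rule sum.reindex_bij_witness[of _ "\<lambda>w. (take n w, drop n w)" "\<lambda>(u, v). u @ v"])
    fix w assume "w \<in> words K (n + m)"
    then show "(take n w, drop n w) \<in> words K n \<times> words K m"
      using set_take_subset[of n w] set_drop_subset[of n w] by (auto simp: words_def)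
  qed (auto simp: words_def)
  finally show ?thesis by simp
qed

lemma sum_words_Suc:
  fixes g :: "'l list \<Rightarrow> 'b::comm_monoid_add"
  shows "(\<Sum>w\<in>words K (Suc n). g w) = (\<Sum>u\<in>words K n. \<Sum>a\<in>K. g (u @ [a]))"
proof -
  have "words K 1 = (\<lambda>a. [a]) ` K"
    by (auto simp: words_def length_Suc_conv)
  then have "(\<Sum>v\<in>words K 1. h v) = (\<Sum>a\<in>K. h [a])" for h :: "'l list \<Rightarrow> 'b"
    by (simp add: sum.reindex inj_on_def)
  then show ?thesis using sum_words_append[of g K n 1] by simp
qed

section \<open>Iterates and spectral radius of the Ruelle operator\<close>

lemma Cauchy_convergent_bcontfun_cantor:
  fixes X :: "nat \<Rightarrow> cantor \<Rightarrow>\<^sub>C real"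
  assumes "Cauchy X"
  shows "convergent X"
proof -
  have "uniformly_Cauchy_on UNIV (\<lambda>n. apply_bcontfun (X n))"
    using assms unfolding uniformly_Cauchy_on_def Cauchy_def by (metis dist_fun_lt_imp_dist_val_lt)
  then obtain g where "uniform_limit UNIV (\<lambda>n. apply_bcontfun (X n)) g sequentially"
    using Cauchy_uniformly_convergent unfolding uniformly_convergent_on_def by blast
  then obtain l where "X \<longlonglongrightarrow> l"
    by (rule uniform_limit_bcontfunE) simp_all
  then show ?thesis by (rule convergentI)
qed

lemma Cauchy_convergent_pair_bcontfun_cantor:
  fixes X :: "nat \<Rightarrow> (cantor \<Rightarrow>\<^sub>C real) \<times> (cantor \<Rightarrow>\<^sub>C real)"
  assumes "Cauchy X"
  shows "convergent X"
proof -
  obtain a b where "(\<lambda>n. fst (X n)) \<longlonglongrightarrow> a" "(\<lambda>n. snd (X n)) \<longlonglongrightarrow> b"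
    using Cauchy_convergent_bcontfun_cantor Cauchy_fst[OF assms] Cauchy_snd[OF assms]
    unfolding convergent_def by blast
  then have "X \<longlonglongrightarrow> (a, b)" using tendsto_Pair by fastforce
  then show ?thesis by (rule convergentI)
qed

lemma abs_bcontfun_le:
  fixes g :: "'a::topological_space \<Rightarrow>\<^sub>C real"
  shows "\<bar>g x\<bar> \<le> norm g"
  using norm_bounded[of g x] by simp

section \<open>Birkhoff sums and the expansion of the iterates over words\<close>

definition birkhoff_sum :: "(cantor \<Rightarrow>\<^sub>C real) \<Rightarrow> nat \<Rightarrow> cantor \<Rightarrow> real" where
  "birkhoff_sum f n x = (\<Sum>i<n. f ((left_shift ^^ i) x))"

definition prepend_word :: "bool list \<Rightarrow> cantor \<Rightarrow> cantor" where
  "prepend_word w y = foldr prepend w y"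

definition partition_function :: "(cantor \<Rightarrow>\<^sub>C real) \<Rightarrow> nat \<Rightarrow> cantor \<Rightarrow> real" where
  "partition_function f n y = (\<Sum>w\<in>words UNIV n. exp (birkhoff_sum f n (prepend_word w y)))"

lemma left_shift_funpow: "(left_shift ^^ i) x = (\<lambda>j. x (i + j))"
  by (induction i) (simp_all add: left_shift_def)

lemma prepend_word_nth: "prepend_word w y i = (if i < length w then w ! i else y (i - length w))"
  unfolding prepend_word_def
proof (induction w arbitrary: i)
  case (Cons a w)
  then show ?case by (cases i) (simp_all add: prepend_def)
qed simp

lemma left_shift_prepend_word: "(left_shift ^^ length w) (prepend_word w y) = y"
  by (simp add: left_shift_funpow prepend_word_nth fun_eq_iff)

lemma finite_bool_words: "finite (words (UNIV :: bool set) n)"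
  by (rule finite_words) simp

lemma bool_words_nonempty: "words (UNIV :: bool set) n \<noteq> {}"
  by (auto simp: words_def intro: exI[of _ "replicate n True"])

text \<open>The outermost application prepends the letter next to y, so the induction step adds a
  last letter to the word; the Birkhoff sum then gains the value of f at that letter followed by
  y.\<close>

lemma ruelle_iterate:
  "apply_bcontfun ((ruelle f ^^ n) \<phi>) y =
     (\<Sum>w\<in>words UNIV n. exp (birkhoff_sum f n (prepend_word w y)) * \<phi> (prepend_word w y))"
proof (induction n arbitrary: y)
  case 0
  show ?case by (simp add: words_0 birkhoff_sum_def prepend_word_def)
next
  case (Suc n)
  have snoc: "prepend_word (w @ [a]) y = prepend_word w (prepend a y)" for w a
    by (simp add: prepend_word_def)
  have birk: "birkhoff_sum f (Suc n) (prepend_word w (prepend a y))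
      = birkhoff_sum f n (prepend_word w (prepend a y)) + f (prepend a y)"
    if "w \<in> words UNIV n" for w a
    using that left_shift_prepend_word[of w "prepend a y"] by (simp add: birkhoff_sum_def words_def)
  have "apply_bcontfun ((ruelle f ^^ Suc n) \<phi>) y
      = (\<Sum>a\<in>UNIV. \<Sum>w\<in>words UNIV n. exp (f (prepend a y)) *
          (exp (birkhoff_sum f n (prepend_word w (prepend a y))) * \<phi> (prepend_word w (prepend a y))))"
    by (simp only: funpow.simps o_apply ruelle_apply Suc sum_distrib_left)
  also have "\<dots> = (\<Sum>w\<in>words UNIV n. \<Sum>a\<in>UNIV. exp (birkhoff_sum f (Suc n) (prepend_word w (prepend a y)))
          * \<phi> (prepend_word w (prepend a y)))"
    by (subst sum.swap) (intro sum.cong refl, simp add: birk exp_add)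
  finally show ?case by (simp add: sum_words_Suc snoc)
qed

lemma ruelle_iterate_one: "apply_bcontfun ((ruelle f ^^ n) (const_bcontfun 1)) y = partition_function f n y"
  unfolding ruelle_iterate partition_function_def by simp

lemma partition_function_pos: "0 < partition_function f n y"
  unfolding partition_function_def
  by (intro sum_pos finite_bool_words bool_words_nonempty) simp

lemma ruelle_add: "ruelle f (\<phi> + \<psi>) = ruelle f \<phi> + ruelle f \<psi>"
  by (rule bcontfun_eqI) (simp add: ruelle_apply algebra_simps sum.distrib)

lemma ruelle_scale: "ruelle f (r *\<^sub>R \<phi>) = r *\<^sub>R ruelle f \<phi>"
  by (rule bcontfun_eqI) (simp add: ruelle_apply algebra_simps sum_distrib_left)

text \<open>The operator is positive, so its n-th power is dominated by its action on the constant 1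
  times the norm of the argument: the operator norm of a power is read off at 1.\<close>

lemma norm_ruelle_iterate_le:
  "norm ((ruelle f ^^ n) \<phi>) \<le> norm ((ruelle f ^^ n) (const_bcontfun 1)) * norm \<phi>"
proof (rule norm_bound)
  fix y
  have "norm ((ruelle f ^^ n) \<phi> y)
      \<le> (\<Sum>w\<in>words UNIV n. norm (exp (birkhoff_sum f n (prepend_word w y)) * \<phi> (prepend_word w y)))"
    unfolding ruelle_iterate by (rule norm_sum)
  also have "\<dots> \<le> (\<Sum>w\<in>words UNIV n. exp (birkhoff_sum f n (prepend_word w y)) * norm \<phi>)"
    unfolding norm_mult by (intro sum_mono mult_mono) (auto simp: abs_bcontfun_le)
  also have "\<dots> = apply_bcontfun ((ruelle f ^^ n) (const_bcontfun 1)) y * norm \<phi>"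
    by (simp add: ruelle_iterate sum_distrib_right)
  also have "\<dots> \<le> norm ((ruelle f ^^ n) (const_bcontfun 1)) * norm \<phi>"
    using norm_bounded[of "(ruelle f ^^ n) (const_bcontfun 1)" y] by (intro mult_right_mono) auto
  finally show "norm ((ruelle f ^^ n) \<phi> y) \<le> norm ((ruelle f ^^ n) (const_bcontfun 1)) * norm \<phi>" .
qed

lemma bounded_linear_ruelle: "bounded_linear (ruelle f)"
  by (rule bounded_linear_intro[where K = "norm (ruelle f (const_bcontfun 1))"])
    (use norm_ruelle_iterate_le[where n = 1] in \<open>simp_all add: ruelle_add ruelle_scale mult.commute\<close>)

lemma partition_function_le_norm:
  "partition_function f n y \<le> norm ((ruelle f ^^ n) (const_bcontfun 1))"
  using norm_bounded[of "(ruelle f ^^ n) (const_bcontfun 1)" y]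
  by (simp add: ruelle_iterate_one)

lemma norm_ruelle_iterate_one_pos: "0 < norm ((ruelle f ^^ n) (const_bcontfun 1))"
  using partition_function_pos partition_function_le_norm by (rule less_le_trans)

text \<open>Among the words summed over is the one made of the first n letters of x, and prepending
  it to y gives back x.\<close>

lemma exp_birkhoff_le_partition_function:
  assumes "(left_shift ^^ n) x = y"
  shows "exp (birkhoff_sum f n x) \<le> partition_function f n y"
proof -
  define w where "w = map x [0..<n]"
  have w: "w \<in> words UNIV n" by (simp add: words_def w_def)
  have "y i = x (n + i)" for i using assms by (auto simp: left_shift_funpow)
  then have "prepend_word w y = x"
    by (simp add: w_def prepend_word_nth fun_eq_iff)
  then show ?thesis
    unfolding partition_function_def
    using member_le_sum[OF w, of "\<lambda>w. exp (birkhoff_sum f n (prepend_word w y))"] finite_bool_words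
    by simp
qed

lemma partition_function_le:
  fixes f :: "cantor \<Rightarrow>\<^sub>C real"
  assumes "\<And>x. f x \<le> b"
  shows "partition_function f n y \<le> (2 * exp b) ^ n"
proof -
  have "card (words (UNIV :: bool set) n) = 2 ^ n"
    using card_lists_length_eq[of "UNIV :: bool set" n] by (simp add: words_def)
  moreover have "birkhoff_sum f n x \<le> real n * b" for x
    unfolding birkhoff_sum_def using sum_bounded_above[of "{..<n}" "\<lambda>i. f ((left_shift ^^ i) x)" b] assms
    by simp
  then have "partition_function f n y \<le> real (card (words (UNIV :: bool set) n)) * exp (real n * b)"
    unfolding partition_function_def by (intro sum_bounded_above) simp
  ultimately show ?thesis
    by (simp add: power_mult_distrib exp_of_nat_mult)
qed

text \<open>Every point has a cylinder on which f stays within e / 2 of its value there; finitely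
  many of these cover the space, and the greatest of their lengths serves all points.\<close>

lemma uniform_cylinder_continuity:
  fixes f :: "cantor \<Rightarrow>\<^sub>C real"
  assumes "e > 0"
  obtains m where "\<And>x y. (\<And>i. i < m \<Longrightarrow> x i = y i) \<Longrightarrow> \<bar>f x - f y\<bar> < e"
proof -
  have "\<exists>n. \<forall>y. (\<forall>i<n. x i = y i) \<longrightarrow> \<bar>f y - f x\<bar> < e / 2" for x
  proof -
    have "open (f -` ball (f x) (e / 2))"
      by (rule open_vimage[OF open_ball continuous_on_apply_bcontfun])
    moreover have "x \<in> f -` ball (f x) (e / 2)" using assms by simp
    ultimately obtain d where d: "d > 0" "\<And>y. cantor_dist x y < d \<Longrightarrow> y \<in> f -` ball (f x) (e / 2)"
      unfolding open_cantor_iff by blast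
    obtain n where n: "(1 / 2 :: real) ^ n < d" using real_arch_pow_inv[OF d(1)] by force
    have "\<bar>f y - f x\<bar> < e / 2" if "\<forall>i<n. x i = y i" for y
      using d(2)[of y] that[folded cantor_dist_less_iff] n by (simp add: dist_real_def abs_minus_commute)
    then show ?thesis by blast
  qed
  then obtain N where N: "\<And>x y. (\<forall>i<N x. x i = y i) \<Longrightarrow> \<bar>f y - f x\<bar> < e / 2" by metis
  obtain C where C: "finite C" "UNIV \<subseteq> (\<Union>x\<in>C. {y. \<forall>i<N x. x i = y i})"
    by (rule compactE_image[OF compact_cantor, of UNIV "\<lambda>x. {y. \<forall>i<N x. x i = y i}"])
      (auto intro: open_cylinder)
  define m where "m = Max (N ` C)"
  have "\<bar>f x - f y\<bar> < e" if xy: "\<And>i. i < m \<Longrightarrow> x i = y i" for x y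
  proof -
    obtain c where c: "c \<in> C" "\<forall>i<N c. c i = x i" using C(2) by blast
    have "N c \<le> m" unfolding m_def using C(1) c(1) by simp
    then have "\<forall>i<N c. c i = y i" using c(2) xy by auto
    with N[OF c(2)] N[of c y] have "\<bar>f x - f c\<bar> < e / 2" "\<bar>f y - f c\<bar> < e / 2" by auto
    then show ?thesis by linarith
  qed
  then show ?thesis using that by blast
qed

text \<open>The i-th terms are taken at points which agree in n - i coordinates. At most m of them,
  those with n - i < m, are bounded only by twice the norm of f; the others are below e by uniform
  continuity.\<close>

lemma birkhoff_sum_variation:
  fixes f :: "cantor \<Rightarrow>\<^sub>C real"
  assumes "e > 0"
  obtains C where "\<And>n x y. (\<And>i. i < n \<Longrightarrow> x i = y i) \<Longrightarrow>
    \<bar>birkhoff_sum f n x - birkhoff_sum f n y\<bar> \<le> C + real n * e"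
proof -
  obtain m where m: "\<And>x y. (\<And>i. i < m \<Longrightarrow> x i = y i) \<Longrightarrow> \<bar>f x - f y\<bar> < e"
    using uniform_cylinder_continuity[OF assms] by blast
  have "\<bar>birkhoff_sum f n x - birkhoff_sum f n y\<bar> \<le> 2 * norm f * real m + real n * e"
    if xy: "\<And>i. i < n \<Longrightarrow> x i = y i" for n x y
  proof -
    let ?d = "\<lambda>i. \<bar>f ((left_shift ^^ i) x) - f ((left_shift ^^ i) y)\<bar>"
    have "?d i \<le> e + (if n < i + m then 2 * norm f else 0)" if "i < n" for i
    proof (cases "n < i + m")
      case True
      have "?d i \<le> 2 * norm f"
        using norm_bounded[of f "(left_shift ^^ i) x"] norm_bounded[of f "(left_shift ^^ i) y"]
        by simp
      then show ?thesis using True assms by simp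
    next
      case False
      then have "?d i < e" by (intro m) (simp add: left_shift_funpow xy)
      then show ?thesis using False by simp
    qed
    then have "(\<Sum>i<n. ?d i) \<le> (\<Sum>i<n. e + (if n < i + m then 2 * norm f else 0))"
      by (intro sum_mono) simp
    also have "\<dots> = real n * e + 2 * norm f * real (card {i\<in>{..<n}. n < i + m})"
      by (simp add: sum.distrib sum.If_cases Int_def)
    also have "card {i\<in>{..<n}. n < i + m} \<le> card {n - m..<n}"
      by (intro card_mono) auto
    then have "real (card {i\<in>{..<n}. n < i + m}) \<le> real m" by simp
    finally have "(\<Sum>i<n. ?d i) \<le> real n * e + 2 * norm f * real m"
      by (simp add: mult_left_mono)
    moreover have "\<bar>birkhoff_sum f n x - birkhoff_sum f n y\<bar> \<le> (\<Sum>i<n. ?d i)"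
      unfolding birkhoff_sum_def sum_subtractf[symmetric] by (rule sum_abs)
    ultimately show ?thesis by simp
  qed
  then show ?thesis using that by blast
qed

lemma partition_function_variation:
  assumes "e > 0"
  obtains C where "\<And>n x y. ln (partition_function f n x) \<le> ln (partition_function f n y) + C + real n * e"
proof -
  obtain C where C: "\<And>n x y. (\<And>i. i < n \<Longrightarrow> x i = y i) \<Longrightarrow>
    \<bar>birkhoff_sum f n x - birkhoff_sum f n y\<bar> \<le> C + real n * e"
    using birkhoff_sum_variation[OF assms] by blast
  have "ln (partition_function f n x) \<le> ln (partition_function f n y) + C + real n * e" for n x y
  proof -
    have "birkhoff_sum f n (prepend_word w x) \<le> birkhoff_sum f n (prepend_word w y) + (C + real n * e)"
      if "w \<in> words UNIV n" for w
      using C[of n "prepend_word w x" "prepend_word w y"] that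
      by (simp add: prepend_word_nth words_def)
    then have "partition_function f n x \<le> exp (C + real n * e) * partition_function f n y"
      unfolding partition_function_def sum_distrib_left
      by (intro sum_mono) (simp add: exp_add[symmetric] add.commute)
    then have "ln (partition_function f n x) \<le> ln (exp (C + real n * e) * partition_function f n y)"
      using partition_function_pos by (simp del: exp_add ln_mult)
    then show ?thesis using partition_function_pos[of f n y] by (simp add: ln_mult)
  qed
  then show ?thesis using that by blast
qed

section \<open>The exponential growth rate of the iterates\<close>

definition pressure :: "(cantor \<Rightarrow>\<^sub>C real) \<Rightarrow> real" where
  "pressure f = lim (\<lambda>n. ln (norm ((ruelle f ^^ n) (const_bcontfun 1))) / real n)"

text \<open>Fekete's lemma applies as the norms are submultiplicative, while a single orbit bounds
  them from below. \<open>pressure_le\<close> is the infimum property of the limit: no norm falls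
  below the limiting exponential rate.\<close>

lemma pressure_properties:
  shows pressure_tendsto: "(\<lambda>n. ln (norm ((ruelle f ^^ n) (const_bcontfun 1))) / real n) \<longlonglongrightarrow> pressure f"
    and pressure_le: "real n * pressure f \<le> ln (norm ((ruelle f ^^ n) (const_bcontfun 1)))"
proof -
  let ?a = "\<lambda>n. ln (norm ((ruelle f ^^ n) (const_bcontfun 1)))"
  have sub: "?a (m + n) \<le> ?a m + ?a n" for m n
  proof -
    have "norm ((ruelle f ^^ (m + n)) (const_bcontfun 1))
       \<le> norm ((ruelle f ^^ m) (const_bcontfun 1)) * norm ((ruelle f ^^ n) (const_bcontfun 1))"
      using norm_ruelle_iterate_le[where f = f and n = m and \<phi> = "(ruelle f ^^ n) (const_bcontfun 1)"] by (simp add: funpow_add)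
    then have "?a (m + n) \<le> ln (norm ((ruelle f ^^ m) (const_bcontfun 1)) * norm ((ruelle f ^^ n) (const_bcontfun 1)))"
      using norm_ruelle_iterate_one_pos by (intro ln_mono) auto
    then show ?thesis using norm_ruelle_iterate_one_pos
      by (metis less_numeral_extra(3) ln_mult_pos)
  qed
  have low: "- norm f * real n \<le> ?a n" for n
  proof -
    have "- norm f \<le> f x" for x using norm_bounded[of f x] by simp
    then have "- norm f * real n \<le> birkhoff_sum f n x" for x
      unfolding birkhoff_sum_def
      using sum_bounded_below[of "{..<n}" "- norm f" "\<lambda>i. f ((left_shift ^^ i) x)"] by (simp add: mult.commute)
    then have "exp (- norm f * real n) \<le> norm ((ruelle f ^^ n) (const_bcontfun 1))"
      using exp_birkhoff_le_partition_function[OF refl, where f = f and n = n and x = undefined]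
        partition_function_le_norm[of f n "(left_shift ^^ n) undefined"]
      by (meson exp_le_cancel_iff order_trans)
    then show ?thesis using norm_ruelle_iterate_one_pos by (simp add: ln_ge_iff)
  qed
  obtain l where l: "(\<lambda>n. ?a n / real n) \<longlonglongrightarrow> l" "\<And>n. real n * l \<le> ?a n"
    using subadditive_limit[of ?a "norm f", OF sub low] by blast
  have "pressure f = l" unfolding pressure_def using l(1) by (rule limI)
  then show "(\<lambda>n. ?a n / real n) \<longlonglongrightarrow> pressure f" "real n * pressure f \<le> ?a n"
    using l by auto
qed

text \<open>The supremum over all points exceeds the value at any one point by at most a factor
  \<open>exp (C + real n * (e / 2))\<close>, with C independent of the point and of n. Hence the
  points \<open>y n\<close> may vary freely.\<close>

lemma partition_function_tendsto:
  "(\<lambda>n. ln (partition_function f n (y n)) / real n) \<longlonglongrightarrow> pressure f"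
proof (rule LIMSEQ_I)
  let ?a = "\<lambda>n. ln (norm ((ruelle f ^^ n) (const_bcontfun 1)))"
  fix e :: real assume e: "e > 0"
  obtain C where C: "\<And>n x y. ln (partition_function f n x) \<le> ln (partition_function f n y) + C + real n * (e / 2)"
    using partition_function_variation[of "e / 2"] e by auto
  have low: "?a n \<le> ln (partition_function f n y) + C + real n * (e / 2)" for n y
  proof -
    have "norm ((ruelle f ^^ n) (const_bcontfun 1)) \<le> exp (ln (partition_function f n y) + C + real n * (e / 2))"
    proof (rule norm_bound)
      fix x
      have "partition_function f n x \<le> exp (ln (partition_function f n y) + C + real n * (e / 2))"
        using C[of n x y] partition_function_pos[of f n x] by (metis exp_le_cancel_iff exp_ln)
      then show "norm ((ruelle f ^^ n) (const_bcontfun 1) x) \<le> exp (ln (partition_function f n y) + C + real n * (e / 2))"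
        using partition_function_pos[of f n x] by (simp add: ruelle_iterate_one)
    qed
    then show ?thesis using norm_ruelle_iterate_one_pos by (metis exp_ln exp_le_cancel_iff)
  qed
  have up: "ln (partition_function f n y) \<le> ?a n" for n y
    using partition_function_le_norm partition_function_pos by (intro ln_mono)
  obtain n1 where n1: "\<And>n. n \<ge> n1 \<Longrightarrow> norm (?a n / real n - pressure f) < e"
    using LIMSEQ_D[OF pressure_tendsto[of f] e] by blast
  obtain n2 where n2: "real n2 > 2 * C / e" using reals_Archimedean2 by blast
  show "\<exists>no. \<forall>n\<ge>no. norm (ln (partition_function f n (y n)) / real n - pressure f) < e"
  proof (intro exI allI impI)
    fix n assume n: "n \<ge> max 1 (max n1 n2)"
    have "2 * C / e < real n" using n n2 by simp
    then have "C < real n * (e / 2)" using e by (simp add: field_simps)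
    with low[of n "y n"] pressure_le[of n f]
    have "real n * (pressure f - e) < ln (partition_function f n (y n))" by (simp add: algebra_simps)
    then have 1: "pressure f - e < ln (partition_function f n (y n)) / real n"
      using n by (simp add: less_divide_eq mult.commute)
    have "ln (partition_function f n (y n)) / real n \<le> ?a n / real n"
      using up by (simp add: divide_right_mono)
    with 1 n1[of n] n show "norm (ln (partition_function f n (y n)) / real n - pressure f) < e" by simp
  qed
qed

text \<open>Positivity of the operator puts the radius itself into the spectrum. The supremum is
  thus attained at a positive real point, and there it suffices to look at the resolvent on real
  functions.\<close>

lemma spectral_radius_ruelle: "spectral_radius (ruelle f) = exp (pressure f)"
proof -
  define T where "T = ruelle f"
  define a where "a n = norm ((T ^^ n) (const_bcontfun 1))" for n
  define r where "r = exp (pressure f)"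
  have r: "r > 0" by (simp add: r_def)
  have apos: "a n > 0" for n unfolding a_def T_def by (rule norm_ruelle_iterate_one_pos)
  have blT: "bounded_linear T" unfolding T_def by (rule bounded_linear_ruelle)
  note linT = bounded_linear.linear[OF blT]
  have Tn: "norm ((T ^^ n) \<phi>) \<le> a n * norm \<phi>" for n \<phi>
    unfolding a_def T_def by (rule norm_ruelle_iterate_le)
  have low: "r ^ n \<le> a n" for n
    using pressure_le[of n f] apos[of n]
    by (simp add: r_def a_def T_def exp_of_nat_mult[symmetric] ln_ge_iff)
  have growth: "\<exists>C. \<forall>n. a n \<le> C * \<rho> ^ n" if \<rho>: "\<rho> > r" for \<rho>
  proof -
    have "pressure f < ln \<rho>" using \<rho> r unfolding r_def by (metis less_trans exp_less_cancel_iff exp_ln)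
    then have "\<forall>\<^sub>F n in sequentially. ln (a n) / real n < ln \<rho>"
      using order_tendstoD(2)[OF pressure_tendsto[of f]] unfolding a_def T_def by blast
    then obtain n0 where n0: "\<And>n. n \<ge> n0 \<Longrightarrow> ln (a n) / real n < ln \<rho>"
      unfolding eventually_sequentially by blast
    have large: "a n \<le> \<rho> ^ n" if "n \<ge> max 1 n0" for n
    proof -
      have "ln (a n) < real n * ln \<rho>" using n0[of n] that by (simp add: divide_less_eq mult.commute)
      also have "\<dots> = ln (\<rho> ^ n)" using \<rho> r by (simp add: ln_realpow)
      finally show ?thesis using apos[of n] \<rho> r by simp
    qed
    define C where "C = 1 + (\<Sum>n<max 1 n0. a n / \<rho> ^ n)"
    have sn: "0 \<le> (\<Sum>n<max 1 n0. a n / \<rho> ^ n)"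
      using \<rho> r apos by (intro sum_nonneg) (simp add: less_imp_le)
    have "a n \<le> C * \<rho> ^ n" for n
    proof (cases "n \<ge> max 1 n0")
      case True
      have "1 * \<rho> ^ n \<le> C * \<rho> ^ n" unfolding C_def using \<rho> r sn by (intro mult_right_mono) auto
      then show ?thesis using large[OF True] by simp
    next
      case False
      then have "a n / \<rho> ^ n \<le> (\<Sum>n<max 1 n0. a n / \<rho> ^ n)"
        using \<rho> r apos by (intro member_le_sum[of n _ "\<lambda>n. a n / \<rho> ^ n"]) (auto simp: less_imp_le)
      then have "a n / \<rho> ^ n \<le> C" unfolding C_def by simp
      then show ?thesis using \<rho> r by (simp add: divide_le_eq)
    qed
    then show ?thesis by blast
  qed
  have upper: "cmod z \<le> r" if z: "z \<in> spectrum T" for z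
  proof (rule ccontr)
    assume "\<not> cmod z \<le> r"
    then have zr: "cmod z > r" by simp
    then have z0: "z \<noteq> 0" using r by auto
    define \<rho> where "\<rho> = (r + cmod z) / 2"
    have \<rho>: "r < \<rho>" "\<rho> < cmod z" using zr by (auto simp: \<rho>_def)
    obtain C where C: "\<And>n. a n \<le> C * \<rho> ^ n" using growth[OF \<rho>(1)] by blast
    \<comment> \<open>Multiplication of u + i v by the complex scalar c. In these terms the pencil
      is z (1 - Q) with Q = T / z acting on pairs, and 1 - Q is inverted by a Neumann
      series.\<close>
    define m :: "complex \<Rightarrow> (cantor \<Rightarrow>\<^sub>C real) \<times> (cantor \<Rightarrow>\<^sub>C real) \<Rightarrow> _" where
      "m c = (\<lambda>(u, v). (Re c *\<^sub>R u - Im c *\<^sub>R v, Im c *\<^sub>R u + Re c *\<^sub>R v))" for c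
    have m_mult: "m c (m d p) = m (c * d) p" for c d p
      by (cases p) (simp add: m_def algebra_simps)
    have m_one: "m 1 p = p" for p by (cases p) (simp add: m_def)
    have m_norm: "norm (m c p) \<le> 4 * cmod c * norm p" for c p
    proof (cases p)
      case (Pair u v)
      have uv: "norm u \<le> norm p" "norm v \<le> norm p"
        unfolding Pair by (simp_all add: norm_Pair real_le_rsqrt)
      have "norm (m c p) \<le> norm (Re c *\<^sub>R u - Im c *\<^sub>R v) + norm (Im c *\<^sub>R u + Re c *\<^sub>R v)"
        unfolding m_def Pair by (simp add: norm_Pair_le)
      also have "\<dots> \<le> (\<bar>Re c\<bar> * norm u + \<bar>Im c\<bar> * norm v) + (\<bar>Im c\<bar> * norm u + \<bar>Re c\<bar> * norm v)"
        by (intro add_mono norm_triangle_le_diff norm_triangle_le) auto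
      also have "\<dots> \<le> (cmod c * norm p + cmod c * norm p) + (cmod c * norm p + cmod c * norm p)"
        by (intro add_mono mult_mono uv abs_Re_le_cmod abs_Im_le_cmod) auto
      finally show ?thesis by simp
    qed
    have bm: "bounded_linear (m c)" for c
      by (rule bounded_linear_intro[where K = "4 * cmod c"])
        (use m_norm[of c] in \<open>auto simp: m_def algebra_simps split: prod.splits\<close>)
    define Tp where "Tp = (\<lambda>(u, v). (T u, T v))"
    have blTp: "bounded_linear Tp"
      unfolding Tp_def case_prod_beta
      by (intro bounded_linear_Pair bounded_linear_compose[OF blT] bounded_linear_fst bounded_linear_snd)
    have m_Tp: "Tp (m c p) = m c (Tp p)" for c p
      by (cases p) (simp add: m_def Tp_def linear_diff[OF linT] linear_add[OF linT] linear_scale[OF linT])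
    define Q where "Q p = m (1 / z) (Tp p)" for p
    have blQ: "bounded_linear Q"
      unfolding Q_def by (rule bounded_linear_compose[OF bm blTp])
    have Qn: "(Q ^^ n) p = m ((1 / z) ^ n) ((Tp ^^ n) p)" for n p
      by (induction n) (simp_all add: m_one Q_def m_Tp m_mult)
    have Tpn: "(Tp ^^ n) p = ((T ^^ n) (fst p), (T ^^ n) (snd p))" for n p
      by (induction n) (simp_all add: Tp_def)
    have fst_le: "norm (fst p) \<le> norm p" and snd_le: "norm (snd p) \<le> norm p"
      for p :: "(cantor \<Rightarrow>\<^sub>C real) \<times> (cantor \<Rightarrow>\<^sub>C real)"
      by (cases p; simp add: norm_Pair real_le_rsqrt)+
    have nTp: "norm ((Tp ^^ n) p) \<le> 2 * a n * norm p" for n p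
    proof -
      have "norm ((Tp ^^ n) p) \<le> norm ((T ^^ n) (fst p)) + norm ((T ^^ n) (snd p))"
        unfolding Tpn by (rule norm_Pair_le)
      also have "\<dots> \<le> a n * norm p + a n * norm p"
        using apos[of n]
        by (intro add_mono order_trans[OF Tn] mult_left_mono fst_le snd_le) (auto simp: less_imp_le)
      finally show ?thesis by (simp add: mult_ac)
    qed
    have bd: "norm ((Q ^^ n) p) \<le> (8 * C) * (\<rho> / cmod z) ^ n * norm p" for n p
    proof -
      have "norm ((Q ^^ n) p) \<le> 4 * cmod ((1 / z) ^ n) * norm ((Tp ^^ n) p)"
        unfolding Qn by (rule m_norm)
      also have "\<dots> \<le> 4 * cmod ((1 / z) ^ n) * (2 * (C * \<rho> ^ n) * norm p)"
        by (intro mult_left_mono order_trans[OF nTp] mult_right_mono C) auto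
      finally show ?thesis
        by (simp add: norm_power norm_divide power_divide mult_ac)
    qed
    have th: "0 \<le> \<rho> / cmod z" "\<rho> / cmod z < 1" using \<rho> r zr z0 by (auto simp: divide_less_eq)
    obtain S where S: "bounded_linear S" "\<And>x. S x - Q (S x) = x" "\<And>x. S (x - Q x) = x"
      "\<And>x. (\<lambda>n. (Q ^^ n) x) sums S x"
      by (rule neumann_series[OF _ blQ th bd]) (erule Cauchy_convergent_pair_bcontfun_cantor, rule that)
    have pencil: "complex_pencil z T p = m z (p - Q p)" for p
    proof -
      have "m z (p - Q p) = m z p - m (z * (1 / z)) (Tp p)"
        using bounded_linear.linear[OF bm] unfolding Q_def by (simp only: linear_diff m_mult)
      then show ?thesis
        using z0 by (cases p) (simp add: m_one complex_pencil_def m_def Tp_def)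
    qed
    have "bounded_linear (S \<circ> m (1 / z))"
      using bounded_linear_compose[OF S(1) bm[of "1 / z"]] by (simp add: o_def)
    moreover have "(S \<circ> m (1 / z)) \<circ> complex_pencil z T = id"
      using z0 by (auto simp: fun_eq_iff pencil m_mult m_one S)
    moreover have "complex_pencil z T \<circ> (S \<circ> m (1 / z)) = id"
      using z0 by (auto simp: fun_eq_iff pencil m_mult m_one S)
    ultimately show False using z unfolding spectrum_def by blast
  qed
  have "complex_of_real r \<in> spectrum T"
  proof (rule ccontr)
    assume "complex_of_real r \<notin> spectrum T"
    then obtain S where S: "bounded_linear S" "S \<circ> complex_pencil (complex_of_real r) T = id"
      unfolding spectrum_def by blast
    \<comment> \<open>The pencil at a real point maps (u, 0) to (r u - T u, 0), so the first
      component of its inverse yields a left inverse of r - T on real functions.\<close>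
    define R where "R \<phi> = fst (S (\<phi>, 0))" for \<phi>
    have blR: "bounded_linear R"
      unfolding R_def
      by (intro bounded_linear_compose[OF bounded_linear_fst] bounded_linear_compose[OF S(1)]
          bounded_linear_Pair bounded_linear_ident bounded_linear_zero)
    have R: "R (r *\<^sub>R u - T u) = u" for u
      using fun_cong[OF S(2), of "(u, 0)"] linear_0[OF linT] by (simp add: R_def complex_pencil_def)
    obtain K where K: "K > 0" "\<And>\<phi>. norm (R \<phi>) \<le> norm \<phi> * K"
      using bounded_linear.pos_bounded[OF blR] by blast
    \<comment> \<open>The gain 1 / (2 K) depends only on the bound for the inverse at r, not on
      l.\<close>
    have key: "r \<le> l - 1 / (2 * K)" if l: "l > r" "(l - r) * K \<le> 1 / 2" for l
    proof -
      define \<rho> where "\<rho> = (r + l) / 2"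
      have \<rho>: "r < \<rho>" "\<rho> < l" using l by (auto simp: \<rho>_def)
      have l0: "l > 0" using l r by simp
      obtain C where C: "\<And>n. a n \<le> C * \<rho> ^ n" using growth[OF \<rho>(1)] by blast
      define Q where "Q \<phi> = (1 / l) *\<^sub>R T \<phi>" for \<phi>
      have blQ: "bounded_linear Q"
        unfolding Q_def by (rule bounded_linear_const_scaleR[OF blT])
      have Qn: "(Q ^^ n) \<phi> = (1 / l) ^ n *\<^sub>R (T ^^ n) \<phi>" for n \<phi>
        by (induction n) (simp_all add: Q_def linear_scale[OF linT])
      have bd: "norm ((Q ^^ n) \<phi>) \<le> C * (\<rho> / l) ^ n * norm \<phi>" for n \<phi>
      proof -
        have "norm ((Q ^^ n) \<phi>) = (1 / l) ^ n * norm ((T ^^ n) \<phi>)"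
          unfolding Qn using l0 by (simp add: power_abs)
        also have "\<dots> \<le> (1 / l) ^ n * ((C * \<rho> ^ n) * norm \<phi>)"
          using l0 by (intro mult_left_mono order_trans[OF Tn] mult_right_mono C) auto
        finally have "norm ((Q ^^ n) \<phi>) \<le> (1 / l) ^ n * ((C * \<rho> ^ n) * norm \<phi>)" .
        then show ?thesis by (simp add: power_divide mult_ac)
      qed
      have th: "0 \<le> \<rho> / l" "\<rho> / l < 1" using \<rho> r l0 by (auto simp: divide_less_eq)
      obtain V where V: "bounded_linear V" "\<And>x. V x - Q (V x) = x" "\<And>x. V (x - Q x) = x"
        "\<And>x. (\<lambda>n. (Q ^^ n) x) sums V x"
        by (rule neumann_series[OF _ blQ th bd]) (erule Cauchy_convergent_bcontfun_cantor, rule that)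
      \<comment> \<open>This is l times the resolvent at l applied to 1. Its Neumann terms are
        positive and the first of them is 1, hence u \<ge> 1; moreover T u = l (u - 1).\<close>
      define u where "u = V (const_bcontfun 1)"
      have ux: "(\<lambda>n. apply_bcontfun ((Q ^^ n) (const_bcontfun 1)) x) sums u x" for x
      proof -
        have "bounded_linear (\<lambda>g :: cantor \<Rightarrow>\<^sub>C real. apply_bcontfun g x)"
          by (rule bounded_linear_intro[where K = 1]) (auto simp: abs_bcontfun_le)
        from bounded_linear.sums[OF this V(4)] show ?thesis unfolding u_def .
      qed
      have Q1: "apply_bcontfun ((Q ^^ n) (const_bcontfun 1)) x = (1 / l) ^ n * partition_function f n x" for n x
        by (simp add: Qn T_def ruelle_iterate_one)
      have u1: "1 \<le> u x" for x
      proof -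
        have "(\<Sum>n\<in>{0}. apply_bcontfun ((Q ^^ n) (const_bcontfun 1)) x)
            \<le> (\<Sum>n. apply_bcontfun ((Q ^^ n) (const_bcontfun 1)) x)"
          using l0 partition_function_pos[of f _ x]
          by (intro sum_le_suminf sums_summable[OF ux]) (auto simp: Q1 less_imp_le)
        also have "\<dots> = u x" using sums_unique[OF ux] by simp
        finally have "(\<Sum>n\<in>{0}. apply_bcontfun ((Q ^^ n) (const_bcontfun 1)) x) \<le> u x" .
        then show ?thesis by simp
      qed
      have Tu: "T u = l *\<^sub>R (u - const_bcontfun 1)"
      proof -
        have "l *\<^sub>R (u - (1 / l) *\<^sub>R T u) = l *\<^sub>R const_bcontfun 1"
          using V(2)[of "const_bcontfun 1", folded u_def] unfolding Q_def by simp
        then have "l *\<^sub>R u - T u = l *\<^sub>R const_bcontfun 1"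
          using l0 by (simp add: scaleR_diff_right)
        then show ?thesis by (simp add: algebra_simps)
      qed
      \<comment> \<open>Since r u - T u = l - (l - r) u, the inverse at r bounds the norm of u by K
        times l plus K (l - r) times that norm; the condition on l allows the last term to be
        absorbed.\<close>
      have nu: "norm u \<le> 2 * K * l"
      proof -
        have "u = R (l *\<^sub>R const_bcontfun 1 - (l - r) *\<^sub>R u)"
          using R[of u] unfolding Tu by (simp add: algebra_simps)
        then have "norm u \<le> norm (l *\<^sub>R const_bcontfun 1 - (l - r) *\<^sub>R u :: cantor \<Rightarrow>\<^sub>C real) * K"
          using K(2) by metis
        also have "\<dots> \<le> (l * 1 + (l - r) * norm u) * K"
        proof (intro mult_right_mono norm_triangle_le_diff add_mono)
          have "norm (const_bcontfun 1 :: cantor \<Rightarrow>\<^sub>C real) \<le> 1" by (rule norm_bound) simp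
          then show "norm (l *\<^sub>R const_bcontfun 1 :: cantor \<Rightarrow>\<^sub>C real) \<le> l * 1"
            using l0 by (simp add: mult_left_le)
        qed (use l K in auto)
        also have "\<dots> = l * K + ((l - r) * K) * norm u" by (simp add: algebra_simps)
        also have "\<dots> \<le> l * K + (1 / 2) * norm u"
          by (intro add_left_mono mult_right_mono l) simp
        finally show ?thesis by (simp add: mult_ac)
      qed
      define c where "c = l - 1 / (2 * K)"
      \<comment> \<open>The bound on u shows that the l subtracted in T u = l u - l is at least u /
        (2 K): this is where the rate drops below l by a fixed amount.\<close>
      have Tux: "T u x \<le> c * u x" for x
      proof -
        have "u x \<le> 2 * K * l" using nu norm_bounded[of u x] by simp
        then have "u x / (2 * K) \<le> l" using K(1) by (simp add: divide_le_eq mult_ac)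
        then show ?thesis by (simp add: Tu c_def algebra_simps)
      qed
      have "0 < T u x" for x
        using u1 unfolding T_def ruelle_apply by (intro sum_pos mult_pos_pos less_le_trans[OF zero_less_one u1]) auto
      then have c: "c > 0" using Tux[of undefined] u1[of undefined]
        by (metis less_le_trans zero_less_mult_pos2 zero_less_one)
      have mono: "T g x \<le> T h x" if "\<And>x. g x \<le> h x" for g h :: "cantor \<Rightarrow>\<^sub>C real" and x
        unfolding T_def ruelle_apply using that by (intro sum_mono mult_left_mono) auto
      have Tnu: "(T ^^ n) u x \<le> c ^ n * u x" for n x
      proof (induction n arbitrary: x)
        case (Suc n)
        have "(T ^^ Suc n) u x \<le> T (c ^ n *\<^sub>R u) x" using mono[of "(T ^^ n) u" "c ^ n *\<^sub>R u"] Suc by simp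
        also have "\<dots> = c ^ n * T u x" by (simp add: linear_scale[OF linT])
        also have "\<dots> \<le> c ^ n * (c * u x)" using c by (intro mult_left_mono Tux) auto
        finally show ?case by (simp add: mult_ac)
      qed simp
      have mono_n: "(T ^^ n) (const_bcontfun 1) x \<le> (T ^^ n) u x" for n x
        by (induction n arbitrary: x) (simp_all add: u1 mono)
      have "r ^ n \<le> c ^ n * norm u" for n
      proof -
        have "norm ((T ^^ n) (const_bcontfun 1)) \<le> c ^ n * norm u"
        proof (rule norm_bound)
          fix x
          have "(T ^^ n) (const_bcontfun 1) x \<le> c ^ n * norm u"
            using c abs_bcontfun_le[of u x]
            by (intro order_trans[OF mono_n] order_trans[OF Tnu] mult_left_mono) auto
          then show "norm ((T ^^ n) (const_bcontfun 1) x) \<le> c ^ n * norm u"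
            using partition_function_pos[of f n x] by (simp add: T_def ruelle_iterate_one)
        qed
        then show ?thesis using low[of n] by (simp add: a_def)
      qed
      then have bound: "(r / c) ^ n \<le> norm u" for n
        using c by (simp add: power_divide divide_le_eq mult.commute)
      show "r \<le> c"
      proof (rule ccontr)
        assume "\<not> r \<le> c"
        then have "1 < r / c" using c by simp
        then obtain n where "norm u < (r / c) ^ n" using real_arch_pow by blast
        with bound[of n] show False by simp
      qed
    qed
    \<comment> \<open>The distance 1 / (4 K) from r is less than the gain in \<open>key\<close>,
      which would push the rate strictly below r.\<close>
    define l where "l = r + 1 / (4 * K)"
    have "l > r" "(l - r) * K \<le> 1 / 2" "l < r + 1 / (2 * K)" using K(1) by (auto simp: l_def field_simps)
    with key[of l] show False by simp
  qed
  then have "(SUP z\<in>spectrum T. cmod z) = r"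
    using upper r by (intro cSup_eq_maximum) (auto intro!: image_eqI[of _ _ "complex_of_real r"])
  then show ?thesis unfolding spectral_radius_def T_def r_def .
qed

section \<open>Entropy of itineraries\<close>

definition itinerary :: "(cantor \<Rightarrow> 'l) \<Rightarrow> nat \<Rightarrow> cantor \<Rightarrow> 'l list" where
  "itinerary \<xi> n x = map (\<lambda>i. \<xi> ((left_shift ^^ i) x)) [0..<n]"

text \<open>A finite partition is coded by the map \<xi> sending a point to the label of its atom.
  The sum runs over all words, visited or not: those of probability 0 contribute
  \<open>0 * ln 0 = 0\<close>.\<close>

definition word_entropy :: "cantor measure \<Rightarrow> (cantor \<Rightarrow> 'l) \<Rightarrow> 'l set \<Rightarrow> nat \<Rightarrow> real" where
  "word_entropy \<mu> \<xi> K n = - (\<Sum>w\<in>words K n.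
     measure \<mu> {x. itinerary \<xi> n x = w} * ln (measure \<mu> {x. itinerary \<xi> n x = w}))"

lemma itinerary_eq_iff:
  "itinerary \<xi> n x = w \<longleftrightarrow> length w = n \<and> (\<forall>i<n. \<xi> ((left_shift ^^ i) x) = w ! i)"
  by (auto simp: itinerary_def list_eq_iff_nth_eq)

lemma itinerary_in_words: "(\<And>x. \<xi> x \<in> K) \<Longrightarrow> itinerary \<xi> n x \<in> words K n"
  by (auto simp: itinerary_def words_def)

lemma itinerary_add: "itinerary \<xi> (n + m) x = itinerary \<xi> n x @ itinerary \<xi> m ((left_shift ^^ n) x)"
  by (auto simp: itinerary_def list_eq_iff_nth_eq nth_append left_shift_funpow add.assoc)

lemma coordinate_itinerary: "itinerary (\<lambda>x. x 0) n x = map x [0..<n]"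
  by (simp add: itinerary_def left_shift_funpow)

text \<open>Words with empty cylinder yield no atom and contribute 0, while distinct words with
  nonempty cylinders yield distinct atoms, so no atom is counted twice.\<close>

lemma partition_entropy_iterated_join:
  assumes sp: "space \<mu> = UNIV" and K: "finite K" "\<And>x. \<xi> x \<in> K"
    and P: "P = (\<lambda>k. \<xi> -` {k}) ` K"
  shows "partition_entropy \<mu> (iterated_join \<mu> left_shift P n) = word_entropy \<mu> \<xi> K n"
proof -
  define c where "c w = {x. itinerary \<xi> n x = w}" for w
  define W where "W = {w \<in> words K n. c w \<noteq> {}}"
  have "iterated_join \<mu> left_shift P n = c ` W"
  proof (intro set_eqI iffI)
    fix C assume "C \<in> iterated_join \<mu> left_shift P n"
    then obtain A where C: "C \<noteq> {}" "\<And>i. i < n \<Longrightarrow> A i \<in> P" "C = {x. \<forall>i<n. (left_shift ^^ i) x \<in> A i}"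
      unfolding iterated_join_def sp by auto
    have "\<exists>k. i < n \<longrightarrow> k \<in> K \<and> A i = \<xi> -` {k}" for i
      using C(2)[of i] unfolding P by auto
    then obtain k where k: "\<And>i. i < n \<Longrightarrow> k i \<in> K" "\<And>i. i < n \<Longrightarrow> A i = \<xi> -` {k i}" by metis
    have "C = c (map k [0..<n])"
      unfolding C(3) c_def by (auto simp: itinerary_eq_iff k(2))
    moreover have "map k [0..<n] \<in> words K n" using k(1) by (auto simp: words_def)
    ultimately show "C \<in> c ` W" using C(1) unfolding W_def by blast
  next
    fix C assume "C \<in> c ` W"
    then obtain w where w: "w \<in> words K n" "C \<noteq> {}" "C = c w" unfolding W_def by blast
    have "\<xi> -` {w ! i} \<in> P" if "i < n" for i
      using w(1) that nth_mem[of i w] unfolding P words_def by blast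
    moreover have "C = {x \<in> space \<mu>. \<forall>i<n. (left_shift ^^ i) x \<in> \<xi> -` {w ! i}}"
      using w(1) unfolding w(3) c_def sp by (auto simp: itinerary_eq_iff words_def)
    ultimately have "(\<forall>i<n. \<xi> -` {w ! i} \<in> P) \<and> C = {x \<in> space \<mu>. \<forall>i<n. (left_shift ^^ i) x \<in> \<xi> -` {w ! i}}"
      by simp
    then have "\<exists>A. (\<forall>i<n. A i \<in> P) \<and> C = {x \<in> space \<mu>. \<forall>i<n. (left_shift ^^ i) x \<in> A i}"
      by (intro exI[of _ "\<lambda>i. \<xi> -` {w ! i}"])
    then show "C \<in> iterated_join \<mu> left_shift P n"
      unfolding iterated_join_def using w(2) by simp
  qed
  moreover have "inj_on c W"
    unfolding inj_on_def W_def c_def by blast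
  ultimately have "partition_entropy \<mu> (iterated_join \<mu> left_shift P n)
      = - (\<Sum>w\<in>W. measure \<mu> (c w) * ln (measure \<mu> (c w)))"
    unfolding partition_entropy_def by (simp add: sum.reindex)
  also have "(\<Sum>w\<in>W. measure \<mu> (c w) * ln (measure \<mu> (c w)))
      = (\<Sum>w\<in>words K n. measure \<mu> (c w) * ln (measure \<mu> (c w)))"
    unfolding W_def by (rule sum.mono_neutral_left) (auto simp: finite_words[OF K(1)])
  finally show ?thesis unfolding word_entropy_def c_def .
qed

section \<open>Gibbs' inequality for random variables with finite range\<close>

lemma (in finite_measure) integral_finite_range:
  fixes c :: "'b \<Rightarrow> real"
  assumes Z: "Z \<in> measurable M (count_space S)" and S: "finite S"
  shows integrable_finite_range: "integrable M (\<lambda>x. c (Z x))"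
    and integral_finite_range_eq: "(\<integral>x. c (Z x) \<partial>M) = (\<Sum>z\<in>S. c z * measure M {x \<in> space M. Z x = z})"
proof -
  have sets: "{x \<in> space M. Z x = z} \<in> sets M" if "z \<in> S" for z
    using measurable_sets[OF Z, of "{z}"] that by (simp add: vimage_def Int_def conj_commute)
  have eq: "c (Z x) = (\<Sum>z\<in>S. c z * indicator {x \<in> space M. Z x = z} x)" if x: "x \<in> space M" for x
  proof -
    have "Z x \<in> S" using measurable_space[OF Z x] by simp
    then have "(\<Sum>z\<in>S. c z * indicator {x \<in> space M. Z x = z} x) = (\<Sum>z\<in>{Z x}. c z * indicator {x \<in> space M. Z x = z} x)"
      by (intro sum.mono_neutral_right S) (auto simp: indicator_def)
    then show ?thesis using x by simp
  qed
  have int: "integrable M (\<lambda>x. c z * indicator {x \<in> space M. Z x = z} x)" if "z \<in> S" for z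
    using sets[OF that] by (intro integrable_mult_right integrable_real_indicator) (simp_all add: less_top[symmetric])
  have "integrable M (\<lambda>x. \<Sum>z\<in>S. c z * indicator {x \<in> space M. Z x = z} x)"
    by (intro Bochner_Integration.integrable_sum int)
  then show "integrable M (\<lambda>x. c (Z x))"
    by (subst Bochner_Integration.integrable_cong[OF refl eq])
  have "(\<integral>x. c (Z x) \<partial>M) = (\<integral>x. (\<Sum>z\<in>S. c z * indicator {x \<in> space M. Z x = z} x) \<partial>M)"
    by (rule Bochner_Integration.integral_cong[OF refl eq])
  also have "\<dots> = (\<Sum>z\<in>S. \<integral>x. c z * indicator {x \<in> space M. Z x = z} x \<partial>M)"
    by (rule Bochner_Integration.integral_sum[OF int])
  also have "\<dots> = (\<Sum>z\<in>S. c z * measure M {x \<in> space M. Z x = z})"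
    using sets by (intro sum.cong refl) (simp add: Int_absorb1 sets.sets_into_space)
  finally show "(\<integral>x. c (Z x) \<partial>M) = (\<Sum>z\<in>S. c z * measure M {x \<in> space M. Z x = z})" .
qed

text \<open>The auxiliary U gives q something to depend on while only the entropy of W is estimated.
  It will be constant for subadditivity, a window of coordinates for the upper bound, and an offset
  with a window for the lower bound.\<close>

lemma (in prob_space) gibbs_inequality:
  fixes q :: "'b \<Rightarrow> 'c \<Rightarrow> real"
  assumes fin: "finite A" "finite K"
    and U: "U \<in> measurable M (count_space A)" and W: "W \<in> measurable M (count_space K)"
    and q: "\<And>u w. u \<in> A \<Longrightarrow> w \<in> K \<Longrightarrow> 0 \<le> q u w"
    and pos: "\<And>u w. u \<in> A \<Longrightarrow> w \<in> K \<Longrightarrow> 0 < prob {x \<in> space M. U x = u \<and> W x = w} \<Longrightarrow> 0 < q u w"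
    and q_sum: "(\<Sum>u\<in>A. \<Sum>w\<in>K. q u w) \<le> 1"
  shows "- (\<Sum>w\<in>K. prob {x \<in> space M. W x = w} * ln (prob {x \<in> space M. W x = w}))
    \<le> - (\<integral>x. ln (q (U x) (W x)) \<partial>M)"
proof -
  let ?p = "\<lambda>u w. prob {x \<in> space M. U x = u \<and> W x = w}"
  let ?Z = "\<lambda>x. (U x, W x)"
  have sU: "U -` {u} \<inter> space M \<in> sets M" if "u \<in> A" for u using measurable_sets[OF U, of "{u}"] that by simp
  have sW: "W -` {w} \<inter> space M \<in> sets M" if "w \<in> K" for w using measurable_sets[OF W, of "{w}"] that by simp
  have "?Z -` {(u, w)} \<inter> space M = (U -` {u} \<inter> space M) \<inter> (W -` {w} \<inter> space M)" for u w by auto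
  then have Z: "?Z \<in> measurable M (count_space (A \<times> K))"
    using fin measurable_space[OF U] measurable_space[OF W] sU sW
    by (subst measurable_count_space_eq2) auto
  have int: "(\<integral>x. c (U x) (W x) \<partial>M) = (\<Sum>u\<in>A. \<Sum>w\<in>K. c u w * ?p u w)" for c :: "'b \<Rightarrow> 'c \<Rightarrow> real"
    using integral_finite_range_eq[OF Z, of "\<lambda>(u, w). c u w"] fin by (simp add: sum.cartesian_product split_beta prod_eq_iff)
  have marg: "(\<Sum>u\<in>A. ?p u w) = prob {x \<in> space M. W x = w}" if w: "w \<in> K" for w
  proof -
    have "(\<integral>x. (if W x = w then 1 else 0) \<partial>M) = (\<integral>x. indicator {x \<in> space M. W x = w} x \<partial>M :: real)"
      by (rule Bochner_Integration.integral_cong) auto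
    also have "\<dots> = prob ({x \<in> space M. W x = w} \<inter> space M)" by simp
    also have "\<dots> = prob {x \<in> space M. W x = w}" by (rule arg_cong[where f = prob]) auto
    finally have "prob {x \<in> space M. W x = w} = (\<Sum>u\<in>A. \<Sum>v\<in>K. (if v = w then 1 else 0) * ?p u v)"
      using int[of "\<lambda>u v. if v = w then 1 else 0"] by simp
    also have "\<dots> = (\<Sum>u\<in>A. ?p u w)"
    proof (intro sum.cong refl)
      fix u
      show "(\<Sum>v\<in>K. (if v = w then 1 else 0) * ?p u v) = ?p u w"
        by (subst sum.remove[OF fin(2) w]) (auto intro!: sum.neutral)
    qed
    finally show ?thesis by simp
  qed
  have one: "(\<Sum>w\<in>K. \<Sum>u\<in>A. ?p u w) = 1"
    using int[of "\<lambda>_ _. 1"] by (simp add: prob_space) (subst sum.swap, simp)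
  have "- (\<Sum>w\<in>K. (\<Sum>u\<in>A. ?p u w) * ln (\<Sum>u\<in>A. ?p u w)) \<le> - (\<Sum>w\<in>K. \<Sum>u\<in>A. ?p u w * ln (q u w))"
    by (rule gibbs_marginal[OF fin]) (use q pos q_sum one in \<open>auto simp: sum.swap[of _ A K]\<close>)
  also have "(\<Sum>w\<in>K. \<Sum>u\<in>A. ?p u w * ln (q u w)) = (\<integral>x. ln (q (U x) (W x)) \<partial>M)"
    unfolding int[of "\<lambda>u w. ln (q u w)"] by (subst sum.swap) (simp add: mult.commute)
  finally show ?thesis by (simp add: marg)
qed

text \<open>A word sent letter by letter through a substochastic channel with inputs
  \<open>b i\<close> has total mass at most 1: summing over the last letter removes one factor at a
  time.\<close>

lemma sum_words_prod_le_1: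
  fixes r :: "'l \<Rightarrow> 'b \<Rightarrow> real"
  assumes r: "\<And>a b. 0 \<le> r a b" and le: "\<And>b. (\<Sum>a\<in>K. r a b) \<le> 1"
  shows "(\<Sum>w\<in>words K n. \<Prod>i<n. r (w ! i) (b i)) \<le> 1"
proof (induction n)
  case 0
  show ?case by (simp add: words_0)
next
  case (Suc n)
  have "(\<Sum>w\<in>words K (Suc n). \<Prod>i<Suc n. r (w ! i) (b i))
      = (\<Sum>u\<in>words K n. (\<Prod>i<n. r (u ! i) (b i)) * (\<Sum>a\<in>K. r a (b n)))"
    unfolding sum_words_Suc sum_distrib_left
    by (intro sum.cong refl) (auto simp: words_def nth_append intro!: prod.cong)
  also have "\<dots> \<le> (\<Sum>u\<in>words K n. (\<Prod>i<n. r (u ! i) (b i)) * 1)"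
    by (intro sum_mono mult_left_mono le prod_nonneg r)
  also have "\<dots> \<le> 1" using Suc by simp
  finally show ?case .
qed

lemma measurable_coordinate: "{x :: cantor. x i \<in> A} \<in> sets borel"
proof -
  have "open ((\<lambda>x :: cantor. x i) -` A)"
    by (rule open_vimage[OF discrete_topology_class.open_discrete continuous_on_product_coordinates])
  then show ?thesis by (simp add: vimage_def)
qed

section \<open>Invariant measures and the subadditivity of their entropies\<close>

locale shift_invariant_measure = prob_space \<mu> for \<mu> :: "cantor measure" +
  assumes sets_eq: "sets \<mu> = sets borel" and invariant: "distr \<mu> borel left_shift = \<mu>"
begin

lemma space_eq: "space \<mu> = UNIV"
  using sets_eq_imp_space_eq[OF sets_eq] by simp

lemma measurable_shift: "left_shift ^^ i \<in> measurable \<mu> \<mu>"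
proof (induction i)
  case 0
  show ?case by (simp add: id_def)
next
  case (Suc i)
  have "left_shift \<in> measurable borel borel"
    by (rule borel_measurable_continuous_onI[OF continuous_on_left_shift])
  then have "left_shift \<in> measurable \<mu> \<mu>"
    by (subst measurable_cong_sets[OF sets_eq sets_eq])
  then show ?case using measurable_comp[OF Suc] by simp
qed

lemma distr_shift: "distr \<mu> \<mu> (left_shift ^^ i) = \<mu>"
proof (induction i)
  case 0
  show ?case by (simp add: id_def distr_id)
next
  case (Suc i)
  have 1: "distr \<mu> \<mu> left_shift = \<mu>"
    using invariant by (metis distr_cong sets_eq)
  have "distr \<mu> \<mu> (left_shift ^^ Suc i) = distr (distr \<mu> \<mu> (left_shift ^^ i)) \<mu> left_shift"
    using measurable_shift[of 1] by (subst distr_distr[OF _ measurable_shift]) simp_all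
  then show ?case by (simp add: Suc 1 o_def)
qed

lemma integral_shift:
  fixes g :: "cantor \<Rightarrow> real"
  assumes "g \<in> borel_measurable \<mu>"
  shows "(\<integral>x. g ((left_shift ^^ i) x) \<partial>\<mu>) = (\<integral>x. g x \<partial>\<mu>)"
  using integral_distr[OF measurable_shift assms, of i] by (simp add: distr_shift)

lemma borel_measurable_bcontfun: "apply_bcontfun f \<in> borel_measurable \<mu>" for f :: "cantor \<Rightarrow>\<^sub>C real"
  by (subst measurable_cong_sets[OF sets_eq refl])
    (rule borel_measurable_continuous_onI[OF continuous_on_apply_bcontfun])

lemma integrable_bcontfun: "integrable \<mu> (apply_bcontfun f)" for f :: "cantor \<Rightarrow>\<^sub>C real"
  by (rule integrable_const_bound[where B = "norm f"])
    (use abs_bcontfun_le[of f] in \<open>auto intro: borel_measurable_bcontfun\<close>)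

lemma integrable_birkhoff_sum: "integrable \<mu> (birkhoff_sum f n)"
  and integral_birkhoff_sum: "(\<integral>x. birkhoff_sum f n x \<partial>\<mu>) = real n * (\<integral>x. f x \<partial>\<mu>)"
proof -
  have int: "integrable \<mu> (\<lambda>x. f ((left_shift ^^ i) x))" for i
    using integrable_distr[OF measurable_shift, of i "apply_bcontfun f"] integrable_bcontfun[of f]
    by (simp add: distr_shift)
  show "integrable \<mu> (birkhoff_sum f n)"
    unfolding birkhoff_sum_def using int by simp
  show "(\<integral>x. birkhoff_sum f n x \<partial>\<mu>) = real n * (\<integral>x. f x \<partial>\<mu>)"
    unfolding birkhoff_sum_def using int by (simp add: integral_shift borel_measurable_bcontfun)
qed

lemma measurable_itinerary:
  assumes \<xi>: "\<xi> \<in> measurable \<mu> (count_space K)" and K: "finite K"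
  shows "itinerary \<xi> n \<in> measurable \<mu> (count_space (words K n))"
proof (subst measurable_count_space_eq2[OF finite_words[OF K]], intro conjI ballI)
  have "\<xi> x \<in> K" for x using measurable_space[OF \<xi>, of x] by (simp add: space_eq)
  then show "itinerary \<xi> n \<in> space \<mu> \<rightarrow> words K n" by (auto intro: itinerary_in_words)
  fix w assume w: "w \<in> words K n"
  have "{x. \<xi> ((left_shift ^^ i) x) = w ! i} \<in> sets \<mu>" if "i < n" for i
  proof -
    have "w ! i \<in> K" using w that nth_mem[of i w] unfolding words_def by blast
    moreover have "(\<lambda>x. \<xi> ((left_shift ^^ i) x)) \<in> measurable \<mu> (count_space K)"
      by (rule measurable_compose[OF measurable_shift \<xi>])
    ultimately show ?thesis
      using measurable_sets[of _ \<mu> "count_space K" "{w ! i}"] by (force simp: vimage_def space_eq)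
  qed
  then have "{x \<in> space \<mu>. \<forall>i\<in>{..<n}. \<xi> ((left_shift ^^ i) x) = w ! i} \<in> sets \<mu>"
    by (intro sets.sets_Collect_finite_All) (auto simp: space_eq)
  moreover have "itinerary \<xi> n -` {w} \<inter> space \<mu> = {x \<in> space \<mu>. \<forall>i\<in>{..<n}. \<xi> ((left_shift ^^ i) x) = w ! i}"
    using w by (auto simp: itinerary_eq_iff words_def)
  ultimately show "itinerary \<xi> n -` {w} \<inter> space \<mu> \<in> sets \<mu>" by simp
qed

lemma word_entropy_integral:
  assumes \<xi>: "\<xi> \<in> measurable \<mu> (count_space K)" and K: "finite K"
  shows "word_entropy \<mu> \<xi> K n = - (\<integral>x. ln (prob {y. itinerary \<xi> n y = itinerary \<xi> n x}) \<partial>\<mu>)"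
  using integral_finite_range_eq[OF measurable_itinerary[OF \<xi> K, of n] finite_words[OF K, of n],
      where c = "\<lambda>w. ln (prob {y. itinerary \<xi> n y = w})"]
  by (simp add: word_entropy_def space_eq mult.commute)

lemma word_entropy_nonneg: "0 \<le> word_entropy \<mu> \<xi> K n"
proof -
  have "p * ln p \<le> 0" if "0 \<le> p" "p \<le> 1" for p :: real
    using that by (cases "p = 0") (auto intro: mult_nonneg_nonpos simp: ln_le_zero_iff)
  then show ?thesis
    unfolding word_entropy_def by (simp add: sum_nonpos)
qed

text \<open>Here q is the product of the laws of the first n and of the last m letters; invariance
  gives the latter the same law as the initial m letters.\<close>

lemma word_entropy_subadditive:
  assumes \<xi>: "\<xi> \<in> measurable \<mu> (count_space K)" and K: "finite K"
  shows "word_entropy \<mu> \<xi> K (n + m) \<le> word_entropy \<mu> \<xi> K n + word_entropy \<mu> \<xi> K m"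
proof -
  define P where "P n w = prob {x. itinerary \<xi> n x = w}" for n w
  have me: "itinerary \<xi> n \<in> measurable \<mu> (count_space (words K n))" for n
    by (rule measurable_itinerary[OF \<xi> K])
  have S: "{x. itinerary \<xi> n x = w} \<in> sets \<mu>" if "w \<in> words K n" for n w
    using measurable_sets[OF me, of "{w}" n] that by (simp add: vimage_def space_eq)
  have me2: "(\<lambda>x. itinerary \<xi> m ((left_shift ^^ n) x)) \<in> measurable \<mu> (count_space (words K m))"
    by (rule measurable_compose[OF measurable_shift me])
  have sumP: "(\<Sum>w\<in>words K n. P n w) = 1" for n
    using integral_finite_range_eq[OF me[of n] finite_words[OF K], where c = "\<lambda>_. 1"]
    by (simp add: P_def space_eq prob_space[unfolded space_eq])
  have shiftP: "prob {x. itinerary \<xi> m ((left_shift ^^ n) x) = w} = P m w" if "w \<in> words K m" for w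
  proof -
    have "prob {x. itinerary \<xi> m ((left_shift ^^ n) x) = w}
        = measure (distr \<mu> \<mu> (left_shift ^^ n)) {x. itinerary \<xi> m x = w}"
      by (subst measure_distr[OF measurable_shift S[OF that]]) (simp add: vimage_def space_eq)
    then show ?thesis by (simp add: distr_shift P_def)
  qed
  have "- (\<Sum>w\<in>words K (n + m). prob {x \<in> space \<mu>. itinerary \<xi> (n + m) x = w} * ln (prob {x \<in> space \<mu>. itinerary \<xi> (n + m) x = w}))
    \<le> - (\<integral>x. ln (P n (take n (itinerary \<xi> (n + m) x)) * P m (drop n (itinerary \<xi> (n + m) x))) \<partial>\<mu>)"
  \<comment> \<open>The auxiliary variable is constant, since q depends on the word alone.\<close>
  proof (rule gibbs_inequality[where A = "{()}" and U = "\<lambda>_. ()" and q = "\<lambda>_ w. P n (take n w) * P m (drop n w)"])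
    show "(\<Sum>u\<in>{()}. \<Sum>w\<in>words K (n + m). P n (take n w) * P m (drop n w)) \<le> 1"
    proof -
      have "(\<Sum>w\<in>words K (n + m). P n (take n w) * P m (drop n w))
          = (\<Sum>u\<in>words K n. \<Sum>v\<in>words K m. P n u * P m v)"
        unfolding sum_words_append by (intro sum.cong refl) (simp add: words_def)
      also have "\<dots> = 1" by (simp add: sum_distrib_left[symmetric] sumP)
      finally show ?thesis by simp
    qed
    fix u w assume w: "w \<in> words K (n + m)"
      and pos: "0 < prob {x \<in> space \<mu>. () = u \<and> itinerary \<xi> (n + m) x = w}"
    have tw: "take n w \<in> words K n" "drop n w \<in> words K m"
      using w set_take_subset[of n w] set_drop_subset[of n w] by (auto simp: words_def)
    have len: "length (itinerary \<xi> n x) = n" for x by (simp add: itinerary_def)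
    have "0 < P n (take n w)"
      unfolding P_def
      by (rule less_le_trans[OF pos finite_measure_mono[OF _ S[OF tw(1)]]])
        (auto simp: itinerary_add len)
    moreover have "{x. itinerary \<xi> m ((left_shift ^^ n) x) = drop n w} \<in> sets \<mu>"
      using measurable_sets[OF me2, of "{drop n w}"] tw by (simp add: vimage_def space_eq)
    then have "0 < prob {x. itinerary \<xi> m ((left_shift ^^ n) x) = drop n w}"
      by (intro less_le_trans[OF pos finite_measure_mono]) (auto simp: itinerary_add len)
    ultimately show "0 < P n (take n w) * P m (drop n w)" using shiftP[OF tw(2)] by simp
  qed (auto simp: me finite_words[OF K] P_def)
  also have "\<dots> = - (\<integral>x. ln (P n (itinerary \<xi> n x) * P m (itinerary \<xi> m ((left_shift ^^ n) x))) \<partial>\<mu>)"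
    by (simp add: itinerary_add) (simp add: itinerary_def)
  also have "(\<integral>x. ln (P n (itinerary \<xi> n x) * P m (itinerary \<xi> m ((left_shift ^^ n) x))) \<partial>\<mu>)
      = (\<integral>x. ln (P n (itinerary \<xi> n x)) + ln (P m (itinerary \<xi> m ((left_shift ^^ n) x))) \<partial>\<mu>)"
  \<comment> \<open>With \<open>ln 0 = 0\<close> the logarithm of a product splits only for nonzero
    factors, so the null set of points whose words have probability 0 must be discarded.\<close>
  proof (rule integral_cong_AE)
    have pos: "AE x in \<mu>. P n (Z x) \<noteq> 0" if Z: "Z \<in> measurable \<mu> (count_space (words K n))"
      and eq: "\<And>w. w \<in> words K n \<Longrightarrow> prob {x. Z x = w} = P n w" for n Z
    proof -
      have "AE x in \<mu>. \<forall>w\<in>words K n. P n w = 0 \<longrightarrow> Z x \<noteq> w"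
      proof (rule AE_finite_allI[OF finite_words[OF K]])
        fix w assume w: "w \<in> words K n"
        have "{x. Z x = w} \<in> sets \<mu>"
          using measurable_sets[OF Z, of "{w}"] w by (simp add: vimage_def space_eq)
        moreover have "emeasure \<mu> {x. Z x = w} = 0" if "P n w = 0"
          using eq[OF w] that by (simp add: emeasure_eq_measure)
        ultimately show "AE x in \<mu>. P n w = 0 \<longrightarrow> Z x \<noteq> w"
          by (cases "P n w = 0") (auto intro!: AE_I[where N = "{x. Z x = w}"])
      qed
      then show ?thesis
        by eventually_elim (use measurable_space[OF Z] in \<open>auto simp: space_eq\<close>)
    qed
    have "AE x in \<mu>. P n (itinerary \<xi> n x) \<noteq> 0" "AE x in \<mu>. P m (itinerary \<xi> m ((left_shift ^^ n) x)) \<noteq> 0"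
      using pos[OF me] pos[OF me2 shiftP] by (simp_all add: P_def)
    then show "AE x in \<mu>. ln (P n (itinerary \<xi> n x) * P m (itinerary \<xi> m ((left_shift ^^ n) x)))
        = ln (P n (itinerary \<xi> n x)) + ln (P m (itinerary \<xi> m ((left_shift ^^ n) x)))"
      by eventually_elim (auto simp: ln_mult P_def)
    have b: "(\<lambda>x. c (itinerary \<xi> n x)) \<in> borel_measurable \<mu>"
      "(\<lambda>x. c (itinerary \<xi> n ((left_shift ^^ k) x))) \<in> borel_measurable \<mu>" for c :: "'a list \<Rightarrow> real" and n k
      by (rule measurable_compose[OF me], simp)
        (rule measurable_compose[OF measurable_compose[OF measurable_shift me]], simp)
    show "(\<lambda>x. ln (P n (itinerary \<xi> n x)) + ln (P m (itinerary \<xi> m ((left_shift ^^ n) x)))) \<in> borel_measurable \<mu>"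
      by (intro borel_measurable_add b(1)[of "\<lambda>w. ln (P n w)"] b(2)[of "\<lambda>w. ln (P m w)"])
    show "(\<lambda>x. ln (P n (itinerary \<xi> n x) * P m (itinerary \<xi> m ((left_shift ^^ n) x)))) \<in> borel_measurable \<mu>"
      by (intro borel_measurable_ln borel_measurable_times b)
  qed
  also have "\<dots> = (\<integral>x. ln (P n (itinerary \<xi> n x)) \<partial>\<mu>) + (\<integral>x. ln (P m (itinerary \<xi> m ((left_shift ^^ n) x))) \<partial>\<mu>)"
    by (intro Bochner_Integration.integral_add
        integrable_finite_range[OF me finite_words[OF K], where c = "\<lambda>w. ln (P n w)"]
        integrable_finite_range[OF me2 finite_words[OF K], where c = "\<lambda>w. ln (P m w)"])
  also have "(\<integral>x. ln (P m (itinerary \<xi> m ((left_shift ^^ n) x))) \<partial>\<mu>) = (\<integral>x. ln (P m (itinerary \<xi> m x)) \<partial>\<mu>)"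
    by (rule integral_shift) (rule measurable_compose[OF me], simp)
  finally show ?thesis
    unfolding word_entropy_integral[OF \<xi> K, of n] word_entropy_integral[OF \<xi> K, of m]
    by (simp add: word_entropy_def P_def space_eq)
qed

lemma word_entropy_limit:
  assumes "\<xi> \<in> measurable \<mu> (count_space K)" "finite K"
  obtains h where "(\<lambda>n. word_entropy \<mu> \<xi> K n / real n) \<longlonglongrightarrow> h"
proof (rule subadditive_limit[of "word_entropy \<mu> \<xi> K" 0])
  show "- 0 * real n \<le> word_entropy \<mu> \<xi> K n" for n using word_entropy_nonneg by simp
qed (use word_entropy_subadditive[OF assms] that in auto)

end

section \<open>Upper bound in the variational principle\<close>

definition determined_by :: "nat \<Rightarrow> cantor set \<Rightarrow> bool" where
  "determined_by m B \<longleftrightarrow> (\<forall>x y. (\<forall>i<m. x i = y i) \<longrightarrow> x \<in> B \<longrightarrow> y \<in> B)"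

lemma determined_byD:
  assumes "determined_by m B" "\<forall>i<m. x i = y i"
  shows "x \<in> B \<longleftrightarrow> y \<in> B"
proof -
  have "\<forall>i<m. y i = x i" using assms(2) by simp
  then show ?thesis using assms unfolding determined_by_def by blast
qed

lemma determined_by_mono:
  assumes "determined_by m B" "m \<le> m'"
  shows "determined_by m' B"
  unfolding determined_by_def
proof (intro allI impI)
  fix x y :: cantor assume "\<forall>i<m'. x i = y i" "x \<in> B"
  moreover from this assms(2) have "\<forall>i<m. x i = y i" by simp
  ultimately show "y \<in> B" using assms(1) unfolding determined_by_def by blast
qed

lemma determined_by_UN: "(\<And>i. i \<in> I \<Longrightarrow> determined_by m (B i)) \<Longrightarrow> determined_by m (\<Union>i\<in>I. B i)"
  unfolding determined_by_def by blast

lemma determined_by_borel: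
  assumes "determined_by m B"
  shows "B \<in> sets borel"
proof -
  have "open B"
    unfolding open_subopen[of B]
  proof
    fix x assume "x \<in> B"
    then have "{y. \<forall>i<m. x i = y i} \<subseteq> B" using assms unfolding determined_by_def by blast
    then show "\<exists>T. open T \<and> x \<in> T \<and> T \<subseteq> B"
      by (intro exI[of _ "{y. \<forall>i<m. x i = y i}"] conjI open_cylinder) auto
  qed
  then show ?thesis by simp
qed

lemma borel_cantor_eq_sigma_cylinders:
  "(borel :: cantor measure) = sigma UNIV (range (\<lambda>w. {y. \<forall>i<length w. w ! i = y i}))"
proof (rule borel_eq_countable_basis)
  show "countable (range (\<lambda>w. {y :: cantor. \<forall>i<length w. w ! i = y i}))" by simp
  show "topological_basis (range (\<lambda>w. {y :: cantor. \<forall>i<length w. w ! i = y i}))"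
  proof (rule topological_basisI)
    show "open X" if "X \<in> (range (\<lambda>w. {y :: cantor. \<forall>i<length w. w ! i = y i}))" for X using that open_cylinder[of "length w" "\<lambda>i. w ! i" for w] by auto
    fix X and x :: cantor assume "open X" "x \<in> X"
    then obtain d where d: "d > 0" "\<And>y. cantor_dist x y < d \<Longrightarrow> y \<in> X" unfolding open_cantor_iff by blast
    obtain n where n: "(1 / 2 :: real) ^ n < d" using real_arch_pow_inv[OF d(1), of "1 / 2"] by auto
    have "{y. \<forall>i<length (map x [0..<n]). map x [0..<n] ! i = y i} \<subseteq> X"
      using d(2) n by (auto simp: cantor_dist_less_iff[symmetric] intro: less_trans)
    then show "\<exists>B'\<in>(range (\<lambda>w. {y :: cantor. \<forall>i<length w. w ! i = y i})). x \<in> B' \<and> B' \<subseteq> X"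
      by (intro bexI[OF _ rangeI[of _ "map x [0..<n]"]]) simp
  qed
qed

context shift_invariant_measure
begin

text \<open>The sets that can be approximated include the cylinders and are closed under complements
  and countable unions, hence exhaust the generated sigma-algebra.\<close>

lemma approximate_by_determined:
  assumes "A \<in> sets \<mu>" "e > 0"
  shows "\<exists>m B. determined_by m B \<and> prob ((A - B) \<union> (B - A)) < e"
proof -
  define G :: "cantor set set" where "G = range (\<lambda>w. {y. \<forall>i<length w. w ! i = y i})"
  have "(borel :: cantor measure) = sigma UNIV G"
    unfolding G_def by (rule borel_cantor_eq_sigma_cylinders)
  then have "sets \<mu> = sets (sigma UNIV G)" unfolding sets_eq by (rule arg_cong)
  then have gen: "sets \<mu> = sigma_sets UNIV G" by simp
  have "A \<in> sigma_sets UNIV G" using assms(1) gen by simp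
  then show ?thesis using assms(2)
  proof (induction arbitrary: e)
    case (Basic A)
    then obtain w where A: "A = {y. \<forall>i<length w. w ! i = y i}" unfolding G_def by blast
    have "determined_by (length w) A" unfolding determined_by_def A by auto
    then show ?case using Basic.prems by (intro exI[of _ "length w"] exI[of _ A]) simp
  next
    case Empty
    then show ?case by (intro exI[of _ 0] exI[of _ "{}"]) (simp add: determined_by_def)
  next
    case (Compl A)
    obtain m B where B: "determined_by m B" "prob ((A - B) \<union> (B - A)) < e"
      using Compl.IH[OF Compl.prems] by blast
    have "determined_by m (- B)"
      unfolding determined_by_def
    proof (intro allI impI)
      fix x y :: cantor assume "\<forall>i<m. x i = y i" "x \<in> - B"
      then show "y \<in> - B" using determined_byD[OF B(1), of x y] by simp
    qed
    moreover have "(UNIV - A - - B) \<union> (- B - (UNIV - A)) = (A - B) \<union> (B - A)" by auto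
    ultimately show ?case using B(2) by metis
  next
    case (Union a)
    have a: "a i \<in> sets \<mu>" for i using Union.hyps[of i] gen by simp
    let ?A = "\<Union>i. a i"
    have "(\<lambda>k. prob (\<Union>i<k. a i)) \<longlonglongrightarrow> prob (\<Union>k. \<Union>i<k. a i)"
      using a by (intro finite_Lim_measure_incseq) (auto simp: incseq_def intro: less_le_trans)
    moreover have "(\<Union>k. \<Union>i<k. a i) = ?A" by auto
    ultimately have "(\<lambda>k. prob (\<Union>i<k. a i)) \<longlonglongrightarrow> prob ?A" by simp
    then obtain k where "norm (prob (\<Union>i<k. a i) - prob ?A) < e / 2"
      using LIMSEQ_D[of _ _ "e / 2"] Union.prems by (metis half_gt_zero order_refl)
    moreover have "prob (?A - (\<Union>i<k. a i)) = prob ?A - prob (\<Union>i<k. a i)"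
      using a by (intro finite_measure_Diff) auto
    ultimately have k: "prob (?A - (\<Union>i<k. a i)) < e / 2"
      unfolding real_norm_def abs_less_iff by linarith
    \<comment> \<open>Truncating the union costs half of e; the k remaining sets share the other
      half. The added 1 keeps the denominator nonzero for k = 0.\<close>
    define d where "d = e / (2 * (real k + 1))"
    have d: "d > 0" using Union.prems by (simp add: d_def)
    have "\<forall>i. \<exists>m B. determined_by m B \<and> prob ((a i - B) \<union> (B - a i)) < d"
      using Union.IH d by blast
    then obtain m B where B: "\<And>i. determined_by (m i) (B i)" "\<And>i. prob ((a i - B i) \<union> (B i - a i)) < d"
      by metis
    have Bs: "B i \<in> sets \<mu>" for i using determined_by_borel[OF B(1)] sets_eq by simp
    let ?B = "\<Union>i<k. B i"
    have "m i \<le> (\<Sum>i<k. m i)" if "i < k" for i using that by (intro member_le_sum) auto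
    then have det: "determined_by (\<Sum>i<k. m i) ?B"
      by (intro determined_by_UN determined_by_mono[OF B(1)]) simp
    have "prob ((?A - ?B) \<union> (?B - ?A))
        \<le> prob ((?A - (\<Union>i<k. a i)) \<union> (\<Union>i<k. (a i - B i) \<union> (B i - a i)))"
      using a Bs by (intro finite_measure_mono) auto
    also have "\<dots> \<le> prob (?A - (\<Union>i<k. a i)) + prob (\<Union>i<k. (a i - B i) \<union> (B i - a i))"
      using a Bs by (intro measure_Un_le) auto
    also have "prob (\<Union>i<k. (a i - B i) \<union> (B i - a i)) \<le> (\<Sum>i<k. prob ((a i - B i) \<union> (B i - a i)))"
      using a Bs by (intro finite_measure_subadditive_finite) auto
    also have "\<dots> \<le> real k * d"
      using sum_bounded_above[of "{..<k}" "\<lambda>i. prob ((a i - B i) \<union> (B i - a i))" d] B(2)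
      by (simp add: less_imp_le)
    also have "real k * d \<le> e / 2"
      using Union.prems unfolding d_def by (simp add: field_simps)
    finally have "prob ((?A - ?B) \<union> (?B - ?A)) < e" using k by simp
    then show ?case using det by blast
  qed
qed

text \<open>Each label set is approximated by a set read off finitely many coordinates, and a label
  is chosen accordingly. Wrong labels occur only inside the union of the symmetric
  differences.\<close>

lemma approximate_labels:
  assumes \<xi>: "\<xi> \<in> measurable \<mu> (count_space K)" and K: "finite K" and e: "e > 0"
  obtains m \<eta> where "\<forall>x y. (\<forall>i<m. x i = y i) \<longrightarrow> \<eta> x = \<eta> y"
    "{x. \<xi> x \<noteq> \<eta> x} \<in> sets \<mu>" "prob {x. \<xi> x \<noteq> \<eta> x} \<le> e"
proof -
  have \<xi>K: "\<xi> x \<in> K" for x using measurable_space[OF \<xi>, of x] by (simp add: space_eq)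
  have S: "\<xi> -` {k} \<in> sets \<mu>" if "k \<in> K" for k
    using measurable_sets[OF \<xi>, of "{k}"] that by (simp add: space_eq)
  define d where "d = e / (real (card K) + 1)"
  have d: "d > 0" using e by (simp add: d_def)
  have "\<forall>k\<in>K. \<exists>m B. determined_by m B \<and> prob ((\<xi> -` {k} - B) \<union> (B - \<xi> -` {k})) < d"
    using approximate_by_determined[OF S d] by blast
  then obtain m B where B: "\<And>k. k \<in> K \<Longrightarrow> determined_by (m k) (B k)"
      "\<And>k. k \<in> K \<Longrightarrow> prob ((\<xi> -` {k} - B k) \<union> (B k - \<xi> -` {k})) < d"
    by metis
  have Bs: "B k \<in> sets \<mu>" if "k \<in> K" for k using determined_by_borel[OF B(1)[OF that]] sets_eq by simp
  define M where "M = (\<Sum>k\<in>K. m k)"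
  \<comment> \<open>The sets \<open>B k\<close> may overlap or leave points uncovered; the choice is
    then arbitrary, possibly outside K. It still depends on the first M coordinates only, because
    the predicate does.\<close>
  define \<eta> where "\<eta> x = (SOME k. k \<in> K \<and> x \<in> B k)" for x
  have \<eta>: "\<eta> x = \<eta> y" if xy: "\<And>i. i < M \<Longrightarrow> x i = y i" for x y
  proof -
    have "x \<in> B k \<longleftrightarrow> y \<in> B k" if k: "k \<in> K" for k
    proof -
      have "m k \<le> M" unfolding M_def using k K by (intro member_le_sum) auto
      then have "\<forall>i<m k. x i = y i" using xy by simp
      then show ?thesis by (rule determined_byD[OF B(1)[OF k]])
    qed
    then have "(\<lambda>k. k \<in> K \<and> x \<in> B k) = (\<lambda>k. k \<in> K \<and> y \<in> B k)" by (intro ext) blast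
    then show ?thesis unfolding \<eta>_def by simp
  qed
  let ?E = "\<Union>k\<in>K. (\<xi> -` {k} - B k) \<union> (B k - \<xi> -` {k})"
  have sub: "{x. \<xi> x \<noteq> \<eta> x} \<subseteq> ?E"
  proof
    fix x assume x: "x \<in> {x. \<xi> x \<noteq> \<eta> x}"
    show "x \<in> ?E"
    proof (rule ccontr)
      assume "x \<notin> ?E"
      then have "x \<in> B k \<longleftrightarrow> \<xi> x = k" if "k \<in> K" for k using that by blast
      then have "(\<lambda>k. k \<in> K \<and> x \<in> B k) = (\<lambda>k. k = \<xi> x)" using \<xi>K[of x] by (intro ext) blast
      then have "\<eta> x = \<xi> x" unfolding \<eta>_def by simp
      with x show False by simp
    qed
  qed
  have \<eta>S: "{x. \<eta> x = k} \<in> sets \<mu>" for k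
    unfolding sets_eq
  proof (rule determined_by_borel[of M], unfold determined_by_def, intro allI impI)
    fix x y assume "\<forall>i<M. x i = y i" "x \<in> {x. \<eta> x = k}"
    then show "y \<in> {x. \<eta> x = k}" using \<eta>[of x y] by simp
  qed
  have "x \<in> (\<Union>k\<in>K. \<xi> -` {k} \<inter> {x. \<eta> x = k}) \<longleftrightarrow> \<xi> x = \<eta> x" for x using \<xi>K[of x] by auto
  then have "{x. \<xi> x \<noteq> \<eta> x} = UNIV - (\<Union>k\<in>K. \<xi> -` {k} \<inter> {x. \<eta> x = k})" by blast
  then have meas: "{x. \<xi> x \<noteq> \<eta> x} \<in> sets \<mu>"
    using K S \<eta>S sets.top[of \<mu>] by (auto simp: space_eq intro!: sets.Diff sets.finite_UN)
  have "prob {x. \<xi> x \<noteq> \<eta> x} \<le> prob ?E"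
    using K S Bs by (intro finite_measure_mono sub sets.finite_UN) auto
  also have "\<dots> \<le> (\<Sum>k\<in>K. prob ((\<xi> -` {k} - B k) \<union> (B k - \<xi> -` {k})))"
    using K S Bs by (intro finite_measure_subadditive_finite) auto
  also have "\<dots> \<le> real (card K) * d"
    using sum_bounded_above[of K "\<lambda>k. prob ((\<xi> -` {k} - B k) \<union> (B k - \<xi> -` {k}))" d] B(2)
    by (simp add: less_imp_le)
  also have "\<dots> \<le> e" using e unfolding d_def by (simp add: field_simps)
  finally have le: "prob {x. \<xi> x \<noteq> \<eta> x} \<le> e" .
  have "\<forall>x y. (\<forall>i<M. x i = y i) \<longrightarrow> \<eta> x = \<eta> y"
    by (intro allI impI \<eta>) blast
  then show ?thesis by (rule that[OF _ meas le])
qed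

text \<open>Here \<open>q u w\<close> is the Gibbs weight of the cylinder u times the probability
  that a noisy channel, fed with the approximate labels along u, puts out w. The window has n + m
  letters because the approximate label at time i < n reads the coordinates from i to i + m - 1.
  That m and C do not depend on n is what makes them vanish in the limit.\<close>

lemma word_entropy_upper:
  fixes f :: "cantor \<Rightarrow>\<^sub>C real"
  assumes \<xi>: "\<xi> \<in> measurable \<mu> (count_space K)" and K: "finite K" and e: "e > 0"
  obtains m C where "\<forall>n. word_entropy \<mu> \<xi> K n + real (n + m) * (\<integral>x. f x \<partial>\<mu>)
    \<le> ln (partition_function f (n + m) (\<lambda>_. False)) + C + real (n + m) * e + real n * (2 * e)"
proof -
  have \<xi>K: "\<xi> x \<in> K" for x using measurable_space[OF \<xi>, of x] by (simp add: space_eq)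
  have K0: "card K > 0" using \<xi>K K card_gt_0_iff by blast
  \<comment> \<open>Chosen so that a correctly transmitted letter costs exactly e in the
    logarithm.\<close>
  define \<delta> where "\<delta> = 1 - exp (- e)"
  have \<delta>: "0 < \<delta>" "\<delta> < 1" using e by (auto simp: \<delta>_def)
  have ln\<delta>: "ln (1 - \<delta>) = - e" by (simp add: \<delta>_def)
  \<comment> \<open>The cost of a wrong letter. Approximating the labels within e / (L + 1) keeps
    the expected cost of errors at most e per letter, and the added 1 covers L = 0.\<close>
  define L where "L = - ln (\<delta> / real (card K))"
  have "\<delta> / real (card K) \<le> 1" using \<delta> K0 by (simp add: divide_le_eq)
  then have L: "L \<ge> 0" using \<delta> K0 unfolding L_def by (simp add: ln_le_zero_iff)
  have "e / (L + 1) > 0" using e L by simp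
  then obtain m \<eta> where \<eta>: "\<forall>x y. (\<forall>i<m. x i = y i) \<longrightarrow> \<eta> x = \<eta> y"
    and D: "{x. \<xi> x \<noteq> \<eta> x} \<in> sets \<mu>" "prob {x. \<xi> x \<noteq> \<eta> x} \<le> e / (L + 1)"
    by (rule approximate_labels[OF \<xi> K])
  have DL: "prob {x. \<xi> x \<noteq> \<eta> x} * L \<le> e"
  proof -
    have "prob {x. \<xi> x \<noteq> \<eta> x} * L \<le> (e / (L + 1)) * (L + 1)"
      using D(2) L e by (intro mult_mono) auto
    then show ?thesis using L by simp
  qed
  obtain C where C: "\<And>n x y. (\<And>i. i < n \<Longrightarrow> x i = y i) \<Longrightarrow>
    \<bar>birkhoff_sum f n x - birkhoff_sum f n y\<bar> \<le> C + real n * e"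
    using birkhoff_sum_variation[OF e] by blast
  \<comment> \<open>The channel keeps its input with weight 1 - \<delta> and gives every other
    letter the same small weight. These weights are positive, as Gibbs' inequality requires at
    mislabelled points.\<close>
  define r where "r a b = (if a = b then 1 - \<delta> else \<delta> / real (card K))" for a b :: 'a
  have r: "0 < r a b" for a b using \<delta> K0 by (simp add: r_def)
  have r_nz: "r a b \<noteq> 0" for a b using r[of a b] by simp
  have r_sum: "(\<Sum>a\<in>K. r a b) \<le> 1" for b
  proof (cases "b \<in> K")
    case True
    have "(\<Sum>a\<in>K. r a b) = r b b + (\<Sum>a\<in>K - {b}. r a b)" by (rule sum.remove[OF K True])
    also have "(\<Sum>a\<in>K - {b}. r a b) = real (card (K - {b})) * (\<delta> / real (card K))"
      by (simp add: r_def)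
    also have "\<dots> \<le> real (card K) * (\<delta> / real (card K))"
      using \<delta> K by (intro mult_right_mono) (auto simp: card_Diff_singleton_if)
    finally show ?thesis using K0 by (simp add: r_def)
  next
    case False
    then have "(\<Sum>a\<in>K. r a b) = (\<Sum>a\<in>K. \<delta> / real (card K))"
      by (intro sum.cong refl) (auto simp: r_def)
    then show ?thesis using K0 \<delta> by simp
  qed
  \<comment> \<open>The representative of the cylinder u. Its tail matches the point at which the
    partition function is evaluated, so that the Gibbs weights sum to 1.\<close>
  define pt where "pt u = prepend_word u (\<lambda>_. False)" for u
  have main: "word_entropy \<mu> \<xi> K n + real (n + m) * (\<integral>x. f x \<partial>\<mu>)
    \<le> ln (partition_function f (n + m) (\<lambda>_. False)) + C + real (n + m) * e + real n * (2 * e)" for n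
  proof -
    define N where "N = n + m"
    define Z where "Z = partition_function f N (\<lambda>_. False)"
    have Z: "Z > 0" unfolding Z_def by (rule partition_function_pos)
    define U where "U = itinerary (\<lambda>x :: cantor. x 0) N"
    define W where "W = itinerary \<xi> n"
    have x0: "(\<lambda>x :: cantor. x 0) \<in> measurable \<mu> (count_space UNIV)"
      using measurable_coordinate[of 0] sets_eq by (auto simp: measurable_count_space_eq2 space_eq vimage_def)
    have mU: "U \<in> measurable \<mu> (count_space (words UNIV N))"
      unfolding U_def by (rule measurable_itinerary[OF x0]) simp
    have mW: "W \<in> measurable \<mu> (count_space (words K n))"
      unfolding W_def by (rule measurable_itinerary[OF \<xi> K])
    have ptU: "pt (U x) i = x i" if "i < N" for x i
      using that by (simp add: pt_def U_def coordinate_itinerary prepend_word_nth)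
    define q where "q u w = exp (birkhoff_sum f N (pt u)) / Z * (\<Prod>i<n. r (w ! i) (\<eta> ((left_shift ^^ i) (pt u))))" for u w
    have q: "0 < q u w" for u w
      unfolding q_def using Z r by (intro mult_pos_pos divide_pos_pos prod_pos) auto
    have q_sum: "(\<Sum>u\<in>words UNIV N. \<Sum>w\<in>words K n. q u w) \<le> 1"
    proof -
      have "(\<Sum>u\<in>words UNIV N. \<Sum>w\<in>words K n. q u w)
          \<le> (\<Sum>u\<in>words UNIV N. exp (birkhoff_sum f N (pt u)) / Z * 1)"
        unfolding q_def sum_distrib_left[symmetric] using Z
        by (intro sum_mono mult_left_mono sum_words_prod_le_1 r_sum) (auto intro: less_imp_le[OF r])
      also have "\<dots> = 1"
        using Z unfolding Z_def partition_function_def pt_def by (simp add: sum_divide_distrib[symmetric])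
      finally show ?thesis .
    qed
    have "word_entropy \<mu> \<xi> K n \<le> - (\<integral>x. ln (q (U x) (W x)) \<partial>\<mu>)"
      using gibbs_inequality[OF finite_bool_words finite_words[OF K] mU mW less_imp_le[OF q] q q_sum]
      by (simp add: word_entropy_def W_def space_eq)
    moreover
    let ?D = "\<lambda>x. indicator {x. \<xi> x \<noteq> \<eta> x} x :: real"
    \<comment> \<open>An integrable lower bound for the logarithm of q with explicit integral: it
      pays C + N e for moving x to the representative of its cylinder, e for each letter, and L more
      for each mislabelled one.\<close>
    define g where "g x = birkhoff_sum f N x - (C + real N * e) - ln Z - real n * e - (\<Sum>i<n. ?D ((left_shift ^^ i) x)) * L" for x
    have ln_q: "ln (q (U x) (W x)) = birkhoff_sum f N (pt (U x)) - ln Z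
        + (\<Sum>i<n. ln (r (\<xi> ((left_shift ^^ i) x)) (\<eta> ((left_shift ^^ i) x))))" for x
    proof -
      have "\<eta> ((left_shift ^^ i) (pt (U x))) = \<eta> ((left_shift ^^ i) x)" if "i < n" for i
        using that by (intro \<eta>[rule_format]) (simp add: left_shift_funpow ptU N_def)
      moreover have "W x ! i = \<xi> ((left_shift ^^ i) x)" if "i < n" for i
        using that by (simp add: W_def itinerary_def)
      ultimately have q_eq: "q (U x) (W x) = exp (birkhoff_sum f N (pt (U x))) / Z *
          (\<Prod>i<n. r (\<xi> ((left_shift ^^ i) x)) (\<eta> ((left_shift ^^ i) x)))"
        unfolding q_def by (intro arg_cong2[where f = "(*)"] refl prod.cong) auto
      have "ln (q (U x) (W x)) = ln (exp (birkhoff_sum f N (pt (U x))) / Z) +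
          ln (\<Prod>i<n. r (\<xi> ((left_shift ^^ i) x)) (\<eta> ((left_shift ^^ i) x)))"
        unfolding q_eq by (rule ln_mult_pos) (use Z r in \<open>auto intro: prod_pos\<close>)
      also have "ln (\<Prod>i<n. r (\<xi> ((left_shift ^^ i) x)) (\<eta> ((left_shift ^^ i) x)))
          = (\<Sum>i<n. ln (r (\<xi> ((left_shift ^^ i) x)) (\<eta> ((left_shift ^^ i) x))))"
        by (rule ln_prod) (simp_all add: r_nz)
      finally show ?thesis using Z by (simp add: ln_div)
    qed
    have g_le: "g x \<le> ln (q (U x) (W x))" for x
    proof -
      have "- e - ?D y * L \<le> ln (r (\<xi> y) (\<eta> y))" for y
        using ln\<delta> e L by (auto simp: r_def L_def indicator_def)
      then have "(\<Sum>i<n. - e - ?D ((left_shift ^^ i) x) * L)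
          \<le> (\<Sum>i<n. ln (r (\<xi> ((left_shift ^^ i) x)) (\<eta> ((left_shift ^^ i) x))))"
        by (intro sum_mono)
      moreover have "birkhoff_sum f N x - birkhoff_sum f N (pt (U x)) \<le> C + real N * e"
        using C[of N x "pt (U x)"] ptU by simp
      ultimately show ?thesis
        unfolding ln_q g_def by (simp add: sum_subtractf sum_distrib_right)
    qed
    have D_meas: "?D \<in> borel_measurable \<mu>" using D(1) by simp
    have D_int: "integrable \<mu> (\<lambda>x. ?D ((left_shift ^^ i) x))" for i
      by (rule integrable_const_bound[where B = 1])
        (auto intro: measurable_compose[OF measurable_shift D_meas])
    have D_val: "(\<integral>x. ?D ((left_shift ^^ i) x) \<partial>\<mu>) = prob {x. \<xi> x \<noteq> \<eta> x}" for i
      using integral_shift[OF D_meas, of i] D(1) by (simp add: space_eq)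
    have g_int: "integrable \<mu> g"
      unfolding g_def
      by (intro Bochner_Integration.integrable_diff integrable_birkhoff_sum integrable_mult_left
          Bochner_Integration.integrable_sum D_int) auto
    have g_val: "(\<integral>x. g x \<partial>\<mu>) = real N * (\<integral>x. f x \<partial>\<mu>) - (C + real N * e) - ln Z - real n * e
        - real n * prob {x. \<xi> x \<noteq> \<eta> x} * L"
      unfolding g_def using integrable_birkhoff_sum[of f N] D_int
      by (simp add: integral_birkhoff_sum D_val prob_space)
    have "integrable \<mu> (\<lambda>x. ln (q (U x) (W x)))"
      unfolding ln_q
    proof (intro Bochner_Integration.integrable_add Bochner_Integration.integrable_diff Bochner_Integration.integrable_sum)
      show "integrable \<mu> (\<lambda>x. birkhoff_sum f N (pt (U x)))"
        by (rule integrable_finite_range[OF mU finite_bool_words])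
      fix i assume "i \<in> {..<n}"
      have "ln (r (\<xi> y) (\<eta> y)) = - e + ?D y * (- L + e)" for y
        using ln\<delta> by (simp add: r_def L_def indicator_def)
      then show "integrable \<mu> (\<lambda>x. ln (r (\<xi> ((left_shift ^^ i) x)) (\<eta> ((left_shift ^^ i) x))))"
        using D_int[of i] by simp
    qed simp
    then have "(\<integral>x. g x \<partial>\<mu>) \<le> (\<integral>x. ln (q (U x) (W x)) \<partial>\<mu>)"
      by (intro integral_mono g_int g_le)
    moreover have "real n * prob {x. \<xi> x \<noteq> \<eta> x} * L \<le> real n * e"
      using mult_left_mono[OF DL, of "real n"] by (simp add: mult.assoc)
    ultimately show ?thesis
      unfolding g_val Z_def N_def by linarith
  qed
  show ?thesis by (rule that[of m C], rule allI, rule main)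
qed

lemma variational_inequality:
  fixes f :: "cantor \<Rightarrow>\<^sub>C real"
  assumes \<xi>: "\<xi> \<in> measurable \<mu> (count_space K)" and K: "finite K"
    and h: "(\<lambda>n. word_entropy \<mu> \<xi> K n / real n) \<longlonglongrightarrow> h"
  shows "h + (\<integral>x. f x \<partial>\<mu>) \<le> pressure f"
proof (rule field_le_epsilon)
  fix d :: real assume "d > 0"
  \<comment> \<open>After division by n the surviving errors are e from the Birkhoff sums and 2 e
    from the channel.\<close>
  define e where "e = d / 3"
  have e: "e > 0" using \<open>d > 0\<close> by (simp add: e_def)
  let ?I = "\<integral>x. f x \<partial>\<mu>"
  obtain m C where mC: "\<forall>n. word_entropy \<mu> \<xi> K n + real (n + m) * ?I
    \<le> ln (partition_function f (n + m) (\<lambda>_. False)) + C + real (n + m) * e + real n * (2 * e)"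
    by (rule word_entropy_upper[OF \<xi> K e])
  let ?l = "\<lambda>n. ln (partition_function f n (\<lambda>_. False))"
  let ?t = "\<lambda>n. 1 + real m / real n"
  have t: "?t \<longlonglongrightarrow> 1"
    using tendsto_add[OF tendsto_const lim_const_over_n[of "real m"], of 1] by simp
  have l: "(\<lambda>n. ?l (n + m) / real (n + m)) \<longlonglongrightarrow> pressure f"
    using LIMSEQ_ignore_initial_segment[OF partition_function_tendsto[of f "\<lambda>_ _. False"]] .
  have lhs: "(\<lambda>n. word_entropy \<mu> \<xi> K n / real n + ?t n * ?I) \<longlonglongrightarrow> h + 1 * ?I"
    by (intro tendsto_intros h t)
  have rhs: "(\<lambda>n. ?l (n + m) / real (n + m) * ?t n + C / real n + ?t n * e + 2 * e)
      \<longlonglongrightarrow> pressure f * 1 + 0 + 1 * e + 2 * e"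
    by (intro tendsto_add tendsto_mult l t lim_const_over_n tendsto_const)
  have "\<exists>N. \<forall>n\<ge>N. word_entropy \<mu> \<xi> K n / real n + ?t n * ?I
      \<le> ?l (n + m) / real (n + m) * ?t n + C / real n + ?t n * e + 2 * e"
  proof (intro exI allI impI)
    fix n :: nat assume n: "n \<ge> 1"
    have t_eq: "?t n = real (n + m) / real n" using n by (simp add: field_simps)
    have "(word_entropy \<mu> \<xi> K n + real (n + m) * ?I) / real n
        \<le> (?l (n + m) + C + real (n + m) * e + real n * (2 * e)) / real n"
      by (intro divide_right_mono mC[rule_format]) simp
    moreover have "?l (n + m) / real (n + m) * ?t n = ?l (n + m) / real n"
      unfolding t_eq using n by simp
    moreover have "?t n * c = real (n + m) * c / real n" for c unfolding t_eq by simp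
    moreover have "2 * e = real n * (2 * e) / real n" using n by simp
    ultimately show "word_entropy \<mu> \<xi> K n / real n + ?t n * ?I
      \<le> ?l (n + m) / real (n + m) * ?t n + C / real n + ?t n * e + 2 * e"
      by (simp only: add_divide_distrib)
  qed
  from LIMSEQ_le[OF lhs rhs this] show "h + ?I \<le> pressure f + d"
    by (simp add: e_def)
qed

text \<open>Each point is labelled by the atom that contains it. Subadditivity makes the defining
  \<open>lim\<close> a true limit rather than an unspecified value.\<close>

lemma entropy_wrt_partition_eq_word_entropy_limit:
  assumes P: "finite P" "P \<subseteq> sets \<mu>" "partition_on (space \<mu>) P"
  obtains \<xi> where "\<xi> \<in> measurable \<mu> (count_space P)"
    "(\<lambda>n. word_entropy \<mu> \<xi> P n / real n) \<longlonglongrightarrow> entropy_wrt_partition \<mu> left_shift P"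
proof -
  define \<xi> where "\<xi> x = (THE A. A \<in> P \<and> x \<in> A)" for x
  have part: "\<Union>P = UNIV" "disjoint P" "{} \<notin> P" using P(3) unfolding partition_on_def space_eq by auto
  have eq: "\<xi> x = A" if "A \<in> P" "x \<in> A" for x A
    unfolding \<xi>_def by (rule the_equality) (use that part(2) in \<open>auto dest: disjointD\<close>)
  have \<xi>P: "\<xi> x \<in> P" for x
  proof -
    obtain A where "A \<in> P" "x \<in> A" using part(1) by blast
    then show ?thesis using eq by simp
  qed
  have x\<xi>: "x \<in> \<xi> x" for x
  proof -
    obtain A where "A \<in> P" "x \<in> A" using part(1) by blast
    then show ?thesis using eq by simp
  qed
  have vim: "\<xi> -` {A} = A" if "A \<in> P" for A using eq[OF that] x\<xi> by auto
  have meas: "\<xi> \<in> measurable \<mu> (count_space P)"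
    using P \<xi>P vim by (subst measurable_count_space_eq2) (auto simp: space_eq)
  have "P = (\<lambda>A. \<xi> -` {A}) ` P" using vim by force
  then have pe: "partition_entropy \<mu> (iterated_join \<mu> left_shift P n) = word_entropy \<mu> \<xi> P n" for n
    by (rule partition_entropy_iterated_join[OF space_eq P(1) \<xi>P])
  obtain h where h: "(\<lambda>n. word_entropy \<mu> \<xi> P n / real n) \<longlonglongrightarrow> h"
    using word_entropy_limit[OF meas P(1)] by blast
  then have "entropy_wrt_partition \<mu> left_shift P = h"
    unfolding entropy_wrt_partition_def pe by (rule limI)
  then show ?thesis using that meas h by simp
qed

lemma ks_entropy_add_integral_le:
  "ks_entropy \<mu> left_shift + ereal (\<integral>x. f x \<partial>\<mu>) \<le> ereal (pressure f)" for f :: "cantor \<Rightarrow>\<^sub>C real"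
proof -
  have "ks_entropy \<mu> left_shift \<le> ereal (pressure f - (\<integral>x. f x \<partial>\<mu>))"
    unfolding ks_entropy_def
  proof (rule SUP_least)
    fix P assume P: "P \<in> {P. finite P \<and> P \<subseteq> sets \<mu> \<and> partition_on (space \<mu>) P}"
    then obtain \<xi> where \<xi>: "\<xi> \<in> measurable \<mu> (count_space P)"
      "(\<lambda>n. word_entropy \<mu> \<xi> P n / real n) \<longlonglongrightarrow> entropy_wrt_partition \<mu> left_shift P"
      using entropy_wrt_partition_eq_word_entropy_limit by blast
    have "entropy_wrt_partition \<mu> left_shift P + (\<integral>x. f x \<partial>\<mu>) \<le> pressure f"
      using variational_inequality[OF \<xi>(1) _ \<xi>(2)] P by blast
    then show "ereal (entropy_wrt_partition \<mu> left_shift P) \<le> ereal (pressure f - (\<integral>x. f x \<partial>\<mu>))"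
      by simp
  qed
  then have "ks_entropy \<mu> left_shift + ereal (\<integral>x. f x \<partial>\<mu>)
      \<le> ereal (pressure f - (\<integral>x. f x \<partial>\<mu>)) + ereal (\<integral>x. f x \<partial>\<mu>)"
    by (rule add_right_mono)
  then show ?thesis by simp
qed

text \<open>The partition by the first coordinate is one competitor in the supremum. Its itineraries
  are the initial words of the sequence, whose entropies can be estimated for block
  measures.\<close>

lemma ks_entropy_ge_coordinate:
  assumes "(\<lambda>n. word_entropy \<mu> (\<lambda>x. x 0) UNIV n / real n) \<longlonglongrightarrow> h"
  shows "ereal h \<le> ks_entropy \<mu> left_shift"
proof -
  define P :: "cantor set set" where "P = (\<lambda>b. (\<lambda>x. x 0) -` {b}) ` UNIV"
  have ne: "(\<lambda>_. b) \<in> (\<lambda>x :: cantor. x 0) -` {b}" for b by simp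
  have "\<Union>P = UNIV" "disjoint P" unfolding P_def disjoint_def by auto
  moreover have "{} \<notin> P" unfolding P_def using ne by (metis (no_types, lifting) empty_iff imageE)
  ultimately have "partition_on (space \<mu>) P"
    unfolding partition_on_def space_eq by simp
  moreover have "P \<subseteq> sets \<mu>"
    unfolding P_def sets_eq using measurable_coordinate[of 0] by (auto simp: vimage_def)
  moreover have "entropy_wrt_partition \<mu> left_shift P = h"
    unfolding entropy_wrt_partition_def
    using assms by (subst partition_entropy_iterated_join[OF space_eq _ _ P_def]) (auto intro: limI)
  ultimately show ?thesis
    unfolding ks_entropy_def by (intro SUP_upper2[of P]) (auto simp: P_def)
qed

end

section \<open>Lower bound in the variational principle\<close>

lemma measurable_into_cantor:
  fixes g :: "'a \<Rightarrow> cantor"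
  assumes "\<And>i. (\<lambda>x. g x i) \<in> measurable M (count_space UNIV)"
  shows "g \<in> measurable M borel"
  unfolding borel_cantor_eq_sigma_cylinders
proof (rule measurable_measure_of)
  fix X assume "X \<in> range (\<lambda>w. {y :: cantor. \<forall>i<length w. w ! i = y i})"
  then obtain w where X: "X = {y. \<forall>i<length w. w ! i = y i}" by blast
  have "{x \<in> space M. \<forall>i\<in>{..<length w}. w ! i = g x i} \<in> sets M"
  proof (intro sets.sets_Collect_finite_All)
    fix i
    have "(\<lambda>x. g x i) -` {w ! i} \<inter> space M \<in> sets M" by (rule measurable_sets[OF assms]) simp
    also have "(\<lambda>x. g x i) -` {w ! i} \<inter> space M = {x \<in> space M. w ! i = g x i}" by auto
    finally show "{x \<in> space M. w ! i = g x i} \<in> sets M" .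
  qed simp
  also have "{x \<in> space M. \<forall>i\<in>{..<length w}. w ! i = g x i} = g -` X \<inter> space M" unfolding X by auto
  finally show "g -` X \<inter> space M \<in> sets M" .
qed auto

lemma prob_space_point_measure:
  assumes "finite S" "\<And>s. s \<in> S \<Longrightarrow> 0 \<le> p s" "(\<Sum>s\<in>S. p s) = 1"
  shows "prob_space (point_measure S (\<lambda>s. ennreal (p s)))"
  by (rule prob_spaceI) (use assms in \<open>simp add: space_point_measure emeasure_point_measure_finite sum_ennreal\<close>)

text \<open>The invariant measure is obtained from a sequence of independent blocks of length \<open>N\<close>, each with
  distribution \<open>p\<close>, by concatenating the blocks and shifting by an independent uniform offset.\<close>

locale independent_blocks =
  fixes N :: nat and p :: "bool list \<Rightarrow> real"
  assumes N: "N > 0"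
    and p_pos: "w \<in> words UNIV N \<Longrightarrow> 0 < p w"
    and p_sum: "(\<Sum>w\<in>words UNIV N. p w) = 1"
begin

abbreviation "S \<equiv> words (UNIV :: bool set) N"

definition "block_law = point_measure S (\<lambda>w. ennreal (p w))"

definition "blocks = PiM UNIV (\<lambda>_ :: nat. block_law)"

definition "offset = point_measure {..<N} (\<lambda>_. ennreal (1 / real N))"

definition "concat_blocks b = (\<lambda>k. (b (k div N) :: bool list) ! (k mod N))"

definition "shifted = (\<lambda>(i, b). (left_shift ^^ i) (concat_blocks b))"

definition "\<mu> = distr (offset \<Otimes>\<^sub>M blocks) borel shifted"

sublocale block: prob_space block_law
  unfolding block_law_def
  by (rule prob_space_point_measure) (auto simp: finite_bool_words p_sum intro: less_imp_le[OF p_pos])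

sublocale bl: product_prob_space "\<lambda>_ :: nat. block_law" UNIV
  by unfold_locales

sublocale blocks: prob_space blocks
  unfolding blocks_def by (rule bl.prob_space_axioms)

sublocale offset: prob_space offset
  unfolding offset_def by (rule prob_space_point_measure) (use N in auto)

sublocale joint: pair_prob_space offset blocks ..

section \<open>Measurability and integration over offset and blocks\<close>

lemma space_block: "space block_law = S" and sets_block: "sets block_law = Pow S"
  by (simp_all add: block_law_def space_point_measure sets_point_measure)

lemma space_blocks: "space blocks = (UNIV \<rightarrow>\<^sub>E S)"
  by (simp add: blocks_def space_PiM space_block)

lemma space_offset: "space offset = {..<N}"
  by (simp add: offset_def space_point_measure)

lemma measurable_component: "(\<lambda>b. b j) \<in> measurable blocks (count_space S)"
proof -
  have "(\<lambda>b. b j) \<in> measurable blocks block_law"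
    unfolding blocks_def by (rule measurable_component_singleton) simp
  also have "measurable blocks block_law = measurable blocks (count_space S)"
    by (rule measurable_cong_sets) (simp_all add: sets_block)
  finally show ?thesis .
qed

lemma measurable_shifted_fixed: "(\<lambda>b. (left_shift ^^ i) (concat_blocks b)) \<in> measurable blocks borel"
proof (rule measurable_into_cantor)
  fix k
  have "(\<lambda>b. b ((i + k) div N) ! ((i + k) mod N)) \<in> measurable blocks (count_space UNIV)"
    by (rule measurable_compose[OF measurable_component]) simp
  then show "(\<lambda>b. (left_shift ^^ i) (concat_blocks b) k) \<in> measurable blocks (count_space UNIV)"
    by (simp add: left_shift_funpow concat_blocks_def)
qed

lemma sets_joint: "sets (offset \<Otimes>\<^sub>M blocks) = sets (count_space {..<N} \<Otimes>\<^sub>M blocks)"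
  by (rule sets_pair_measure_cong) (simp_all add: offset_def sets_point_measure)

lemma measurable_shifted: "shifted \<in> measurable (offset \<Otimes>\<^sub>M blocks) borel"
proof -
  have "shifted \<in> measurable (count_space {..<N} \<Otimes>\<^sub>M blocks) borel"
    by (rule measurable_pair_measure_countable1) (simp_all add: shifted_def measurable_shifted_fixed)
  then show ?thesis by (subst measurable_cong_sets[OF sets_joint refl])
qed

lemma integral_joint:
  fixes g :: "nat \<times> (nat \<Rightarrow> bool list) \<Rightarrow> real"
  assumes "integrable (offset \<Otimes>\<^sub>M blocks) g"
  shows "(\<integral>z. g z \<partial>(offset \<Otimes>\<^sub>M blocks)) = (\<Sum>i<N. \<integral>b. g (i, b) \<partial>blocks) / real N"
proof -
  have "(\<integral>z. g z \<partial>(offset \<Otimes>\<^sub>M blocks)) = (\<integral>i. (\<integral>b. g (i, b) \<partial>blocks) \<partial>offset)"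
    by (rule joint.integral_fst'[OF assms, symmetric])
  also have "\<dots> = (\<Sum>i<N. (1 / real N) *\<^sub>R (\<integral>b. g (i, b) \<partial>blocks))"
    unfolding offset_def by (rule lebesgue_integral_point_measure_finite) auto
  finally show ?thesis by (simp add: sum_divide_distrib)
qed

lemma prob_space_\<mu>: "prob_space \<mu>"
  unfolding \<mu>_def by (rule joint.prob_space_distr[OF measurable_shifted])

lemma sets_\<mu>: "sets \<mu> = sets borel"
  by (simp add: \<mu>_def)

lemma space_\<mu>: "space \<mu> = UNIV"
  by (simp add: \<mu>_def)

lemma integral_\<mu>:
  fixes g :: "cantor \<Rightarrow> real"
  assumes "integrable \<mu> g"
  shows "(\<integral>x. g x \<partial>\<mu>) = (\<Sum>i<N. \<integral>b. g ((left_shift ^^ i) (concat_blocks b)) \<partial>blocks) / real N"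
proof -
  have g: "g \<in> borel_measurable borel" using borel_measurable_integrable[OF assms] by (simp add: \<mu>_def)
  have "integrable (offset \<Otimes>\<^sub>M blocks) (\<lambda>z. g (shifted z))"
    using assms unfolding \<mu>_def by (subst (asm) integrable_distr_eq[OF measurable_shifted g])
  from integral_joint[OF this] show ?thesis
    unfolding \<mu>_def by (subst integral_distr[OF measurable_shifted g]) (simp add: shifted_def)
qed

lemma measure_\<mu>:
  assumes A: "A \<in> sets borel"
  shows "measure \<mu> A = (\<Sum>i<N. measure blocks {b \<in> space blocks. (left_shift ^^ i) (concat_blocks b) \<in> A}) / real N"
proof -
  interpret prob_space \<mu> by (rule prob_space_\<mu>)
  have A': "A \<in> sets \<mu>" using A by (simp add: sets_\<mu>)
  have slice: "(\<integral>b. indicator A ((left_shift ^^ i) (concat_blocks b)) \<partial>blocks)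
      = measure blocks {b \<in> space blocks. (left_shift ^^ i) (concat_blocks b) \<in> A}" for i
  proof -
    have "(\<integral>b. indicator A ((left_shift ^^ i) (concat_blocks b)) \<partial>blocks)
        = (\<integral>b. indicator {b \<in> space blocks. (left_shift ^^ i) (concat_blocks b) \<in> A} b \<partial>blocks :: real)"
      by (rule Bochner_Integration.integral_cong) (auto simp: indicator_def)
    also have "\<dots> = measure blocks ({b \<in> space blocks. (left_shift ^^ i) (concat_blocks b) \<in> A} \<inter> space blocks)"
      by simp
    also have "\<dots> = measure blocks {b \<in> space blocks. (left_shift ^^ i) (concat_blocks b) \<in> A}"
      by (rule arg_cong[where f = "measure blocks"]) auto
    finally show ?thesis .
  qed
  have "measure \<mu> A = (\<integral>x. indicator A x \<partial>\<mu>)" using sets.sets_into_space[OF A'] by (simp add: Int_absorb2)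
  also have "\<dots> = (\<Sum>i<N. \<integral>b. indicator A ((left_shift ^^ i) (concat_blocks b)) \<partial>blocks) / real N"
    using A' by (intro integral_\<mu>) (simp add: less_top[symmetric])
  finally show ?thesis unfolding slice .
qed

lemma distr_drop_block: "distr blocks blocks (\<lambda>b j. b (Suc j)) = blocks"
  using distr_PiM_reindex[of UNIV "\<lambda>_ :: nat. block_law" Suc UNIV] block.prob_space_axioms
  by (simp add: blocks_def restrict_UNIV)

lemma shift_concat_blocks: "(left_shift ^^ N) (concat_blocks b) = concat_blocks (\<lambda>j. b (Suc j))"
  using N by (simp add: left_shift_funpow concat_blocks_def fun_eq_iff)

lemma measure_shift_blocks:
  assumes A: "A \<in> sets borel"
  shows "measure blocks {b \<in> space blocks. (left_shift ^^ N) (concat_blocks b) \<in> A}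
    = measure blocks {b \<in> space blocks. concat_blocks b \<in> A}"
proof -
  let ?s = "\<lambda>b j. b (Suc j) :: bool list"
  have ms: "?s \<in> measurable blocks blocks"
    unfolding blocks_def
    by (rule measurable_PiM_single') (auto intro!: measurable_component_singleton simp: space_PiM)
  have mA: "{b \<in> space blocks. concat_blocks b \<in> A} \<in> sets blocks"
    using measurable_sets[OF measurable_shifted_fixed[of 0] A] by (simp add: vimage_def Int_def conj_commute)
  have "measure blocks {b \<in> space blocks. concat_blocks b \<in> A}
      = measure (distr blocks blocks ?s) {b \<in> space blocks. concat_blocks b \<in> A}"
    by (simp add: distr_drop_block)
  also have "\<dots> = measure blocks (?s -` {b \<in> space blocks. concat_blocks b \<in> A} \<inter> space blocks)"
    by (rule measure_distr[OF ms mA])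
  also have "?s -` {b \<in> space blocks. concat_blocks b \<in> A} \<inter> space blocks
      = {b \<in> space blocks. (left_shift ^^ N) (concat_blocks b) \<in> A}"
    using measurable_space[OF ms] by (auto simp: shift_concat_blocks)
  finally show ?thesis by simp
qed

text \<open>One more shift turns the offsets 0, ..., N - 1 into 1, ..., N. Offset N just drops the
  first block, which does not change the law of an independent, identically distributed sequence, so
  it may be replaced by offset 0.\<close>

lemma invariant_\<mu>: "distr \<mu> borel left_shift = \<mu>"
proof (rule measure_eqI)
  fix A assume "A \<in> sets (distr \<mu> borel left_shift)"
  then have A: "A \<in> sets borel" by simp
  have ls: "left_shift \<in> measurable borel borel"
    by (rule borel_measurable_continuous_onI[OF continuous_on_left_shift])
  then have ls': "left_shift \<in> measurable \<mu> borel" by (simp add: \<mu>_def)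
  interpret prob_space \<mu> by (rule prob_space_\<mu>)
  interpret d: prob_space "distr \<mu> borel left_shift" by (rule prob_space_distr[OF ls'])
  let ?m = "\<lambda>i. measure blocks {b \<in> space blocks. (left_shift ^^ i) (concat_blocks b) \<in> A}"
  have "measure (distr \<mu> borel left_shift) A = measure \<mu> (left_shift -` A)"
    using measure_distr[OF ls' A] by (simp add: space_\<mu>)
  also have "\<dots> = (\<Sum>i<N. ?m (Suc i)) / real N"
    using measurable_sets[OF ls A] by (subst measure_\<mu>) (simp_all)
  also have "(\<Sum>i<N. ?m (Suc i)) = (\<Sum>i<Suc N. ?m i) - ?m 0"
    by (simp only: sum.lessThan_Suc_shift)
  also have "\<dots> = (\<Sum>i<N. ?m i)"
    using measure_shift_blocks[OF A] by simp
  also have "\<dots> / real N = measure \<mu> A" by (simp add: measure_\<mu>[OF A])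
  finally show "emeasure (distr \<mu> borel left_shift) A = emeasure \<mu> A"
    by (simp add: emeasure_eq_measure d.emeasure_eq_measure)
qed (simp add: sets_\<mu>)

sublocale \<mu>: shift_invariant_measure \<mu>
  by (intro shift_invariant_measure.intro shift_invariant_measure_axioms.intro prob_space_\<mu> sets_\<mu> invariant_\<mu>)

lemma \<mu>_in: "\<mu> \<in> shift_invariant_measures"
  unfolding shift_invariant_measures_def using prob_space_\<mu> sets_\<mu> invariant_\<mu> by simp

lemma integral_component:
  fixes g :: "bool list \<Rightarrow> real"
  shows "(\<integral>b. g (b j) \<partial>blocks) = (\<Sum>w\<in>S. p w * g w)"
proof -
  have m: "(\<lambda>b. b j) \<in> measurable blocks block_law"
    unfolding blocks_def by (rule measurable_component_singleton) simp
  have "(\<integral>b. g (b j) \<partial>blocks) = (\<integral>w. g w \<partial>(distr blocks block_law (\<lambda>b. b j)))"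
    by (rule integral_distr[OF m, symmetric]) (simp add: block_law_def)
  also have "distr blocks block_law (\<lambda>b. b j) = block_law"
    unfolding blocks_def by (rule bl.PiM_component) simp
  also have "(\<integral>w. g w \<partial>block_law) = (\<Sum>w\<in>S. p w *\<^sub>R g w)"
    unfolding block_law_def
    by (rule lebesgue_integral_point_measure_finite) (auto simp: finite_bool_words intro: less_imp_le[OF p_pos])
  finally show ?thesis by simp
qed

text \<open>The blocks are numbered from 1 because a shifted window in general sees block 0 only in
  part.\<close>

lemma prob_blocks_cylinder:
  assumes "w \<in> words S k"
  shows "measure blocks {b \<in> space blocks. map b [1..<Suc k] = w} = (\<Prod>j<k. p (w ! j))"
proof -
  let ?J = "Suc ` {..<k}"
  let ?X = "\<lambda>j. {w ! (j - 1)}"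
  have wS: "w ! j \<in> S" if "j < k" for j using assms that nth_mem[of j w] unfolding words_def by blast
  have "{b \<in> space blocks. map b [1..<Suc k] = w} = prod_emb UNIV (\<lambda>_. block_law) ?J (Pi\<^sub>E ?J ?X)"
  proof -
    have "map b [1..<Suc k] = w \<longleftrightarrow> (\<forall>j<k. b (Suc j) = w ! j)" for b
      using assms by (auto simp: list_eq_iff_nth_eq words_def simp del: upt_Suc)
    then show ?thesis
      by (auto simp: prod_emb_def space_blocks space_block PiE_iff restrict_def extensional_def)
  qed
  then have "measure blocks {b \<in> space blocks. map b [1..<Suc k] = w}
      = measure (PiM UNIV (\<lambda>_. block_law)) (prod_emb UNIV (\<lambda>_. block_law) ?J (Pi\<^sub>E ?J ?X))"
    unfolding blocks_def by (rule arg_cong)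
  also have "\<dots> = (\<Prod>j\<in>?J. measure block_law (?X j))"
    by (rule bl.measure_PiM_emb) (use wS in \<open>auto simp: sets_block\<close>)
  also have "\<dots> = (\<Prod>j<k. measure block_law {w ! j})"
    by (subst prod.reindex) (auto simp: inj_on_def)
  also have "\<dots> = (\<Prod>j<k. p (w ! j))"
    using wS by (intro prod.cong refl)
      (simp add: block_law_def measure_point_measure_finite_if finite_bool_words less_imp_le[OF p_pos])
  finally show ?thesis .
qed

text \<open>Additivity of entropy under independence: the last block is split off, and each
  remaining factor sums to 1.\<close>

lemma entropy_prod_words:
  "(\<Sum>w\<in>words S k. (\<Prod>j<k. p (w ! j)) * ln (\<Prod>j<k. p (w ! j)))
    = real k * (\<Sum>w\<in>S. p w * ln (p w))"
proof -
  have snoc: "(\<Prod>j<Suc k. p ((u @ [a]) ! j)) = (\<Prod>j<k. p (u ! j)) * p a" if "u \<in> words S k" for u a k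
    using that by (auto simp: words_def nth_append intro!: prod.cong)
  have one: "(\<Sum>w\<in>words S k. \<Prod>j<k. p (w ! j)) = 1" for k
  proof (induction k)
    case 0
    show ?case by (simp add: words_0)
  next
    case (Suc k)
    have "(\<Sum>w\<in>words S (Suc k). \<Prod>j<Suc k. p (w ! j)) = (\<Sum>u\<in>words S k. \<Sum>a\<in>S. (\<Prod>j<k. p (u ! j)) * p a)"
      unfolding sum_words_Suc by (intro sum.cong refl snoc)
    then show ?case by (simp add: sum_distrib_left[symmetric] p_sum Suc)
  qed
  show "(\<Sum>w\<in>words S k. (\<Prod>j<k. p (w ! j)) * ln (\<Prod>j<k. p (w ! j))) = real k * (\<Sum>w\<in>S. p w * ln (p w))"
  proof (induction k)
    case 0
    show ?case by (simp add: words_0)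
  next
    case (Suc k)
    let ?P = "\<lambda>u. \<Prod>j<k. p (u ! j)"
    have pos: "0 < ?P u" if "u \<in> words S k" for u
      using that by (intro prod_pos) (auto simp: words_def intro!: p_pos[unfolded words_def] dest!: subsetD)
    have "(\<Sum>w\<in>words S (Suc k). (\<Prod>j<Suc k. p (w ! j)) * ln (\<Prod>j<Suc k. p (w ! j)))
        = (\<Sum>u\<in>words S k. \<Sum>a\<in>S. (?P u * ln (?P u)) * p a + ?P u * (p a * ln (p a)))"
      unfolding sum_words_Suc
    proof (intro sum.cong refl)
      fix u a assume "u \<in> words S k" "a \<in> S"
      then show "(\<Prod>j<Suc k. p ((u @ [a]) ! j)) * ln (\<Prod>j<Suc k. p ((u @ [a]) ! j))
          = (?P u * ln (?P u)) * p a + ?P u * (p a * ln (p a))"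
        using pos[of u] p_pos[of a] unfolding snoc[OF \<open>u \<in> words S k\<close>]
        by (simp add: ln_mult_pos algebra_simps)
    qed
    also have "\<dots> = (\<Sum>u\<in>words S k. ?P u * ln (?P u)) * 1 + 1 * (\<Sum>a\<in>S. p a * ln (p a))"
      unfolding sum.distrib sum_distrib_left[symmetric] sum_distrib_right[symmetric] p_sum one by simp
    finally show ?case using Suc by (simp add: algebra_simps)
  qed
qed

text \<open>A window of length \<open>(k + 1) N\<close> together with the offset determines \<open>k\<close> complete blocks.\<close>

lemma entropy_blocks_le:
  "real k * - (\<Sum>w\<in>S. p w * ln (p w)) \<le> ln (real N) + word_entropy \<mu> (\<lambda>x. x 0) UNIV (Suc k * N)"
proof -
  define n where "n = Suc k * N"
  let ?\<Omega> = "offset \<Otimes>\<^sub>M blocks"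
  let ?it = "itinerary (\<lambda>x :: cantor. x 0) n"
  define P where "P u = measure \<mu> {x. ?it x = u}" for u
  \<comment> \<open>Decoding: letter l of block j stands at position j N + l of the concatenation,
    hence at j N + l - i after the offset i.\<close>
  define G where "G = (\<lambda>(i, u :: bool list). map (\<lambda>j. map (\<lambda>l. u ! (j * N + l - i)) [0..<N]) [1..<Suc k])"
  define U where "U z = (fst z, ?it (shifted z))" for z
  define W where "W z = map (snd z) [1..<Suc k]" for z :: "nat \<times> (nat \<Rightarrow> bool list)"
  define A where "A = {..<N} \<times> words (UNIV :: bool set) n"
  \<comment> \<open>Offset and window are weighed as if independent, and the blocks as determined by
    them. The uniform weight of the offset is the source of the term ln N.\<close>
  define q where "q = (\<lambda>(i, u) w. 1 / real N * P u * (if w = G (i, u) then 1 else 0))" for i :: nat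
  have finA: "finite A" by (simp add: A_def finite_bool_words)
  have finK: "finite (words S k)" by (rule finite_words[OF finite_bool_words])
  have x0: "(\<lambda>x :: cantor. x 0) \<in> measurable \<mu> (count_space UNIV)"
    using measurable_coordinate[of 0] sets_\<mu> by (auto simp: measurable_count_space_eq2 space_\<mu> vimage_def)
  have it: "?it \<in> measurable \<mu> (count_space (words UNIV n))"
    by (rule \<mu>.measurable_itinerary[OF x0]) simp
  have it_b: "?it \<in> measurable borel (count_space (words UNIV n))"
    using it by (simp add: \<mu>_def)
  have sP: "{x. ?it x = u} \<in> sets borel" if "u \<in> words UNIV n" for u
    using measurable_sets[OF it_b, of "{u}"] that by (simp add: vimage_def)
  have P_eq: "P u = joint.prob {z \<in> space ?\<Omega>. ?it (shifted z) = u}" if "u \<in> words UNIV n" for u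
    unfolding P_def \<mu>_def
    by (subst measure_distr[OF measurable_shifted sP[OF that]]) (simp add: vimage_def Int_def conj_commute)
  have P_sum: "(\<Sum>u\<in>words UNIV n. P u) = 1"
    using \<mu>.integral_finite_range_eq[OF it finite_bool_words, where c = "\<lambda>_. 1"]
    by (simp add: P_def space_\<mu> \<mu>.prob_space[unfolded space_\<mu>])
  have mU: "U \<in> measurable ?\<Omega> (count_space A)"
  proof (subst measurable_count_space_eq2[OF finA], intro conjI ballI)
    show "U \<in> space ?\<Omega> \<rightarrow> A"
      by (auto simp: U_def A_def space_pair_measure space_offset intro!: itinerary_in_words)
    fix a assume "a \<in> A"
    then obtain i u where a: "a = (i, u)" "i < N" "u \<in> words UNIV n" by (auto simp: A_def)
    have "U -` {a} \<inter> space ?\<Omega> = (fst -` {i} \<inter> space ?\<Omega>) \<inter> (shifted -` {x. ?it x = u} \<inter> space ?\<Omega>)"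
      by (auto simp: U_def a)
    moreover have "fst -` {i} \<inter> space ?\<Omega> \<in> sets ?\<Omega>"
      by (rule measurable_sets[OF measurable_fst]) (use a in \<open>simp add: offset_def sets_point_measure\<close>)
    ultimately show "U -` {a} \<inter> space ?\<Omega> \<in> sets ?\<Omega>"
      using measurable_sets[OF measurable_shifted sP[OF a(3)]] by simp
  qed
  have sW: "{b \<in> space blocks. map b [1..<Suc k] = w} \<in> sets blocks" for w
  proof (cases "length w = k")
    case True
    have "{b \<in> space blocks. b j = v} \<in> sets blocks" for j v
    proof (cases "v \<in> S")
      case True
      then show ?thesis
        using measurable_sets[OF measurable_component, of "{v}" j] by (simp add: vimage_def Int_def conj_commute)
    next
      case False
      then have "{b \<in> space blocks. b j = v} = {}" by (auto simp: space_blocks PiE_iff)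
      then show ?thesis by (simp only: sets.empty_sets)
    qed
    then have "{b \<in> space blocks. \<forall>j\<in>{..<k}. b (Suc j) = w ! j} \<in> sets blocks"
      by (intro sets.sets_Collect_finite_All) auto
    moreover have "{b \<in> space blocks. map b [1..<Suc k] = w} = {b \<in> space blocks. \<forall>j\<in>{..<k}. b (Suc j) = w ! j}"
      using True by (auto simp: list_eq_iff_nth_eq simp del: upt_Suc)
    ultimately show ?thesis by simp
  next
    case False
    then have "{b \<in> space blocks. map b [1..<Suc k] = w} = {}" by auto
    then show ?thesis by (simp only: sets.empty_sets)
  qed
  have W_set: "{z \<in> space ?\<Omega>. W z = w} = {..<N} \<times> {b \<in> space blocks. map b [1..<Suc k] = w}" for w
    by (auto simp: W_def space_pair_measure space_offset)
  have mW: "W \<in> measurable ?\<Omega> (count_space (words S k))"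
  proof (subst measurable_count_space_eq2[OF finK], intro conjI ballI)
    show "W \<in> space ?\<Omega> \<rightarrow> words S k"
      by (auto simp: W_def words_def[of S] space_pair_measure space_blocks PiE_iff)
    fix w
    have "{..<N} \<times> {b \<in> space blocks. map b [1..<Suc k] = w} \<in> sets ?\<Omega>"
      by (intro pair_measureI sW) (simp add: offset_def sets_point_measure)
    then show "W -` {w} \<inter> space ?\<Omega> \<in> sets ?\<Omega>"
      using W_set[of w] by (simp add: vimage_def Int_def conj_commute)
  qed
  have prob_W: "joint.prob {z \<in> space ?\<Omega>. W z = w} = (\<Prod>j<k. p (w ! j))" if w: "w \<in> words S k" for w
  proof -
    have "emeasure ?\<Omega> ({..<N} \<times> {b \<in> space blocks. map b [1..<Suc k] = w})
        = emeasure offset {..<N} * emeasure blocks {b \<in> space blocks. map b [1..<Suc k] = w}"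
      by (rule blocks.emeasure_pair_measure_Times[OF _ sW]) (simp add: offset_def sets_point_measure)
    also have "emeasure offset {..<N} = 1"
      using offset.emeasure_space_1 by (simp add: space_offset)
    finally show ?thesis
      unfolding W_set prob_blocks_cylinder[OF w, symmetric] by (simp add: measure_def)
  qed
  \<comment> \<open>The subtraction of natural numbers is exact as i < N \<le> j N, and the position
    stays inside the window as l < N and j \<le> k.\<close>
  have G: "G (U z) = W z" if z: "z \<in> space ?\<Omega>" for z
  proof -
    obtain i b where z': "z = (i, b)" "i < N" "b \<in> space blocks"
      using z by (auto simp: space_pair_measure space_offset)
    have "map (\<lambda>l. ?it (shifted z) ! (j * N + l - i)) [0..<N] = b j" if j: "1 \<le> j" "j \<le> k" for j
    proof (rule nth_equalityI)
      have len: "length (b j) = N" using z'(3) by (auto simp: space_blocks PiE_iff words_def)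
      then show "length (map (\<lambda>l. ?it (shifted z) ! (j * N + l - i)) [0..<N]) = length (b j)" by simp
      fix l assume "l < length (map (\<lambda>l. ?it (shifted z) ! (j * N + l - i)) [0..<N])"
      then have l: "l < N" by simp
      have "N \<le> j * N" using j by simp
      then have ge: "i \<le> j * N + l" using z'(2) by linarith
      have "j * N \<le> k * N" using j(2) by (rule mult_le_mono1)
      from add_less_le_mono[OF l this] have "j * N + l < Suc k * N"
        by (simp only: mult_Suc add.commute[of "j * N"])
      then have "j * N + l - i < n" by (simp add: n_def)
      then have "?it (shifted z) ! (j * N + l - i) = concat_blocks b (i + (j * N + l - i))"
        by (simp add: coordinate_itinerary z'(1) shifted_def left_shift_funpow)
      also have "\<dots> = b j ! l" using ge l by (simp add: concat_blocks_def)
      finally show "map (\<lambda>l. ?it (shifted z) ! (j * N + l - i)) [0..<N] ! l = b j ! l" using l by simp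
    qed
    then show ?thesis
      by (simp add: G_def U_def W_def z'(1) del: upt_Suc)
  qed
  have "- (\<Sum>w\<in>words S k. joint.prob {z \<in> space ?\<Omega>. W z = w} * ln (joint.prob {z \<in> space ?\<Omega>. W z = w}))
      \<le> - (\<integral>z. ln (q (U z) (W z)) \<partial>?\<Omega>)"
  proof (rule joint.gibbs_inequality[OF finA finK mU mW])
    show "0 \<le> q u w" for u w by (cases u) (simp add: q_def P_def)
    show "(\<Sum>u\<in>A. \<Sum>w\<in>words S k. q u w) \<le> 1"
    proof -
      have "(\<Sum>w\<in>words S k. q (i, u) w) \<le> 1 / real N * P u" for i u
      proof -
        have "(\<Sum>w\<in>words S k. if w = G (i, u) then 1 else 0 :: real) \<le> 1"
          using finK by simp
        then have "(1 / real N * P u) * (\<Sum>w\<in>words S k. if w = G (i, u) then 1 else 0) \<le> (1 / real N * P u) * 1"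
          by (intro mult_left_mono) (auto simp: P_def)
        then show ?thesis unfolding q_def by (simp add: sum_distrib_left)
      qed
      then have "(\<Sum>u\<in>A. \<Sum>w\<in>words S k. q u w) \<le> (\<Sum>(i, u)\<in>A. 1 / real N * P u)"
        by (intro sum_mono) auto
      also have "\<dots> = (\<Sum>i<N. \<Sum>u\<in>words UNIV n. 1 / real N * P u)"
        unfolding A_def by (rule sum.cartesian_product[symmetric])
      also have "\<dots> = 1" using N P_sum by (simp add: sum_divide_distrib[symmetric])
      finally show ?thesis .
    qed
    fix a w assume a: "a \<in> A" and pos: "0 < joint.prob {z \<in> space ?\<Omega>. U z = a \<and> W z = w}"
    obtain i u where iu: "a = (i, u)" "u \<in> words UNIV n" using a by (auto simp: A_def)
    have "{z \<in> space ?\<Omega>. U z = a \<and> W z = w} \<noteq> {}"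
    proof
      assume "{z \<in> space ?\<Omega>. U z = a \<and> W z = w} = {}"
      with pos show False by (simp only: measure_empty less_irrefl)
    qed
    then obtain z where z: "z \<in> space ?\<Omega>" "U z = a" "W z = w" by blast
    have "w = G (i, u)" using G[OF z(1)] z iu by simp
    moreover have "{z \<in> space ?\<Omega>. ?it (shifted z) = u} \<in> sets ?\<Omega>"
      using measurable_sets[OF measurable_shifted sP[OF iu(2)]] by (simp add: vimage_def Int_def conj_commute)
    then have "0 < P u"
      unfolding P_eq[OF iu(2)] by (intro less_le_trans[OF pos joint.finite_measure_mono]) (auto simp: U_def iu)
    ultimately show "0 < q a w" using N by (simp add: q_def iu)
  qed
  also have "\<dots> \<le> - (\<integral>z. - ln (real N) + ln (P (?it (shifted z))) \<partial>?\<Omega>)"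
  proof -
    have mit: "(\<lambda>z. ?it (shifted z)) \<in> measurable ?\<Omega> (count_space (words UNIV n))"
      by (rule measurable_compose[OF measurable_shifted it_b])
    have int: "integrable ?\<Omega> (\<lambda>z. c (?it (shifted z)))" for c :: "bool list \<Rightarrow> real"
      by (rule joint.integrable_finite_range[OF mit finite_bool_words])
    have q_eq: "q (U z) (W z) = 1 / real N * P (?it (shifted z))" if "z \<in> space ?\<Omega>" for z
      using G[OF that] by (simp add: q_def U_def)
    have "integrable ?\<Omega> (\<lambda>z. ln (q (U z) (W z)))"
      using int[of "\<lambda>u. ln (1 / real N * P u)"] by (subst Bochner_Integration.integrable_cong[OF refl]) (auto simp: q_eq)
    moreover have "- ln (real N) + ln (P (?it (shifted z))) \<le> ln (q (U z) (W z))" if "z \<in> space ?\<Omega>" for z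
    \<comment> \<open>In the first case both logarithms are \<open>ln 0 = 0\<close> and the claim
      reduces to ln N \<ge> 0.\<close>
    proof (cases "P (?it (shifted z)) = 0")
      case True
      then show ?thesis using N unfolding q_eq[OF that] by simp
    next
      case False
      then have "P (?it (shifted z)) > 0" by (simp add: P_def order.strict_iff_order)
      then show ?thesis using N unfolding q_eq[OF that] by (simp add: ln_div)
    qed
    ultimately show ?thesis
      using int[of "\<lambda>u. - ln (real N) + ln (P u)"] by (intro le_imp_neg_le integral_mono)
  qed
  also have "(\<integral>z. - ln (real N) + ln (P (?it (shifted z))) \<partial>?\<Omega>) = (\<integral>x. - ln (real N) + ln (P (?it x)) \<partial>\<mu>)"
    unfolding \<mu>_def
    by (rule integral_distr[OF measurable_shifted, symmetric]) (rule measurable_compose[OF it_b], simp)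
  also have "\<dots> = - ln (real N) + (\<integral>x. ln (P (?it x)) \<partial>\<mu>)"
    using \<mu>.integrable_finite_range[OF it finite_bool_words, where c = "\<lambda>u. ln (P u)"]
    by (simp add: \<mu>.prob_space)
  also have "(\<integral>x. ln (P (?it x)) \<partial>\<mu>) = - word_entropy \<mu> (\<lambda>x. x 0) UNIV n"
    using \<mu>.word_entropy_integral[OF x0, of n] by (simp add: P_def)
  also have "(\<Sum>w\<in>words S k. joint.prob {z \<in> space ?\<Omega>. W z = w} * ln (joint.prob {z \<in> space ?\<Omega>. W z = w}))
      = real k * (\<Sum>w\<in>S. p w * ln (p w))"
    unfolding entropy_prod_words[symmetric] by (intro sum.cong refl) (simp add: prob_W)
  finally show ?thesis by (simp add: n_def)
qed

text \<open>Along the window lengths (k + 1) N, division by k makes ln N disappear, while (k + 1) N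
  / k tends to N.\<close>

lemma block_entropy_le_rate:
  assumes h: "(\<lambda>n. word_entropy \<mu> (\<lambda>x. x 0) UNIV n / real n) \<longlonglongrightarrow> h"
  shows "- (\<Sum>w\<in>S. p w * ln (p w)) \<le> real N * h"
proof -
  let ?H = "- (\<Sum>w\<in>S. p w * ln (p w))"
  let ?w = "word_entropy \<mu> (\<lambda>x. x 0) UNIV"
  have "strict_mono (\<lambda>k. Suc k * N)" using N by (auto simp: strict_mono_def)
  from LIMSEQ_subseq_LIMSEQ[OF h this]
  have l: "(\<lambda>k. ?w (Suc k * N) / real (Suc k * N)) \<longlonglongrightarrow> h" by (simp add: o_def)
  have t: "(\<lambda>k. 1 + 1 / real k) \<longlonglongrightarrow> 1"
    using tendsto_add[OF tendsto_const lim_const_over_n[of 1], of 1] by simp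
  have rhs: "(\<lambda>k. ln (real N) / real k + ?w (Suc k * N) / real (Suc k * N) * ((1 + 1 / real k) * real N))
      \<longlonglongrightarrow> 0 + h * (1 * real N)"
    by (intro tendsto_add tendsto_mult l t lim_const_over_n tendsto_const)
  have "\<exists>K. \<forall>k\<ge>K. ?H \<le> ln (real N) / real k + ?w (Suc k * N) / real (Suc k * N) * ((1 + 1 / real k) * real N)"
  proof (intro exI allI impI)
    fix k :: nat assume k: "k \<ge> 1"
    have "(1 + 1 / real k) * real N = real (Suc k * N) / real k" using k by (simp add: field_simps)
    then have e: "?w (Suc k * N) / real (Suc k * N) * ((1 + 1 / real k) * real N) = ?w (Suc k * N) / real k"
      using k N by (simp del: mult_Suc)
    have "?H \<le> (ln (real N) + ?w (Suc k * N)) / real k"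
      using entropy_blocks_le[of k] k by (simp add: le_divide_eq mult.commute del: mult_Suc)
    then show "?H \<le> ln (real N) / real k + ?w (Suc k * N) / real (Suc k * N) * ((1 + 1 / real k) * real N)"
      unfolding e by (simp add: add_divide_distrib)
  qed
  from LIMSEQ_le_const[OF rhs this] show ?thesis by (simp add: mult.commute)
qed

end

text \<open>For Gibbs weights the entropy of a block is exactly ln Z - E F, with F the Birkhoff sum
  at the representative of the block, while N times the integral of f is at least E F - C. In the
  sum of the two, E F cancels.\<close>

lemma topological_pressure_ge:
  fixes f :: "cantor \<Rightarrow>\<^sub>C real"
  assumes N: "N > 0"
    and C: "\<And>x y. (\<And>i. i < N \<Longrightarrow> x i = y i) \<Longrightarrow> \<bar>birkhoff_sum f N x - birkhoff_sum f N y\<bar> \<le> C"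
  shows "ereal ((ln (partition_function f N (\<lambda>_. False)) - C) / real N) \<le> topological_pressure f"
proof -
  define Z where "Z = partition_function f N (\<lambda>_. False)"
  have Z: "Z > 0" unfolding Z_def by (rule partition_function_pos)
  define F where "F w = birkhoff_sum f N (prepend_word w (\<lambda>_. False))" for w
  define p where "p w = exp (F w) / Z" for w
  interpret independent_blocks N p
    by unfold_locales
      (use N Z in \<open>auto simp: p_def Z_def F_def partition_function_def sum_divide_distrib[symmetric]\<close>)
  let ?I = "\<integral>x. f x \<partial>\<mu>"
  have x0: "(\<lambda>x :: cantor. x 0) \<in> measurable \<mu> (count_space UNIV)"
    using measurable_coordinate[of 0] sets_\<mu> by (auto simp: measurable_count_space_eq2 space_\<mu> vimage_def)
  obtain h where h: "(\<lambda>n. word_entropy \<mu> (\<lambda>x. x 0) UNIV n / real n) \<longlonglongrightarrow> h"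
    using \<mu>.word_entropy_limit[OF x0] by auto
  have ent: "- (\<Sum>w\<in>S. p w * ln (p w)) \<le> real N * h" by (rule block_entropy_le_rate[OF h])
  have ln_p: "ln (p w) = F w - ln Z" for w using Z by (simp add: p_def ln_div)
  have "(\<Sum>w\<in>S. p w * ln (p w)) = (\<Sum>w\<in>S. p w * F w) - ln Z * (\<Sum>w\<in>S. p w)"
    unfolding sum_distrib_left sum_subtractf[symmetric]
    by (intro sum.cong refl) (simp add: ln_p algebra_simps)
  then have ent': "ln Z - (\<Sum>w\<in>S. p w * F w) \<le> real N * h" using ent by (simp add: p_sum)
  have fm: "apply_bcontfun f \<in> borel_measurable borel"
    by (rule borel_measurable_continuous_onI[OF continuous_on_apply_bcontfun])
  have int_f: "integrable blocks (\<lambda>b. f ((left_shift ^^ i) (concat_blocks b)))" for i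
    by (rule blocks.integrable_const_bound[where B = "norm f"])
      (auto intro: measurable_compose[OF measurable_shifted_fixed fm] simp: abs_bcontfun_le)
  \<comment> \<open>Averaging over the offset turns the integral of f into the mean of a whole
    Birkhoff sum over the first N coordinates, which form block 0.\<close>
  have "real N * ?I = (\<Sum>i<N. \<integral>b. f ((left_shift ^^ i) (concat_blocks b)) \<partial>blocks)"
    using integral_\<mu>[OF \<mu>.integrable_bcontfun, of f] N by simp
  also have "\<dots> = (\<integral>b. birkhoff_sum f N (concat_blocks b) \<partial>blocks)"
    unfolding birkhoff_sum_def by (rule Bochner_Integration.integral_sum[symmetric]) (rule int_f)
  also have "\<dots> \<ge> (\<integral>b. F (b 0) - C \<partial>blocks)"
  proof (rule integral_mono)
    show "integrable blocks (\<lambda>b. F (b 0) - C)"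
      by (rule blocks.integrable_finite_range[OF measurable_component finite_bool_words])
    show "integrable blocks (\<lambda>b. birkhoff_sum f N (concat_blocks b))"
      unfolding birkhoff_sum_def by (intro Bochner_Integration.integrable_sum int_f)
    fix b assume "b \<in> space blocks"
    then have "length (b 0) = N" by (auto simp: space_blocks PiE_iff words_def)
    then have "\<bar>birkhoff_sum f N (concat_blocks b) - F (b 0)\<bar> \<le> C"
      unfolding F_def by (intro C) (simp add: concat_blocks_def prepend_word_nth)
    then show "F (b 0) - C \<le> birkhoff_sum f N (concat_blocks b)" by linarith
  qed
  also have "(\<integral>b. F (b 0) - C \<partial>blocks) = (\<Sum>w\<in>S. p w * F w) - C"
    unfolding integral_component[of "\<lambda>w. F w - C" 0]
    by (simp add: right_diff_distrib sum_subtractf sum_distrib_right[symmetric] p_sum)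
  finally have "ln Z - C \<le> real N * (h + ?I)" using ent' by (simp add: algebra_simps)
  then have "(ln Z - C) / real N \<le> h + ?I" using N by (simp add: divide_le_eq mult.commute)
  then have "ereal ((ln Z - C) / real N) \<le> ereal h + ereal ?I" by simp
  also have "\<dots> \<le> ks_entropy \<mu> left_shift + ereal ?I"
    by (intro add_right_mono \<mu>.ks_entropy_ge_coordinate[OF h])
  also have "\<dots> \<le> topological_pressure f"
    unfolding topological_pressure_def by (rule SUP_upper[OF \<mu>_in])
  finally show ?thesis unfolding Z_def .
qed

lemma topological_pressure_eq: "topological_pressure f = ereal (pressure f)"
proof (rule antisym)
  show "topological_pressure f \<le> ereal (pressure f)"
    unfolding topological_pressure_def
  proof (rule SUP_least)
    fix \<mu> assume "\<mu> \<in> shift_invariant_measures"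
    then interpret shift_invariant_measure \<mu>
      by (simp add: shift_invariant_measures_def shift_invariant_measure_def shift_invariant_measure_axioms_def)
    show "ks_entropy \<mu> left_shift + ereal (\<integral>x. f x \<partial>\<mu>) \<le> ereal (pressure f)"
      by (rule ks_entropy_add_integral_le)
  qed
  show "ereal (pressure f) \<le> topological_pressure f"
  proof (rule ereal_le_epsilon2)
    fix e :: real assume e: "e > 0"
    obtain C where C: "\<And>n x y. (\<And>i. i < n \<Longrightarrow> x i = y i) \<Longrightarrow>
      \<bar>birkhoff_sum f n x - birkhoff_sum f n y\<bar> \<le> C + real n * e"
      using birkhoff_sum_variation[OF e] by blast
    let ?l = "\<lambda>n. ln (partition_function f n (\<lambda>_. False)) / real n"
    have lim: "(\<lambda>n. ereal (?l n - C / real n - e)) \<longlonglongrightarrow> ereal (pressure f - 0 - e)"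
      by (intro tendsto_ereal tendsto_diff partition_function_tendsto lim_const_over_n tendsto_const)
    have "\<exists>M. \<forall>n\<ge>M. ereal (?l n - C / real n - e) \<le> topological_pressure f"
    proof (intro exI allI impI)
      fix n :: nat assume n: "n \<ge> 1"
      \<comment> \<open>The variation over n-cylinders, taken with N = n, becomes C / n + e after
        division by n.\<close>
      have "ereal ((ln (partition_function f n (\<lambda>_. False)) - (C + real n * e)) / real n) \<le> topological_pressure f"
        by (rule topological_pressure_ge) (use n C in auto)
      moreover have "(ln (partition_function f n (\<lambda>_. False)) - (C + real n * e)) / real n = ?l n - C / real n - e"
        using n by (simp add: diff_divide_distrib add_divide_distrib)
      ultimately show "ereal (?l n - C / real n - e) \<le> topological_pressure f" by simp
    qed
    from LIMSEQ_le_const2[OF lim this] have "ereal (pressure f - e) + ereal e \<le> topological_pressure f + ereal e"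
      by (intro add_right_mono) simp
    then show "ereal (pressure f) \<le> topological_pressure f + ereal e" by simp
  qed
qed

section \<open>The maximum of Brownian motion\<close>

text \<open>The two preimages of a Borel set differ only inside a null set, and completeness makes
  this harmless.\<close>

lemma (in complete_measure) borel_measurable_AE_cong:
  fixes f g :: "'a \<Rightarrow> 'b::topological_space"
  assumes f: "f \<in> borel_measurable M" and eq: "AE x in M. f x = g x"
  shows "g \<in> borel_measurable M"
proof (rule measurableI)
  fix A :: "'b set" assume A: "A \<in> sets borel"
  show "g -` A \<inter> space M \<in> sets M"
  proof (rule in_sets_AE)
    show "AE x in M. x \<in> f -` A \<inter> space M \<longleftrightarrow> x \<in> g -` A \<inter> space M"
      using eq by eventually_elim auto
  qed (use measurable_sets[OF f A] in auto)
qed simp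

text \<open>Layer-cake formula: \<open>exp (V \<omega>) - 1\<close> is the integral of exp from 0 to
  \<open>V \<omega>\<close>, and Tonelli's theorem exchanges the integrals. Subtracting 1 makes the
  layers start at level 0, so only tails at nonnegative levels enter.\<close>

lemma (in prob_space) nn_integral_exp_minus_one:
  assumes V: "V \<in> borel_measurable M" and nonneg: "\<And>\<omega>. \<omega> \<in> space M \<Longrightarrow> 0 \<le> V \<omega>"
  shows "(\<integral>\<^sup>+\<omega>. ennreal (exp (V \<omega>) - 1) \<partial>M)
    = (\<integral>\<^sup>+a. ennreal (exp a) * indicator {0..} a * emeasure M {\<omega> \<in> space M. a \<le> V \<omega>} \<partial>lborel)"
proof -
  interpret pair_sigma_finite lborel M
    by (intro pair_sigma_finite.intro sigma_finite_lborel sigma_finite_measure_axioms)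
  define g where "g a \<omega> = ennreal (exp a) * indicator {0..} a * indicator {\<omega> \<in> space M. a \<le> V \<omega>} \<omega>" for a \<omega>
  have "{z \<in> space (lborel \<Otimes>\<^sub>M M). fst z \<le> V (snd z)} \<in> sets (lborel \<Otimes>\<^sub>M M)"
    using V by measurable
  then have "case_prod (\<lambda>a \<omega>. ennreal (exp a) * indicator {0..} a * indicator {z \<in> space (lborel \<Otimes>\<^sub>M M). fst z \<le> V (snd z)} (a, \<omega>))
      \<in> borel_measurable (lborel \<Otimes>\<^sub>M M)"
    by measurable
  also have "case_prod (\<lambda>a \<omega>. ennreal (exp a) * indicator {0..} a * indicator {z \<in> space (lborel \<Otimes>\<^sub>M M). fst z \<le> V (snd z)} (a, \<omega>))
      = case_prod g"
    by (auto simp: g_def fun_eq_iff indicator_def space_pair_measure)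
  finally have g: "case_prod g \<in> borel_measurable (lborel \<Otimes>\<^sub>M M)" .
  have "(\<integral>\<^sup>+\<omega>. ennreal (exp (V \<omega>) - 1) \<partial>M) = (\<integral>\<^sup>+\<omega>. (\<integral>\<^sup>+a. g a \<omega> \<partial>lborel) \<partial>M)"
  proof (rule nn_integral_cong)
    fix \<omega> assume \<omega>: "\<omega> \<in> space M"
    have "(\<integral>\<^sup>+a. ennreal (exp a) * indicator {0..V \<omega>} a \<partial>lborel) = ennreal (exp (V \<omega>) - exp 0)"
      by (rule nn_integral_FTC_Icc) (use nonneg[OF \<omega>] in \<open>auto intro!: derivative_eq_intros\<close>)
    moreover have "g a \<omega> = ennreal (exp a) * indicator {0..V \<omega>} a" for a
      using \<omega> by (auto simp: g_def indicator_def)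
    ultimately show "ennreal (exp (V \<omega>) - 1) = (\<integral>\<^sup>+a. g a \<omega> \<partial>lborel)" by simp
  qed
  also have "\<dots> = (\<integral>\<^sup>+a. (\<integral>\<^sup>+\<omega>. g a \<omega> \<partial>M) \<partial>lborel)"
    by (rule Fubini'[OF g])
  also have "\<dots> = (\<integral>\<^sup>+a. ennreal (exp a) * indicator {0..} a * emeasure M {\<omega> \<in> space M. a \<le> V \<omega>} \<partial>lborel)"
  proof (rule nn_integral_cong)
    fix a :: real
    have "{\<omega> \<in> space M. a \<le> V \<omega>} \<in> sets M" using V by measurable
    then show "(\<integral>\<^sup>+\<omega>. g a \<omega> \<partial>M) = ennreal (exp a) * indicator {0..} a * emeasure M {\<omega> \<in> space M. a \<le> V \<omega>}"
      unfolding g_def by (rule nn_integral_cmult_indicator)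
  qed
  finally show ?thesis .
qed

text \<open>By symmetry of the law both closed half-lines have the same probability, and together
  they cover the line.\<close>

lemma (in prob_space) prob_centred_normal_nonneg:
  assumes X: "distributed M lborel X (normal_density 0 \<sigma>)" and \<sigma>: "0 < \<sigma>"
  shows "1 / 2 \<le> prob {\<omega> \<in> space M. 0 \<le> X \<omega>}"
proof -
  have Xm[measurable]: "X \<in> borel_measurable M" using distributed_measurable[OF X] by simp
  have "distributed M lborel (\<lambda>\<omega>. - X \<omega>) (normal_density 0 \<sigma>)"
    using normal_density_affine[OF X \<sigma>, of "-1" 0] by simp
  then have "distr M lborel (\<lambda>\<omega>. - X \<omega>) = distr M lborel X"
    using X by (simp add: distributed_distr_eq_density)
  then have "measure (distr M lborel (\<lambda>\<omega>. - X \<omega>)) {0..} = measure (distr M lborel X) {0..}" by simp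
  then have "prob {\<omega> \<in> space M. 0 \<le> X \<omega>} = prob {\<omega> \<in> space M. X \<omega> \<le> 0}"
    using Xm by (simp add: measure_distr vimage_def Int_def conj_commute)
  moreover have "1 = prob ({\<omega> \<in> space M. 0 \<le> X \<omega>} \<union> {\<omega> \<in> space M. X \<omega> \<le> 0})"
    unfolding prob_space[symmetric] by (rule arg_cong[where f = prob]) auto
  moreover have "\<dots> \<le> prob {\<omega> \<in> space M. 0 \<le> X \<omega>} + prob {\<omega> \<in> space M. X \<omega> \<le> 0}"
    by (intro measure_Un_le) measurable
  ultimately show ?thesis by simp
qed

text \<open>Completing the square turns exp times the density of mean 0 into
  \<open>exp (1 / 2)\<close> times the density of mean 1, both of variance 1.\<close>

lemma (in prob_space) exp_standard_normal:
  assumes X: "distributed M lborel X (normal_density 0 1)"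
  shows integrable_exp_standard_normal: "integrable M (\<lambda>\<omega>. exp (X \<omega>))"
    and integral_exp_standard_normal: "(\<integral>\<omega>. exp (X \<omega>) \<partial>M) = exp (1 / 2)"
proof -
  have eq: "normal_density 0 1 x * exp x = exp (1 / 2) * normal_density 1 1 x" for x :: real
  proof -
    have "- x\<^sup>2 / 2 + x = 1 / 2 + - (x - 1)\<^sup>2 / 2" by (simp add: power2_eq_square field_simps)
    then have "exp (- x\<^sup>2 / 2) * exp x = exp (1 / 2) * exp (- (x - 1)\<^sup>2 / 2)"
      by (simp only: exp_add[symmetric])
    then show ?thesis by (simp add: normal_density_def)
  qed
  show "integrable M (\<lambda>\<omega>. exp (X \<omega>))"
    using distributed_integrable[OF X, of exp] by (simp add: eq)
  show "(\<integral>\<omega>. exp (X \<omega>) \<partial>M) = exp (1 / 2)"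
    using distributed_integral[OF X, of exp] by (simp add: eq)
qed

context standard_brownian_motion
begin

text \<open>Subtracting \<open>B 0\<close> makes the values sums of increments at every \<omega>,
  whereas B starts at 0 only almost surely. The value at k = 0 vanishes, so the maximum is
  nonnegative everywhere.\<close>

definition grid :: "nat \<Rightarrow> nat \<Rightarrow> 'w \<Rightarrow> real" where
  "grid n k \<omega> = B (real k / real n) \<omega> - B 0 \<omega>"

definition grid_max :: "nat \<Rightarrow> 'w \<Rightarrow> real" where
  "grid_max n \<omega> = Max ((\<lambda>k. grid n k \<omega>) ` {..n})"

lemma grid_measurable: "k \<le> n \<Longrightarrow> grid n k \<in> borel_measurable M"
  unfolding grid_def by (intro borel_measurable_diff random_variable) (auto simp: divide_le_eq)

lemma grid_max_measurable: "grid_max n \<in> borel_measurable M"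
  unfolding grid_max_def by (intro borel_measurable_Max) (auto intro: grid_measurable)

lemma grid_le_grid_max: "k \<le> n \<Longrightarrow> grid n k \<omega> \<le> grid_max n \<omega>"
  unfolding grid_max_def by (intro Max_ge) auto

lemma grid_max_nonneg: "0 \<le> grid_max n \<omega>"
  using grid_le_grid_max[of 0 n \<omega>] by (simp add: grid_def)

text \<open>The first passage decomposition: once level \<open>a\<close> is reached at time \<open>k\<close>, the remaining increment
  is nonnegative with probability at least \<open>1/2\<close>.\<close>

lemma levy_first_passage:
  fixes a :: real
  assumes "k \<le> n"
  defines "A \<equiv> {\<omega> \<in> space M. a \<le> grid n k \<omega> \<and> (\<forall>j<k. grid n j \<omega> < a)}"
  shows "prob A \<le> 2 * prob (A \<inter> {\<omega> \<in> space M. a \<le> grid n n \<omega>})"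
proof (cases "k = n")
  case True
  have "A \<inter> {\<omega> \<in> space M. a \<le> grid n n \<omega>} = A" unfolding A_def True by auto
  then show ?thesis by simp
next
  case False
  then have k: "k < n" using assms(1) by simp
  \<comment> \<open>The times run through the grid up to k / n and then jump to 1: the increments
    before index k determine the first passage, and \<open>D k\<close> is the whole remaining
    increment, independent of them.\<close>
  define \<theta> where "\<theta> i = (if i \<le> k then real i / real n else 1)" for i
  define D where "D i \<omega> = B (\<theta> (Suc i)) \<omega> - B (\<theta> i) \<omega>" for i \<omega>
  have \<theta>_mono: "\<theta> i \<le> \<theta> (Suc i)" for i
    using k by (auto simp: \<theta>_def divide_right_mono divide_le_eq)
  have ind: "indep_vars (\<lambda>_. borel) D {..<Suc k}"
    unfolding D_def
  proof (rule independent_increments)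
    show "\<theta> i \<in> {0..1}" for i using k by (auto simp: \<theta>_def divide_le_eq)
  qed (rule \<theta>_mono)
  let ?P = "\<lambda>J. PiM J (\<lambda>_. borel :: real measure)"
  let ?R = "\<lambda>J \<omega>. restrict (\<lambda>i. D i \<omega>) J"
  have iv: "indep_var (?P {..<k}) (?R {..<k}) (?P {k}) (?R {k})"
    by (rule indep_var_restrict[OF ind]) auto
  define Xa where "Xa = {v \<in> space (?P {..<k}). a \<le> (\<Sum>i<k. v i) \<and> (\<forall>j\<in>{..<k}. (\<Sum>i<j. v i) < a)}"
  define Xb where "Xb = {v \<in> space (?P {k}). 0 \<le> v k}"
  have sum_m: "(\<lambda>v. \<Sum>i<j. v i) \<in> borel_measurable (?P {..<k})" if "j \<le> k" for j
    using that by (intro borel_measurable_sum measurable_component_singleton) auto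
  have Xa: "Xa \<in> sets (?P {..<k})"
    unfolding Xa_def
  proof (intro sets.sets_Collect_conj sets.sets_Collect_finite_All)
    show "{v \<in> space (?P {..<k}). a \<le> (\<Sum>i<k. v i)} \<in> sets (?P {..<k})"
      using sum_m[of k] by (intro borel_measurable_le) auto
    show "{v \<in> space (?P {..<k}). (\<Sum>i<j. v i) < a} \<in> sets (?P {..<k})" if "j \<in> {..<k}" for j
      using sum_m[of j] that by (intro borel_measurable_less) auto
  qed simp
  have Xb: "Xb \<in> sets (?P {k})"
    unfolding Xb_def by (intro borel_measurable_le measurable_component_singleton) auto
  have D_sum: "(\<Sum>i<j. D i \<omega>) = grid n j \<omega>" if "j \<le> k" for j \<omega>
  proof -
    have "(\<Sum>i<j. D i \<omega>) = B (\<theta> j) \<omega> - B (\<theta> 0) \<omega>"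
      unfolding D_def by (rule sum_lessThan_telescope)
    then show ?thesis using that by (simp add: \<theta>_def grid_def)
  qed
  have Ra: "?R {..<k} \<omega> \<in> space (?P {..<k})" and Rb: "?R {k} \<omega> \<in> space (?P {k})" for \<omega>
    by (simp_all add: space_PiM)
  have "?R {..<k} -` Xa \<inter> space M = A"
    unfolding Xa_def A_def using Ra by (auto simp: D_sum)
  moreover define E where "E = {\<omega> \<in> space M. 0 \<le> B 1 \<omega> - B (real k / real n) \<omega>}"
  have "?R {k} -` Xb \<inter> space M = E"
    unfolding Xb_def E_def using Rb by (auto simp: D_def \<theta>_def)
  moreover have "(\<lambda>\<omega>. (?R {..<k} \<omega>, ?R {k} \<omega>)) -` (Xa \<times> Xb) \<inter> space M
      = (?R {..<k} -` Xa \<inter> space M) \<inter> (?R {k} -` Xb \<inter> space M)" by auto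
  ultimately have prod: "prob (A \<inter> E) = prob A * prob E"
    using indep_varD[OF iv Xa Xb] by simp
  have "distributed M lborel (\<lambda>\<omega>. B 1 \<omega> - B (real k / real n) \<omega>) (normal_density 0 (sqrt (1 - real k / real n)))"
    by (rule gaussian_increments) (use k in auto)
  then have "1 / 2 \<le> prob E"
    unfolding E_def by (rule prob_centred_normal_nonneg) (use k in auto)
  then have "prob A * (1 / 2) \<le> prob A * prob E" by (intro mult_left_mono) auto
  then have "prob A \<le> 2 * prob (A \<inter> E)" unfolding prod by simp
  also have "prob (A \<inter> E) \<le> prob (A \<inter> {\<omega> \<in> space M. a \<le> grid n n \<omega>})"
  proof (rule finite_measure_mono)
    show "A \<inter> E \<subseteq> A \<inter> {\<omega> \<in> space M. a \<le> grid n n \<omega>}"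
      using k unfolding A_def E_def grid_def by auto
    have "A \<in> sets M"
      using \<open>?R {..<k} -` Xa \<inter> space M = A\<close> measurable_sets[OF indep_var_rv1[OF iv] Xa] by simp
    moreover have "{\<omega> \<in> space M. a \<le> grid n n \<omega>} \<in> sets M"
      using grid_measurable[of n n] by (intro borel_measurable_le) auto
    ultimately show "A \<inter> {\<omega> \<in> space M. a \<le> grid n n \<omega>} \<in> sets M" by simp
  qed
  finally show ?thesis by simp
qed

text \<open>The first passage events at different times are disjoint and cover the event on the
  left. The bounds for the pieces add up inside the event that the final value is at least
  a.\<close>

lemma levy_inequality:
  "prob {\<omega> \<in> space M. a \<le> grid_max n \<omega>} \<le> 2 * prob {\<omega> \<in> space M. a \<le> grid n n \<omega>}"
proof -
  define A where "A k = {\<omega> \<in> space M. a \<le> grid n k \<omega> \<and> (\<forall>j<k. grid n j \<omega> < a)}" for k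
  define F where "F = {\<omega> \<in> space M. a \<le> grid n n \<omega>}"
  have le: "{\<omega> \<in> space M. a \<le> grid n k \<omega>} \<in> sets M" "{\<omega> \<in> space M. grid n k \<omega> < a} \<in> sets M" if "k \<le> n" for k
    using grid_measurable[OF that] by (auto intro!: borel_measurable_le borel_measurable_less)
  have Am: "A k \<in> sets M" if "k \<le> n" for k
  proof -
    have "A k = {\<omega> \<in> space M. a \<le> grid n k \<omega> \<and> (\<forall>j\<in>{..<k}. grid n j \<omega> < a)}" unfolding A_def by auto
    also have "\<dots> \<in> sets M"
      using that by (intro sets.sets_Collect_conj sets.sets_Collect_finite_All le) auto
    finally show ?thesis .
  qed
  have Fm: "F \<in> sets M" unfolding F_def by (rule le) simp
  have disj: "disjoint_family_on A {..n}"
  proof (unfold disjoint_family_on_def, intro ballI impI)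
    fix i j :: nat assume "i \<noteq> j"
    then consider "i < j" | "j < i" by linarith
    then show "A i \<inter> A j = {}" by cases (auto simp: A_def dest: spec)
  qed
  have "{\<omega> \<in> space M. a \<le> grid_max n \<omega>} \<subseteq> (\<Union>k\<le>n. A k)"
  proof
    fix \<omega> assume \<omega>: "\<omega> \<in> {\<omega> \<in> space M. a \<le> grid_max n \<omega>}"
    then have "\<exists>k. k \<le> n \<and> a \<le> grid n k \<omega>"
      unfolding grid_max_def by (auto simp: Max_ge_iff)
    define k where "k = (LEAST k. k \<le> n \<and> a \<le> grid n k \<omega>)"
    have k: "k \<le> n" "a \<le> grid n k \<omega>"
      unfolding k_def using LeastI_ex[OF \<open>\<exists>k. k \<le> n \<and> a \<le> grid n k \<omega>\<close>] by auto
    have "grid n j \<omega> < a" if "j < k" for j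
      using not_less_Least[OF that[unfolded k_def]] that k(1) by simp
    then show "\<omega> \<in> (\<Union>k\<le>n. A k)" using \<omega> k unfolding A_def by auto
  qed
  then have "prob {\<omega> \<in> space M. a \<le> grid_max n \<omega>} \<le> prob (\<Union>k\<le>n. A k)"
    using Am by (intro finite_measure_mono) auto
  also have "\<dots> = (\<Sum>k\<le>n. prob (A k))"
    using Am disj by (intro finite_measure_finite_Union) auto
  also have "\<dots> \<le> (\<Sum>k\<le>n. 2 * prob (A k \<inter> F))"
    unfolding A_def F_def by (intro sum_mono levy_first_passage) simp
  also have "\<dots> = 2 * prob (\<Union>k\<le>n. A k \<inter> F)"
  proof -
    have "disjoint_family_on (\<lambda>k. A k \<inter> F) {..n}"
      using disj unfolding disjoint_family_on_def by blast
    then show ?thesis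
      using Am Fm by (subst finite_measure_finite_Union) (auto simp: sum_distrib_left)
  qed
  also have "\<dots> \<le> 2 * prob F"
    using Am Fm by (intro mult_left_mono finite_measure_mono) auto
  finally show ?thesis unfolding F_def .
qed

text \<open>The layer-cake formula is applied to the maximum and read backwards for the positive
  part Y of the final value, so that E exp(max) - 1 is at most 2 (E exp(Y) - 1). The last bracket is
  at most exp(1/2) - 1/2, whence the total 2 exp(1/2) without any additive remainder.\<close>

lemma nn_integral_exp_grid_max:
  assumes n: "n > 0"
  shows "(\<integral>\<^sup>+\<omega>. ennreal (exp (grid_max n \<omega>)) \<partial>M) \<le> ennreal (2 * exp (1 / 2))"
proof -
  define X where "X = grid n n"
  have Xd: "distributed M lborel X (normal_density 0 1)"
    using gaussian_increments[of 0 1] n by (simp add: X_def grid_def[abs_def])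
  have Xm[measurable]: "X \<in> borel_measurable M" unfolding X_def by (rule grid_measurable) simp
  define Y where "Y \<omega> = max 0 (X \<omega>)" for \<omega>
  have Ym[measurable]: "Y \<in> borel_measurable M" using Xm unfolding Y_def by measurable
  define F where "F = {\<omega> \<in> space M. 0 \<le> X \<omega>}"
  have Fm: "F \<in> sets M" unfolding F_def using Xm by measurable
  have half: "1 / 2 \<le> prob F" unfolding F_def by (rule prob_centred_normal_nonneg[OF Xd]) simp
  have tail: "emeasure M {\<omega> \<in> space M. a \<le> grid_max n \<omega>} \<le> 2 * emeasure M {\<omega> \<in> space M. a \<le> Y \<omega>}" for a
  proof -
    have "prob {\<omega> \<in> space M. a \<le> grid_max n \<omega>} \<le> 2 * prob {\<omega> \<in> space M. a \<le> X \<omega>}"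
      unfolding X_def by (rule levy_inequality)
    also have "prob {\<omega> \<in> space M. a \<le> X \<omega>} \<le> prob {\<omega> \<in> space M. a \<le> Y \<omega>}"
    proof (rule finite_measure_mono)
      show "{\<omega> \<in> space M. a \<le> X \<omega>} \<subseteq> {\<omega> \<in> space M. a \<le> Y \<omega>}" by (auto simp: Y_def)
    qed measurable
    finally have "ennreal (prob {\<omega> \<in> space M. a \<le> grid_max n \<omega>}) \<le> ennreal (2 * prob {\<omega> \<in> space M. a \<le> Y \<omega>})"
      by (intro ennreal_leI) simp
    then show ?thesis by (simp add: emeasure_eq_measure ennreal_mult)
  qed
  have "(\<integral>\<^sup>+\<omega>. ennreal (exp (grid_max n \<omega>) - 1) \<partial>M)
      = (\<integral>\<^sup>+a. ennreal (exp a) * indicator {0..} a * emeasure M {\<omega> \<in> space M. a \<le> grid_max n \<omega>} \<partial>lborel)"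
    by (rule nn_integral_exp_minus_one[OF grid_max_measurable grid_max_nonneg])
  also have "\<dots> \<le> (\<integral>\<^sup>+a. 2 * (ennreal (exp a) * indicator {0..} a * emeasure M {\<omega> \<in> space M. a \<le> Y \<omega>}) \<partial>lborel)"
  proof (rule nn_integral_mono)
    fix a :: real
    have "ennreal (exp a) * indicator {0..} a * emeasure M {\<omega> \<in> space M. a \<le> grid_max n \<omega>}
        \<le> ennreal (exp a) * indicator {0..} a * (2 * emeasure M {\<omega> \<in> space M. a \<le> Y \<omega>})"
      by (intro mult_left_mono tail) simp
    then show "ennreal (exp a) * indicator {0..} a * emeasure M {\<omega> \<in> space M. a \<le> grid_max n \<omega>}
        \<le> 2 * (ennreal (exp a) * indicator {0..} a * emeasure M {\<omega> \<in> space M. a \<le> Y \<omega>})"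
      by (simp add: mult_ac)
  qed
  also have "\<dots> = 2 * (\<integral>\<^sup>+a. ennreal (exp a) * indicator {0..} a * emeasure M {\<omega> \<in> space M. a \<le> Y \<omega>} \<partial>lborel)"
  proof (rule nn_integral_cmult)
    have "(\<lambda>a. prob {\<omega> \<in> space M. a \<le> Y \<omega>}) \<in> borel_measurable borel"
    proof -
      have "antimono (\<lambda>a. prob {\<omega> \<in> space M. a \<le> Y \<omega>})"
        using Ym by (intro antimonoI finite_measure_mono) auto
      then have "mono (\<lambda>a. - prob {\<omega> \<in> space M. a \<le> Y \<omega>})" by (auto simp: mono_def antimono_def)
      then have "(\<lambda>a. - (- prob {\<omega> \<in> space M. a \<le> Y \<omega>})) \<in> borel_measurable borel"
        by (intro borel_measurable_uminus borel_measurable_mono)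
      then show ?thesis by simp
    qed
    then show "(\<lambda>a. ennreal (exp a) * indicator {0..} a * emeasure M {\<omega> \<in> space M. a \<le> Y \<omega>}) \<in> borel_measurable lborel"
      unfolding emeasure_eq_measure by measurable
  qed
  also have "(\<integral>\<^sup>+a. ennreal (exp a) * indicator {0..} a * emeasure M {\<omega> \<in> space M. a \<le> Y \<omega>} \<partial>lborel)
      = (\<integral>\<^sup>+\<omega>. ennreal (exp (Y \<omega>) - 1) \<partial>M)"
    by (rule nn_integral_exp_minus_one[OF Ym, symmetric]) (simp add: Y_def)
  also have "\<dots> \<le> ennreal (exp (1 / 2) - 1 / 2)"
  proof -
    have int: "integrable M (\<lambda>\<omega>. exp (X \<omega>) - indicator F \<omega>)"
      using Fm by (intro Bochner_Integration.integrable_diff integrable_exp_standard_normal[OF Xd]) (simp add: less_top[symmetric])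
    \<comment> \<open>Both sides agree on F, and off F the left side is 0. The indicator has
      expectation at least 1 / 2; doubled, this cancels the 1 that is added back at the end.\<close>
    have le: "exp (Y \<omega>) - 1 \<le> exp (X \<omega>) - indicator F \<omega>" if "\<omega> \<in> space M" for \<omega>
      using that by (auto simp: Y_def F_def indicator_def max_def)
    have nn: "0 \<le> exp (Y \<omega>) - 1" for \<omega> by (simp add: Y_def)
    have "(\<integral>\<^sup>+\<omega>. ennreal (exp (Y \<omega>) - 1) \<partial>M) \<le> (\<integral>\<^sup>+\<omega>. ennreal (exp (X \<omega>) - indicator F \<omega>) \<partial>M)"
      by (intro nn_integral_mono ennreal_leI le)
    also have "\<dots> = ennreal (\<integral>\<omega>. exp (X \<omega>) - indicator F \<omega> \<partial>M)"
      by (intro nn_integral_eq_integral int AE_I2 order_trans[OF nn le])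
    also have "(\<integral>\<omega>. exp (X \<omega>) - indicator F \<omega> \<partial>M) = exp (1 / 2) - prob F"
    proof -
      have "(\<integral>\<omega>. exp (X \<omega>) - indicator F \<omega> \<partial>M) = (\<integral>\<omega>. exp (X \<omega>) \<partial>M) - (\<integral>\<omega>. indicator F \<omega> \<partial>M)"
        using Fm by (intro Bochner_Integration.integral_diff integrable_exp_standard_normal[OF Xd]) (simp add: less_top[symmetric])
      then show ?thesis
        using sets.sets_into_space[OF Fm] by (simp add: integral_exp_standard_normal[OF Xd] Int_absorb2)
    qed
    also have "ennreal (exp (1 / 2) - prob F) \<le> ennreal (exp (1 / 2) - 1 / 2)"
      using half by (intro ennreal_leI) simp
    finally show ?thesis .
  qed
  finally have main: "(\<integral>\<^sup>+\<omega>. ennreal (exp (grid_max n \<omega>) - 1) \<partial>M) \<le> 2 * ennreal (exp (1 / 2) - 1 / 2)"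
    by (simp add: mult_left_mono)
  have "(\<integral>\<^sup>+\<omega>. ennreal (exp (grid_max n \<omega>)) \<partial>M) = (\<integral>\<^sup>+\<omega>. ennreal (exp (grid_max n \<omega>) - 1) + 1 \<partial>M)"
  proof (rule nn_integral_cong)
    fix \<omega>
    have "ennreal (exp (grid_max n \<omega>)) = ennreal ((exp (grid_max n \<omega>) - 1) + 1)" by simp
    also have "\<dots> = ennreal (exp (grid_max n \<omega>) - 1) + ennreal 1"
      using grid_max_nonneg[of n \<omega>] by (intro ennreal_plus) simp_all
    finally show "ennreal (exp (grid_max n \<omega>)) = ennreal (exp (grid_max n \<omega>) - 1) + 1" by simp
  qed
  also have "\<dots> = (\<integral>\<^sup>+\<omega>. ennreal (exp (grid_max n \<omega>) - 1) \<partial>M) + 1"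
    using grid_max_measurable[of n] by (subst nn_integral_add) (auto simp: emeasure_space_1)
  also have "\<dots> \<le> 2 * ennreal (exp (1 / 2) - 1 / 2) + 1"
    by (intro add_right_mono main)
  also have "\<dots> = ennreal (2 * (exp (1 / 2) - 1 / 2) + 1)"
  proof -
    have "2 * ennreal c + 1 = ennreal (2 * c + 1)" if "0 \<le> c" for c
      using that by (simp add: ennreal_mult ennreal_plus)
    moreover have "(0::real) \<le> exp (1 / 2) - 1 / 2" using one_le_exp_iff[of "1 / 2 :: real"] by linarith
    ultimately show ?thesis by blast
  qed
  finally show ?thesis by (simp add: algebra_simps)
qed

text \<open>The grid points \<open>k n / n\<close>, with \<open>k n\<close> the integer part of n s,
  tend to s, and the path is continuous there. The liminf is the form that suits Fatou's
  lemma.\<close>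

lemma exp_sup_le_liminf:
  assumes cont: "continuous_on {0..1} (\<lambda>s. B s \<omega>)" and s: "s \<in> {0..1}" and B0: "B 0 \<omega> = 0"
  shows "ennreal (exp (B s \<omega>)) \<le> liminf (\<lambda>n. ennreal (exp (grid_max n \<omega>)))"
proof -
  define k where "k n = nat \<lfloor>real n * s\<rfloor>" for n
  have k_bounds: "real (k n) \<le> real n * s" "real n * s \<le> real (k n) + 1" for n
    using s unfolding k_def by (auto simp: of_nat_nat)
  have k_le: "k n \<le> n" for n
  proof -
    have "real (k n) \<le> real n * 1" using k_bounds(1)[of n] s by (meson atLeastAtMost_iff mult_left_mono of_nat_0_le_iff order_trans)
    then show ?thesis by simp
  qed
  have lim: "(\<lambda>n. real (k n) / real n) \<longlonglongrightarrow> s"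
  proof (rule real_tendsto_sandwich)
    show "\<forall>\<^sub>F n in sequentially. s - 1 / real n \<le> real (k n) / real n"
      using eventually_gt_at_top[of 0]
    proof eventually_elim
      case (elim n)
      have "s - 1 / real n = (real n * s - 1) / real n" using elim by (simp add: diff_divide_distrib)
      also have "\<dots> \<le> real (k n) / real n" using k_bounds(2)[of n] by (intro divide_right_mono) auto
      finally show ?case .
    qed
    show "\<forall>\<^sub>F n in sequentially. real (k n) / real n \<le> s"
      using eventually_gt_at_top[of 0] by eventually_elim (use k_bounds(1) in \<open>simp add: divide_le_eq mult.commute\<close>)
    show "(\<lambda>n. s - 1 / real n) \<longlonglongrightarrow> s"
      using tendsto_diff[OF tendsto_const lim_const_over_n[of 1], of s] by simp
  qed simp
  have "(\<lambda>n. B (real (k n) / real n) \<omega>) \<longlonglongrightarrow> B s \<omega>"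
    by (rule continuous_on_tendsto_compose[OF cont lim s]) (use k_le in \<open>auto simp: divide_le_eq\<close>)
  then have "(\<lambda>n. ennreal (exp (B (real (k n) / real n) \<omega>))) \<longlonglongrightarrow> ennreal (exp (B s \<omega>))"
    by (intro tendsto_ennrealI tendsto_exp)
  then have "ennreal (exp (B s \<omega>)) = liminf (\<lambda>n. ennreal (exp (B (real (k n) / real n) \<omega>)))"
    by (intro lim_imp_Liminf[symmetric]) auto
  also have "\<dots> \<le> liminf (\<lambda>n. ennreal (exp (grid_max n \<omega>)))"
  proof (rule Liminf_mono, rule always_eventually, rule allI)
    fix n show "ennreal (exp (B (real (k n) / real n) \<omega>)) \<le> ennreal (exp (grid_max n \<omega>))"
      using grid_le_grid_max[OF k_le, of n \<omega>] B0 by (intro ennreal_leI) (simp add: grid_def)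
  qed
  finally show ?thesis .
qed

end

section \<open>The Brownian potential\<close>

lemma pressure_le_bound:
  fixes f :: "cantor \<Rightarrow>\<^sub>C real"
  assumes "\<And>x. f x \<le> b"
  shows "pressure f \<le> ln 2 + b"
proof (rule LIMSEQ_le_const2[OF partition_function_tendsto[of f "\<lambda>_ _. False"]], intro exI allI impI)
  fix n :: nat assume n: "n \<ge> 1"
  have "ln (partition_function f n (\<lambda>_. False)) \<le> ln ((2 * exp b) ^ n)"
    by (intro ln_mono partition_function_pos partition_function_le assms)
  also have "\<dots> = real n * (ln 2 + b)" by (simp add: ln_realpow ln_mult algebra_simps)
  finally show "ln (partition_function f n (\<lambda>_. False)) / real n \<le> ln 2 + b"
    using n by (simp add: divide_le_eq mult.commute)
qed

text \<open>The constant orbit is one of those counted by the partition function at x. It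
  corresponds to the point mass at x, an invariant measure of entropy 0.\<close>

lemma pressure_ge_fixed_point:
  fixes f :: "cantor \<Rightarrow>\<^sub>C real"
  assumes "left_shift x = x"
  shows "f x \<le> pressure f"
proof (rule LIMSEQ_le_const[OF partition_function_tendsto[of f "\<lambda>_. x"]], intro exI allI impI)
  have fix_pow: "(left_shift ^^ i) x = x" for i by (induction i) (simp_all add: assms)
  fix n :: nat assume n: "n \<ge> 1"
  have "exp (birkhoff_sum f n x) \<le> partition_function f n x"
    by (rule exp_birkhoff_le_partition_function[OF fix_pow])
  then have "birkhoff_sum f n x \<le> ln (partition_function f n x)"
    using partition_function_pos by (simp add: ln_ge_iff)
  then show "f x \<le> ln (partition_function f n x) / real n"
    using n by (simp add: birkhoff_sum_def fix_pow le_divide_eq mult.commute)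
qed

context standard_brownian_motion
begin

text \<open>Almost surely the pressure is the limit of \<open>g n\<close>, which involves only
  finitely many values of B for each n; completeness carries measurability over the exceptional
  set.\<close>

lemma borel_measurable_pressure:
  assumes "complete_measure M"
  shows "(\<lambda>\<omega>. pressure (brownian_potential B \<omega>)) \<in> borel_measurable M"
proof -
  interpret C: complete_measure M by (rule assms)
  define g where "g n \<omega> = ln (\<Sum>w\<in>words UNIV n. exp (\<Sum>i<n.
    B (binary_value ((left_shift ^^ i) (prepend_word w (\<lambda>_. False)))) \<omega>)) / real n" for n \<omega>
  have [measurable]: "B (binary_value x) \<in> borel_measurable M" for x
    by (rule random_variable[OF binary_value_range])
  have "g n \<in> borel_measurable M" for n
    unfolding g_def by measurable
  then have lim: "(\<lambda>\<omega>. lim (\<lambda>n. g n \<omega>)) \<in> borel_measurable M"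
    by (rule borel_measurable_lim_metric)
  have "AE \<omega> in M. lim (\<lambda>n. g n \<omega>) = pressure (brownian_potential B \<omega>)"
    using brownian_potential_apply
  proof eventually_elim
    case (elim \<omega>)
    have "g n \<omega> = ln (partition_function (brownian_potential B \<omega>) n (\<lambda>_. False)) / real n" for n
      by (simp add: g_def partition_function_def birkhoff_sum_def elim)
    then have "(\<lambda>n. g n \<omega>) \<longlonglongrightarrow> pressure (brownian_potential B \<omega>)"
      using partition_function_tendsto[of "brownian_potential B \<omega>" "\<lambda>_ _. False"] by simp
    then show ?case by (rule limI)
  qed
  from C.borel_measurable_AE_cong[OF lim this] show ?thesis .
qed

text \<open>The all-\<open>False\<close> sequence is fixed by the shift and has binary value 0,
  where the path vanishes. For the upper bound, the maximum of the path is reached at a time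
  depending on the path; the liminf of the grid maxima dominates it and is measurable by
  construction.\<close>

lemma AE_pressure_bounds:
  "AE \<omega> in M. 0 \<le> pressure (brownian_potential B \<omega>) \<and>
    ennreal (exp (pressure (brownian_potential B \<omega>))) \<le> 2 * liminf (\<lambda>n. ennreal (exp (grid_max n \<omega>)))"
  using brownian_potential_apply start continuous_paths
proof eventually_elim
  case (elim \<omega>)
  let ?f = "brownian_potential B \<omega>"
  have "binary_value (\<lambda>_. False) = 0" by (simp add: binary_value_def)
  then have "?f (\<lambda>_. False) = 0" using elim(1,2) by simp
  then have nonneg: "0 \<le> pressure ?f"
    using pressure_ge_fixed_point[of "\<lambda>_. False" ?f] by (simp add: left_shift_def)
  obtain s where s: "s \<in> {0..1}" "\<And>u. u \<in> {0..1} \<Longrightarrow> B u \<omega> \<le> B s \<omega>"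
    using continuous_attains_sup[OF compact_Icc _ elim(3)] by auto
  have "pressure ?f \<le> ln 2 + B s \<omega>"
    using elim(1) s(2) binary_value_range by (intro pressure_le_bound) simp
  then have "exp (pressure ?f) \<le> exp (ln 2 + B s \<omega>)" by simp
  also have "\<dots> = 2 * exp (B s \<omega>)" by (simp add: exp_add)
  finally have "ennreal (exp (pressure ?f)) \<le> 2 * ennreal (exp (B s \<omega>))"
    using ennreal_leI by (fastforce simp: ennreal_mult)
  also have "\<dots> \<le> 2 * liminf (\<lambda>n. ennreal (exp (grid_max n \<omega>)))"
    by (intro mult_left_mono exp_sup_le_liminf elim s(1)) simp
  finally show ?case using nonneg by simp
qed

text \<open>Fatou's lemma carries the uniform grid bound to the limit. Of the factor 4, one 2 counts
  the preimages and the other comes from Levy's inequality.\<close>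

lemma nn_integral_exp_pressure:
  "(\<integral>\<^sup>+\<omega>. ennreal (exp (pressure (brownian_potential B \<omega>))) \<partial>M) \<le> ennreal (4 * exp (1 / 2))"
proof -
  have m: "(\<lambda>\<omega>. ennreal (exp (grid_max n \<omega>))) \<in> borel_measurable M" for n
    using grid_max_measurable[of n] by measurable
  have "(\<integral>\<^sup>+\<omega>. ennreal (exp (pressure (brownian_potential B \<omega>))) \<partial>M)
      \<le> (\<integral>\<^sup>+\<omega>. 2 * liminf (\<lambda>n. ennreal (exp (grid_max n \<omega>))) \<partial>M)"
    by (rule nn_integral_mono_AE) (use AE_pressure_bounds in eventually_elim, simp)
  also have "\<dots> = 2 * (\<integral>\<^sup>+\<omega>. liminf (\<lambda>n. ennreal (exp (grid_max n \<omega>))) \<partial>M)"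
    by (rule nn_integral_cmult) (intro borel_measurable_liminf m)
  also have "\<dots> \<le> 2 * liminf (\<lambda>n. \<integral>\<^sup>+\<omega>. ennreal (exp (grid_max n \<omega>)) \<partial>M)"
    by (intro mult_left_mono nn_integral_liminf m) simp
  also have "liminf (\<lambda>n. \<integral>\<^sup>+\<omega>. ennreal (exp (grid_max n \<omega>)) \<partial>M)
      \<le> liminf (\<lambda>_ :: nat. ennreal (2 * exp (1 / 2)))"
    by (rule Liminf_mono, rule eventually_mono[OF eventually_gt_at_top[of 0]])
      (rule nn_integral_exp_grid_max)
  also have "\<dots> = ennreal (2 * exp (1 / 2))" by (rule Liminf_const) simp
  also have "2 * ennreal (2 * exp (1 / 2)) = ennreal (2 * (2 * exp (1 / 2)))"
    by (simp add: ennreal_mult)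
  finally show ?thesis by (simp add: mult_left_mono)
qed

lemma pressure_integrals:
  assumes "complete_measure M"
  defines "p \<equiv> \<lambda>\<omega>. pressure (brownian_potential B \<omega>)"
  shows "integrable M p" "integrable M (\<lambda>\<omega>. exp (p \<omega>))" "0 \<le> (\<integral>\<omega>. p \<omega> \<partial>M)"
    "(\<integral>\<omega>. p \<omega> \<partial>M) \<le> ln (\<integral>\<omega>. exp (p \<omega>) \<partial>M)"
    "ln (\<integral>\<omega>. exp (p \<omega>) \<partial>M) \<le> ln 4 + 1 / 2"
proof -
  have pm: "p \<in> borel_measurable M"
    unfolding p_def by (rule borel_measurable_pressure[OF assms(1)])
  have nonneg: "AE \<omega> in M. 0 \<le> p \<omega>"
    using AE_pressure_bounds unfolding p_def by eventually_elim simp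
  have bound: "(\<integral>\<^sup>+\<omega>. ennreal (exp (p \<omega>)) \<partial>M) \<le> ennreal (4 * exp (1 / 2))"
    unfolding p_def by (rule nn_integral_exp_pressure)
  show int_exp: "integrable M (\<lambda>\<omega>. exp (p \<omega>))"
    using pm le_less_trans[OF bound ennreal_less_top] by (intro integrableI_bounded) simp_all
  show int: "integrable M p"
  proof (rule Bochner_Integration.integrable_bound[OF int_exp pm])
    show "AE \<omega> in M. norm (p \<omega>) \<le> norm (exp (p \<omega>))"
      using nonneg
    proof eventually_elim
      case (elim \<omega>)
      have "p \<omega> \<le> exp (p \<omega>)" using exp_ge_add_one_self[of "p \<omega>"] by linarith
      with elim show ?case by simp
    qed
  qed
  show "0 \<le> (\<integral>\<omega>. p \<omega> \<partial>M)" by (rule integral_nonneg_AE[OF nonneg])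
  define c where "c = (\<integral>\<omega>. exp (p \<omega>) \<partial>M)"
  have "(\<integral>\<omega>. 1 \<partial>M) \<le> c"
    unfolding c_def
  proof (rule integral_mono_AE)
    show "AE \<omega> in M. 1 \<le> exp (p \<omega>)" using nonneg by eventually_elim simp
  qed (use int_exp in auto)
  then have c: "c \<ge> 1" by (simp add: prob_space)
  \<comment> \<open>Jensen's inequality in tangent form: ln lies below its tangent at c, and the
    tangent evaluated at \<open>exp (p \<omega>)\<close> integrates to ln c.\<close>
  have "(\<integral>\<omega>. p \<omega> \<partial>M) \<le> (\<integral>\<omega>. ln c + (exp (p \<omega>) / c - 1) \<partial>M)"
  proof (rule integral_mono[OF int])
    show "integrable M (\<lambda>\<omega>. ln c + (exp (p \<omega>) / c - 1))" using int_exp by simp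
    fix \<omega>
    have "ln (exp (p \<omega>) / c) \<le> exp (p \<omega>) / c - 1" using c by (intro ln_le_minus_one) simp
    then show "p \<omega> \<le> ln c + (exp (p \<omega>) / c - 1)" using c by (simp add: ln_div)
  qed
  also have "\<dots> = ln c" using int_exp c by (simp add: prob_space c_def[symmetric])
  finally show "(\<integral>\<omega>. p \<omega> \<partial>M) \<le> ln (\<integral>\<omega>. exp (p \<omega>) \<partial>M)" unfolding c_def .
  have "(\<integral>\<^sup>+\<omega>. ennreal (exp (p \<omega>)) \<partial>M) = ennreal c"
    unfolding c_def by (rule nn_integral_eq_integral[OF int_exp]) simp
  with bound have "ennreal c \<le> ennreal (4 * exp (1 / 2))" by (simp only:)
  then have "c \<le> 4 * exp (1 / 2)" by (subst (asm) ennreal_le_iff) simp_all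
  then have "ln c \<le> ln (4 * exp (1 / 2))" using c by (intro ln_mono) auto
  then show "ln (\<integral>\<omega>. exp (p \<omega>) \<partial>M) \<le> ln 4 + 1 / 2" by (simp add: c_def ln_mult)
qed

end

text \<open>Finiteness, convergence and integrability are asserted along with the equalities because
  \<open>real_of_ereal\<close>, \<open>lim\<close> and the integral also have values where they
  carry no meaning.\<close>

theorem mainTheorem6:
  fixes M :: "'w measure" and B :: "real \<Rightarrow> 'w \<Rightarrow> real"
  assumes "complete_measure M"
    and "standard_brownian_motion M B"
  shows
    "(AE \<omega> in M. \<bar>topological_pressure (brownian_potential B \<omega>)\<bar> \<noteq> \<infinity>) \<and>
     integrable M (\<lambda>\<omega>. real_of_ereal (topological_pressure (brownian_potential B \<omega>))) \<and>
     (AE \<omega> in M. bounded_linear (ruelle (brownian_potential B \<omega>)) \<and> brownian_spectral_radius B \<omega> > 0) \<and>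
     integrable M (\<lambda>\<omega>. ln (brownian_spectral_radius B \<omega>)) \<and>
     quenched_pressure M B = (\<integral>\<omega>. ln (brownian_spectral_radius B \<omega>) \<partial>M) \<and>
     (\<forall>x.
        (AE \<omega> in M. convergent (\<lambda>n. ln (apply_bcontfun
            ((ruelle (brownian_potential B \<omega>) ^^ n) (const_bcontfun 1)) ((left_shift ^^ n) x)) / real n)) \<and>
        integrable M (\<lambda>\<omega>. lim (\<lambda>n. ln (apply_bcontfun
            ((ruelle (brownian_potential B \<omega>) ^^ n) (const_bcontfun 1)) ((left_shift ^^ n) x)) / real n)) \<and>
        quenched_pressure M B = (\<integral>\<omega>. lim (\<lambda>n. ln (apply_bcontfun
            ((ruelle (brownian_potential B \<omega>) ^^ n) (const_bcontfun 1)) ((left_shift ^^ n) x)) / real n) \<partial>M)) \<and>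
     integrable M (brownian_spectral_radius B) \<and>
     0 \<le> quenched_pressure M B \<and>
     quenched_pressure M B \<le> ln (\<integral>\<omega>. brownian_spectral_radius B \<omega> \<partial>M) \<and>
     ln (\<integral>\<omega>. brownian_spectral_radius B \<omega> \<partial>M) \<le> ln 4 + 1 / 2"
proof -
  interpret standard_brownian_motion M B by (rule assms)
  have radius: "brownian_spectral_radius B = (\<lambda>\<omega>. exp (pressure (brownian_potential B \<omega>)))"
    by (rule ext) (simp add: brownian_spectral_radius_def spectral_radius_ruelle)
  have quenched: "quenched_pressure M B = (\<integral>\<omega>. pressure (brownian_potential B \<omega>) \<partial>M)"
    by (simp add: quenched_pressure_def topological_pressure_eq)
  \<comment> \<open>Here the evaluation points move with n, which is covered by the limit along
    arbitrary sequences of points.\<close>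
  have iterate_lim: "(\<lambda>n. ln (apply_bcontfun ((ruelle f ^^ n) (const_bcontfun 1)) ((left_shift ^^ n) x)) / real n)
      \<longlonglongrightarrow> pressure f" for f x
    unfolding ruelle_iterate_one by (rule partition_function_tendsto)
  show ?thesis
    unfolding quenched radius topological_pressure_eq
    using pressure_integrals[OF assms(1)]
    by (simp add: limI[OF iterate_lim] convergentI[OF iterate_lim] bounded_linear_ruelle)
qed

end
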